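(* Let $\Phi_0,\Phi_\ell:\mathcal F\subset L^2(\Omega_T)\to L^2(0,T)$ be given by $\Phi_0(F)(t):=u_x(0,t;F)$ and $\Phi_\ell(F)(t):=u_x(\ell,t;F)$, where $u(\cdot,\cdot;F)$ is the unique weak solution of the forward problem (stated in the context) with load $F$. Then $\Phi_0$ and $\Phi_\ell$ are Lipschitz continuous: for all $F_1,F_2\in\mathcal F$, $$\Vert\Phi_0(F_1)-\Phi_0(F_2)\Vert_{L^2(0,T)}\le C_L\Vert F_1-F_2\Vert_{L^2(\Omega_T)},\qquad \Vert\Phi_\ell(F_1)-\Phi_\ell(F_2)\Vert_{L^2(0,T)}\le C_L\Vert F_1-F_2\Vert_{L^2(\Omega_T)},$$ where $C_L=C_1/\sqrt{r_0}$, $C_1>0$ and $C_1^2=\frac{5\ell\rho_0}{3}\left(\exp(T/\rho_0)-1\right)$.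
   Context: Let $\ell,T>0$ and $\Omega_T=(0,\ell)\times(0,T)$. The coefficients satisfy $\rho_A,\mu,T_r,r,\kappa\in L^\infty(0,\ell)$ and there are constants with, for $x\in(0,\ell)$, $0<\rho_0\le\rho_A(x)\le\rho_1$, $0\le T_{r0}\le T_r(x)\le T_{r1}$, $0<r_0\le r(x)\le r_1$, $0\le\mu_0\le\mu(x)\le\mu_1$, $0<\kappa_0\le\kappa(x)\le\kappa_1$. Let $\mathcal V^2(0,\ell)=\{v\in H^2(0,\ell): v(0)=v(\ell)=0\}$. The set of admissible loads is $\mathcal F=\{F\in L^2(\Omega_T):\Vert F\Vert^2_{L^2(\Omega_T)}\le C_F\}$, with $C_F>0$ a fixed constant. Forward problem with load $F$: $\rho_A(x)u_{tt}+\mu(x)u_t-(T_r(x)u_x)_x+(r(x)u_{xx}+\kappa(x)u_{xxt})_{xx}=F(x,t)$ in $\Omega_T$; $u(x,0)=u_t(x,0)=0$ for $x\in(0,\ell)$; $u(0,t)=u(\ell,t)=0$ and $(r u_{xx}+\kappa u_{xxt})|_{x=0}=(r u_{xx}+\kappa u_{xxt})|_{x=\ell}=0$ for $t\in[0,T]$. A weak solution is $u\in L^2(0,T;\mathcal V^2(0,\ell))$ with $u_t\in L^2(0,T;L^2(0,\ell))$, $u_{tt}\in L^2(0,T;H^{-2}(0,\ell))$, in the usual variational sense: $u(\cdot,0)=0$ and for all $v\in H^1(0,T;\mathcal V^2(0,\ell))$ with $v(\cdot,T)=0$, $\int_0^T\int_0^\ell[-\rho_A u_tv_t+\mu u_tv+T_ru_xv_x+ru_{xx}v_{xx}-\kappa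 u_{xx}v_{xxt}]\,dx\,dt=\int_0^T\int_0^\ell Fv\,dx\,dt$. *)

theory Defs
  imports "HOL-Analysis.Analysis"
begin

text \<open>Elements of Lebesgue and Sobolev spaces are represented by functions, and all notions below
  are insensitive to changes on null sets. Functions on the space-time cylinder take pairs
  \<open>(x, t)\<close>.\<close>

definition L2 :: "'a::euclidean_space set \<Rightarrow> ('a \<Rightarrow> real) \<Rightarrow> bool" where
  "L2 S f \<longleftrightarrow> f \<in> borel_measurable (lebesgue_on S) \<and> integrable (lebesgue_on S) (\<lambda>x. (f x)\<^sup>2)"

definition L2_norm :: "'a::euclidean_space set \<Rightarrow> ('a \<Rightarrow> real) \<Rightarrow> real" where
  "L2_norm S f = sqrt (LINT x|lebesgue_on S. (f x)\<^sup>2)"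

definition L_infinity :: "'a::euclidean_space set \<Rightarrow> ('a \<Rightarrow> real) \<Rightarrow> bool" where
  "L_infinity S f \<longleftrightarrow>
    f \<in> borel_measurable (lebesgue_on S) \<and> (\<exists>C. AE x in lebesgue_on S. \<bar>f x\<bar> \<le> C)"

definition cylinder :: "real \<Rightarrow> real \<Rightarrow> (real \<times> real) set" where
  "cylinder l T = {0<..<l} \<times> {0<..<T}"

definition admissible_loads :: "real \<Rightarrow> real \<Rightarrow> real \<Rightarrow> (real \<times> real \<Rightarrow> real) set" where
  "admissible_loads l T C = {F. L2 (cylinder l T) F \<and> (L2_norm (cylinder l T) F)\<^sup>2 \<le> C}"


subsection \<open>Sobolev functions on an interval\<close>

definition test_functions :: "real \<Rightarrow> real \<Rightarrow> (real \<Rightarrow> real) set" where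
  "test_functions a b =
    {\<phi>. (\<forall>n x. ((deriv ^^ n) \<phi>) differentiable (at x)) \<and>
        (\<exists>K. compact K \<and> K \<subseteq> {a<..<b} \<and> (\<forall>x. x \<notin> K \<longrightarrow> \<phi> x = 0))}"

definition has_L2_weak_derivative ::
  "real \<Rightarrow> real \<Rightarrow> (real \<Rightarrow> real) \<Rightarrow> (real \<Rightarrow> real) \<Rightarrow> bool" where
  "has_L2_weak_derivative a b f g \<longleftrightarrow>
    L2 {a<..<b} f \<and> L2 {a<..<b} g \<and>
    (\<forall>\<phi>\<in>test_functions a b.
      (LINT x|lebesgue_on {a<..<b}. f x * deriv \<phi> x) = - (LINT x|lebesgue_on {a<..<b}. g x * \<phi> x))"

definition L2_weak_derivative :: "real \<Rightarrow> real \<Rightarrow> (real \<Rightarrow> real) \<Rightarrow> real \<Rightarrow> real" where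
  "L2_weak_derivative a b f = (SOME g. has_L2_weak_derivative a b f g)"

text \<open>Boundary values are those of the representative that is continuous on the closed interval;
  for \<open>a < b\<close> its values on \<open>{a..b}\<close> are unique whenever it exists.\<close>

definition continuous_representative :: "real \<Rightarrow> real \<Rightarrow> (real \<Rightarrow> real) \<Rightarrow> real \<Rightarrow> real" where
  "continuous_representative a b f =
    (SOME g. continuous_on {a..b} g \<and> (AE x in lebesgue_on {a<..<b}. g x = f x))"

text \<open>\<open>V2 l v v1 v2\<close>: \<open>v\<close> lies in the space of \<open>H\<^sup>2\<close> functions on \<open>(0, l)\<close> vanishing at both
  endpoints, and its first two weak derivatives are \<open>v1\<close> and \<open>v2\<close>.\<close>

definition V2 :: "real \<Rightarrow> (real \<Rightarrow> real) \<Rightarrow> (real \<Rightarrow> real) \<Rightarrow> (real \<Rightarrow> real) \<Rightarrow> bool" where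
  "V2 l v v1 v2 \<longleftrightarrow>
    has_L2_weak_derivative 0 l v v1 \<and> has_L2_weak_derivative 0 l v1 v2 \<and>
    continuous_representative 0 l v 0 = 0 \<and> continuous_representative 0 l v l = 0"


subsection \<open>Spaces of time-dependent functions\<close>

text \<open>Square-integrable functions of \<open>t\<close> with values in \<open>L\<^sup>2(0, l)\<close> are identified with
  square-integrable functions on the cylinder. \<open>L2_V2 l T v v1 v2\<close> says that \<open>v\<close> is a
  square-integrable function of \<open>t\<close> with values in the space of \<^const>\<open>V2\<close>, and that
  its weak derivatives in \<open>x\<close> are \<open>v1\<close> and \<open>v2\<close>.\<close>

definition L2_V2 ::
  "real \<Rightarrow> real \<Rightarrow> (real \<times> real \<Rightarrow> real) \<Rightarrow> (real \<times> real \<Rightarrow> real) \<Rightarrow> (real \<times> real \<Rightarrow> real) \<Rightarrow> bool"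
where
  "L2_V2 l T v v1 v2 \<longleftrightarrow>
    L2 (cylinder l T) v \<and> L2 (cylinder l T) v1 \<and> L2 (cylinder l T) v2 \<and>
    (AE t in lebesgue_on {0<..<T}. V2 l (\<lambda>x. v (x, t)) (\<lambda>x. v1 (x, t)) (\<lambda>x. v2 (x, t)))"

text \<open>The weak time derivative of an \<open>L\<^sup>2(0, l)\<close>-valued function: for each scalar test function of
  \<open>t\<close> the two integrals agree as elements of \<open>L\<^sup>2(0, l)\<close>, that is, for almost every \<open>x\<close>.\<close>

definition has_time_derivative ::
  "real \<Rightarrow> real \<Rightarrow> (real \<times> real \<Rightarrow> real) \<Rightarrow> (real \<times> real \<Rightarrow> real) \<Rightarrow> bool" where
  "has_time_derivative l T v w \<longleftrightarrow>
    L2 (cylinder l T) v \<and> L2 (cylinder l T) w \<and>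
    (\<forall>\<theta>\<in>test_functions 0 T. AE x in lebesgue_on {0<..<l}.
      (LINT t|lebesgue_on {0<..<T}. v (x, t) * deriv \<theta> t)
        = - (LINT t|lebesgue_on {0<..<T}. w (x, t) * \<theta> t))"

text \<open>\<open>v(\<cdot>, s) = 0\<close> for the representative of \<open>v\<close> that is continuous from \<open>{0..T}\<close> to \<open>L\<^sup>2(0, l)\<close>.\<close>

definition vanishes_at_time :: "real \<Rightarrow> real \<Rightarrow> (real \<times> real \<Rightarrow> real) \<Rightarrow> real \<Rightarrow> bool" where
  "vanishes_at_time l T v s \<longleftrightarrow>
    (\<exists>w. (\<forall>t\<in>{0..T}. L2 {0<..<l} (\<lambda>x. w (x, t))) \<and>
         (\<forall>t\<in>{0..T}. ((\<lambda>t'. L2_norm {0<..<l} (\<lambda>x. w (x, t') - w (x, t))) \<longlongrightarrow> 0) (at t within {0..T})) \<and>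
         (AE t in lebesgue_on {0<..<T}. AE x in lebesgue_on {0<..<l}. w (x, t) = v (x, t)) \<and>
         (AE x in lebesgue_on {0<..<l}. w (x, s) = 0))"

definition H2_norm :: "real \<Rightarrow> (real \<Rightarrow> real) \<Rightarrow> real" where
  "H2_norm l \<phi> = sqrt ((L2_norm {0<..<l} \<phi>)\<^sup>2 + (L2_norm {0<..<l} (deriv \<phi>))\<^sup>2
    + (L2_norm {0<..<l} (deriv (deriv \<phi>)))\<^sup>2)"

text \<open>\<open>H\<^sup>-\<^sup>2(0, l)\<close> is the dual of the closure of the test functions in \<open>H\<^sup>2(0, l)\<close>, so its elements are
  given by the linear functionals on test functions that are bounded for \<^const>\<open>H2_norm\<close>. As this
  space is a separable Hilbert space, a function of \<open>t\<close> with values in it is measurable iff it is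
  weakly measurable.\<close>

definition L2_Hminus2 :: "real \<Rightarrow> real \<Rightarrow> (real \<Rightarrow> (real \<Rightarrow> real) \<Rightarrow> real) \<Rightarrow> bool" where
  "L2_Hminus2 l T g \<longleftrightarrow>
    (\<forall>\<phi>\<in>test_functions 0 l. (\<lambda>t. g t \<phi>) \<in> borel_measurable (lebesgue_on {0<..<T})) \<and>
    (\<exists>C. L2 {0<..<T} C \<and>
      (AE t in lebesgue_on {0<..<T}.
        (\<forall>\<phi>\<in>test_functions 0 l. \<forall>\<psi>\<in>test_functions 0 l. \<forall>a b.
          g t (\<lambda>x. a * \<phi> x + b * \<psi> x) = a * g t \<phi> + b * g t \<psi>) \<and>
        (\<forall>\<phi>\<in>test_functions 0 l. \<bar>g t \<phi>\<bar> \<le> C t * H2_norm l \<phi>)))"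

definition has_time_derivative_Hminus2 ::
  "real \<Rightarrow> real \<Rightarrow> (real \<times> real \<Rightarrow> real) \<Rightarrow> (real \<Rightarrow> (real \<Rightarrow> real) \<Rightarrow> real) \<Rightarrow> bool" where
  "has_time_derivative_Hminus2 l T w g \<longleftrightarrow>
    L2 (cylinder l T) w \<and> L2_Hminus2 l T g \<and>
    (\<forall>\<phi>\<in>test_functions 0 l. \<forall>\<theta>\<in>test_functions 0 T.
      (LINT (x, t)|lebesgue_on (cylinder l T). w (x, t) * \<phi> x * deriv \<theta> t)
        = - (LINT t|lebesgue_on {0<..<T}. g t \<phi> * \<theta> t))"


subsection \<open>Weak solutions of the beam equation\<close>

text \<open>The initial condition on \<open>u\<^sub>t\<close> and the moment conditions at both ends are natural conditions,
  contained in the variational equation because \<open>v(\<cdot>, 0)\<close> and \<open>v\<^sub>x\<close> at the ends are free.\<close>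

definition weak_solution ::
  "real \<Rightarrow> real \<Rightarrow> (real \<Rightarrow> real) \<Rightarrow> (real \<Rightarrow> real) \<Rightarrow> (real \<Rightarrow> real) \<Rightarrow> (real \<Rightarrow> real) \<Rightarrow> (real \<Rightarrow> real)
    \<Rightarrow> (real \<times> real \<Rightarrow> real) \<Rightarrow> (real \<times> real \<Rightarrow> real) \<Rightarrow> bool" where
  "weak_solution l T \<rho>\<^sub>A \<mu> T\<^sub>r r \<kappa> F u \<longleftrightarrow>
    (\<exists>u\<^sub>x u\<^sub>x\<^sub>x u\<^sub>t u\<^sub>t\<^sub>t.
      L2_V2 l T u u\<^sub>x u\<^sub>x\<^sub>x \<and> has_time_derivative l T u u\<^sub>t \<and>
      has_time_derivative_Hminus2 l T u\<^sub>t u\<^sub>t\<^sub>t \<and>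
      vanishes_at_time l T u 0 \<and>
      (\<forall>v v\<^sub>x v\<^sub>x\<^sub>x v\<^sub>t v\<^sub>x\<^sub>t v\<^sub>x\<^sub>x\<^sub>t.
        L2_V2 l T v v\<^sub>x v\<^sub>x\<^sub>x \<and> has_time_derivative l T v v\<^sub>t \<and> L2_V2 l T v\<^sub>t v\<^sub>x\<^sub>t v\<^sub>x\<^sub>x\<^sub>t \<and>
        vanishes_at_time l T v T \<longrightarrow>
        (LINT (x, t)|lebesgue_on (cylinder l T).
            - \<rho>\<^sub>A x * u\<^sub>t (x, t) * v\<^sub>t (x, t) + \<mu> x * u\<^sub>t (x, t) * v (x, t)
            + T\<^sub>r x * u\<^sub>x (x, t) * v\<^sub>x (x, t) + r x * u\<^sub>x\<^sub>x (x, t) * v\<^sub>x\<^sub>x (x, t)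
            - \<kappa> x * u\<^sub>x\<^sub>x (x, t) * v\<^sub>x\<^sub>x\<^sub>t (x, t))
        = (LINT (x, t)|lebesgue_on (cylinder l T). F (x, t) * v (x, t))))"

text \<open>\<open>boundary_slope l u y t\<close> is \<open>u\<^sub>x(y, t)\<close> for an endpoint \<open>y \<in> {0, l}\<close>.\<close>

definition boundary_slope :: "real \<Rightarrow> (real \<times> real \<Rightarrow> real) \<Rightarrow> real \<Rightarrow> real \<Rightarrow> real" where
  "boundary_slope l u y t =
    continuous_representative 0 l (L2_weak_derivative 0 l (\<lambda>x. u (x, t))) y"

end

theory Submission
  imports Defs "HOL-Computational_Algebra.Polynomial"
begin

text \<open>Let \<open>u\<close> be the difference of the two solutions and \<open>h\<close> its second derivative in \<open>x\<close>. Then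
  \<open>u = G h\<close> with the Green operator \<open>G\<close> of the second derivative under Dirichlet conditions, and the
  slopes at the ends are integrals of \<open>h\<close> against weights with squared norm \<open>l / 3\<close>. So it suffices to
  bound \<open>h\<close> by the load.

  A weak solution is too irregular in time to be used as a test function in the energy identity. Let
  \<open>R\<close> be the exponential average over the past, so that \<open>w = R u\<close> solves \<open>\<epsilon> w' + w = u\<close>, \<open>w(0) = 0\<close>.
  It commutes with \<open>G\<close>, and its adjoint, the average over the future, maps the square-integrable
  functions of \<open>t\<close> with values in the space of \<^const>\<open>V2\<close> to admissible test functions. The test
  function is the adjoint applied to \<open>\<phi> w'\<close> with \<open>\<phi>(t) = exp ((T - t) / \<rho>\<^sub>0) - 1 + a\<close>. Since
  \<open>\<phi> \<le> - \<rho>\<^sub>0 \<phi>'\<close>, the term with the load is absorbed by the kinetic energy without Gronwall's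
  inequality. As \<open>\<phi>(T) = a > 0\<close>, the damping bounds \<open>\<partial>\<^sub>t R h\<close> uniformly in \<open>\<epsilon>\<close>, and
  \<open>h = R h + \<epsilon> \<partial>\<^sub>t R h\<close> allows passing to the limit. The factor 5 of the claim leaves room for the
  crude choices of \<open>a\<close> and of the splitting of the square.\<close>

text \<open>The obstacle is regularity in time: u_tt is only a functional on test functions and no
  u_xxt is given, so the equation cannot be multiplied by u_t. An exponential average suits this
  better than a symmetric mollifier because it respects the time interval. Averaging over the past
  builds in the value 0 at the start, its adjoint vanishes at T as test functions must, and its time
  derivative (f - R f) / \<epsilon> is square integrable although f is never differentiated. Taking
  h as the unknown removes the boundary conditions in x, since every square-integrable h yields an
  admissible G h. What remains of the kinematics is one identity: G h is the time primitive of u_t.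
  The exponential in the constant comes from the weight. Splitting the load term into two halves of
  squares asks for a weight that is at most \<open>\<rho>\<^sub>0\<close> times minus its
  derivative, which suggests exp ((T - t) / \<open>\<rho>\<^sub>0\<close>). The maximum of the
  weight multiplies the load, hence the subtraction of 1; the lower bound 1 /
  \<open>\<rho>\<^sub>0\<close> of minus its derivative is what multiplies the square of h.\<close>

section \<open>Square-integrable Borel functions vanishing outside a set\<close>

text \<open>Borel instead of Lebesgue measurability keeps sections and products measurable in the
  plane. Vanishing outside \<open>S\<close> turns integrals over \<open>S\<close> into integrals
  over the whole space.\<close>

definition borel_L2 :: "'a::euclidean_space set \<Rightarrow> ('a \<Rightarrow> real) set" where
  "borel_L2 S = {f \<in> borel_measurable borel. integrable lborel (\<lambda>x. (f x)\<^sup>2) \<and> (\<forall>x. x \<notin> S \<longrightarrow> f x = 0)}"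

lemma borel_L2_measurable [measurable_dest]: "f \<in> borel_L2 S \<Longrightarrow> f \<in> borel_measurable borel"
  and borel_L2_square_integrable: "f \<in> borel_L2 S \<Longrightarrow> integrable lborel (\<lambda>x. (f x)\<^sup>2)"
  and borel_L2_outside: "f \<in> borel_L2 S \<Longrightarrow> x \<notin> S \<Longrightarrow> f x = 0"
  by (auto simp: borel_L2_def)

lemma integrable_mult_square:
  fixes f g :: "'a \<Rightarrow> real"
  assumes [measurable]: "f \<in> borel_measurable M" "g \<in> borel_measurable M"
    and "integrable M (\<lambda>x. (f x)\<^sup>2)" "integrable M (\<lambda>x. (g x)\<^sup>2)"
  shows "integrable M (\<lambda>x. f x * g x)"
proof (rule Bochner_Integration.integrable_bound)
  show "integrable M (\<lambda>x. (f x)\<^sup>2 + (g x)\<^sup>2)" using assms by simp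
  have "norm (f x * g x) \<le> norm ((f x)\<^sup>2 + (g x)\<^sup>2)" for x
  proof -
    have "2 * (\<bar>f x\<bar> * \<bar>g x\<bar>) \<le> (f x)\<^sup>2 + (g x)\<^sup>2"
      using sum_squares_bound[of "\<bar>f x\<bar>" "\<bar>g x\<bar>"] by simp
    moreover have "0 \<le> \<bar>f x\<bar> * \<bar>g x\<bar>" by simp
    ultimately have "\<bar>f x\<bar> * \<bar>g x\<bar> \<le> (f x)\<^sup>2 + (g x)\<^sup>2" by linarith
    then show ?thesis by (simp add: abs_mult)
  qed
  then show "AE x in M. norm (f x * g x) \<le> norm ((f x)\<^sup>2 + (g x)\<^sup>2)" by simp
qed measurable

lemma Cauchy_Schwarz_integral:
  fixes f g :: "'a \<Rightarrow> real"
  assumes [measurable]: "f \<in> borel_measurable M" "g \<in> borel_measurable M"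
    and f: "integrable M (\<lambda>x. (f x)\<^sup>2)" and g: "integrable M (\<lambda>x. (g x)\<^sup>2)"
  shows "(LINT x|M. f x * g x)\<^sup>2 \<le> (LINT x|M. (f x)\<^sup>2) * (LINT x|M. (g x)\<^sup>2)"
proof -
  define A where "A = (LINT x|M. (g x)\<^sup>2)"
  define B where "B = (LINT x|M. f x * g x)"
  note fg = integrable_mult_square[OF assms]
  have A0: "A \<ge> 0" by (simp add: A_def)
  show ?thesis
  proof (cases "A = 0")
    case True
    then have "AE x in M. (g x)\<^sup>2 = 0"
      unfolding A_def using g by (subst (asm) integral_nonneg_eq_0_iff_AE) auto
    then have "B = (LINT x|M. 0)" unfolding B_def by (intro integral_cong_AE) auto
    with True show ?thesis by (simp add: A_def B_def)
  next
    case False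
    \<comment> \<open>\<open>A * f - B * g\<close> is \<open>A\<close> times the component of
      \<open>f\<close> orthogonal to \<open>g\<close>; scaling by \<open>A\<close> avoids a
      division.\<close>
    have "0 \<le> (LINT x|M. (A * f x - B * g x)\<^sup>2)" by simp
    also have "\<dots> = (LINT x|M. A\<^sup>2 * (f x)\<^sup>2 - 2 * A * B * (f x * g x) + B\<^sup>2 * (g x)\<^sup>2)"
      by (intro arg_cong[where f="integral\<^sup>L M"]) (auto simp: power2_eq_square algebra_simps)
    also have "\<dots> = A\<^sup>2 * (LINT x|M. (f x)\<^sup>2) - 2 * A * B * B + B\<^sup>2 * A"
      using f g fg by (simp add: A_def B_def)
    also have "\<dots> = A * (A * (LINT x|M. (f x)\<^sup>2) - B\<^sup>2)"
      by (simp add: power2_eq_square algebra_simps)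
    finally have "0 \<le> A * (LINT x|M. (f x)\<^sup>2) - B\<^sup>2"
      using False A0 by (metis less_eq_real_def zero_le_mult_iff not_less)
    then show ?thesis by (simp add: A_def B_def mult.commute)
  qed
qed

lemma borel_L2_mult_integrable:
  "f \<in> borel_L2 S \<Longrightarrow> g \<in> borel_L2 S' \<Longrightarrow> integrable lborel (\<lambda>x. f x * g x)"
  using borel_L2_measurable borel_L2_square_integrable
  by (intro integrable_mult_square) auto

lemma borel_L2_bounded_mult:
  assumes f: "f \<in> borel_L2 S" and [measurable]: "c \<in> borel_measurable borel" and c: "\<And>x. \<bar>c x\<bar> \<le> B"
  shows "(\<lambda>x. c x * f x) \<in> borel_L2 S"
proof -
  have [measurable]: "f \<in> borel_measurable borel" using f by (rule borel_L2_measurable)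
  have "integrable lborel (\<lambda>x. (c x * f x)\<^sup>2)"
  proof (rule Bochner_Integration.integrable_bound)
    show "integrable lborel (\<lambda>x. B\<^sup>2 * (f x)\<^sup>2)" using borel_L2_square_integrable[OF f] by simp
    have "(c x)\<^sup>2 \<le> B\<^sup>2" for x using c[of x] by (simp add: abs_le_square_iff[symmetric])
    then show "AE x in lborel. norm ((c x * f x)\<^sup>2) \<le> norm (B\<^sup>2 * (f x)\<^sup>2)"
      by (auto simp: power_mult_distrib intro!: mult_right_mono)
  qed measurable
  then show ?thesis using borel_L2_outside[OF f] by (auto simp: borel_L2_def)
qed

lemma borel_L2_add: 
  assumes f: "f \<in> borel_L2 S" and g: "g \<in> borel_L2 S"
  shows "(\<lambda>x. f x + g x) \<in> borel_L2 S"
proof -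
  have [measurable]: "f \<in> borel_measurable borel" "g \<in> borel_measurable borel"
    using f g by (auto intro: borel_L2_measurable)
  have "integrable lborel (\<lambda>x. (f x)\<^sup>2 + 2 * (f x * g x) + (g x)\<^sup>2)"
    using borel_L2_square_integrable[OF f] borel_L2_square_integrable[OF g]
      borel_L2_mult_integrable[OF f g] by simp
  then have "integrable lborel (\<lambda>x. (f x + g x)\<^sup>2)"
    by (rule back_subst[where P="integrable lborel"]) (auto simp: power2_eq_square algebra_simps)
  then show ?thesis using borel_L2_outside[OF f] borel_L2_outside[OF g] by (auto simp: borel_L2_def)
qed

lemma borel_L2_scale: "f \<in> borel_L2 S \<Longrightarrow> (\<lambda>x. c * f x) \<in> borel_L2 S"
  by (rule borel_L2_bounded_mult) auto

lemma borel_L2_diff: 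
  assumes "f \<in> borel_L2 S" "g \<in> borel_L2 S"
  shows "(\<lambda>x. f x - g x) \<in> borel_L2 S"
  using borel_L2_add[OF assms(1) borel_L2_scale[OF assms(2), of "-1"]] by simp

lemma indicator_cbox_borel_L2: "(indicator (cbox a b) :: 'a::euclidean_space \<Rightarrow> real) \<in> borel_L2 (cbox a b)"
proof -
  have "(\<lambda>x. (indicat_real (cbox a b) x)\<^sup>2) = indicator (cbox a b)" by (auto simp: indicator_def fun_eq_iff)
  moreover have "integrable lborel (indicat_real (cbox a b))"
    using emeasure_lborel_cbox_finite[of a b] by (intro integrable_real_indicator) auto
  ultimately show ?thesis by (auto simp: borel_L2_def)
qed

text \<open>Paired with the indicator of a box containing \<open>S\<close>, the function becomes a
  product of two square-integrable ones.\<close>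

lemma borel_L2_integrable:
  assumes f: "f \<in> borel_L2 S" and S: "bounded S"
  shows "integrable lborel f"
proof -
  obtain a where a: "S \<subseteq> cbox (-a) a" using S bounded_subset_cbox_symmetric by blast
  from borel_L2_mult_integrable[OF f indicator_cbox_borel_L2[of "-a" a]] show ?thesis
    by (rule back_subst[where P="integrable lborel"])
       (use a borel_L2_outside[OF f] in \<open>auto simp: indicator_def fun_eq_iff\<close>)
qed

lemma borel_L2_bounded:
  assumes [measurable]: "f \<in> borel_measurable borel" and "\<And>x. \<bar>f x\<bar> \<le> B" "\<And>x. x \<notin> S \<Longrightarrow> f x = 0"
    and S: "bounded S"
  shows "f \<in> borel_L2 S"
proof -
  obtain a where a: "S \<subseteq> cbox (-a) a" using S bounded_subset_cbox_symmetric by blast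
  have "(\<lambda>x. f x * indicator (cbox (-a) a) x) \<in> borel_L2 (cbox (-a) a)"
    by (rule borel_L2_bounded_mult[OF indicator_cbox_borel_L2 _ assms(2)]) simp
  moreover have "(\<lambda>x. f x * indicator (cbox (-a) a) x) = f"
    using a assms(3) by (force simp: indicator_def fun_eq_iff)
  ultimately show ?thesis using assms(3) by (auto simp: borel_L2_def)
qed

lemma borel_L2_cong_AE:
  assumes f: "f \<in> borel_L2 S" and [measurable]: "g \<in> borel_measurable borel"
    and "AE x in lborel. f x = g x" and "\<And>x. x \<notin> S \<Longrightarrow> g x = 0"
  shows "g \<in> borel_L2 S"
proof -
  have [measurable]: "f \<in> borel_measurable borel" using f by (rule borel_L2_measurable)
  have "integrable lborel (\<lambda>x. (g x)\<^sup>2)"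
    by (rule integrable_cong_AE_imp[OF borel_L2_square_integrable[OF f]]) (use assms in auto)
  then show ?thesis using assms(4) by (simp add: borel_L2_def)
qed

subsection \<open>Lebesgue measurable functions and their Borel representatives\<close>

lemma AE_lebesgue_on_iff:
  assumes "S \<in> sets borel"
  shows "(AE x in lebesgue_on S. P x) \<longleftrightarrow> (AE x in lborel. x \<in> S \<longrightarrow> P x)"
  using assms by (subst AE_restrict_space_iff) (auto simp: AE_completion_iff)

lemma borel_representative_ex:
  assumes "f \<in> borel_measurable (lebesgue_on S)" and [measurable]: "S \<in> sets borel"
  obtains f' :: "'a::euclidean_space \<Rightarrow> real"
    where "f' \<in> borel_measurable borel" "\<And>x. x \<notin> S \<Longrightarrow> f' x = 0" "AE x in lebesgue_on S. f x = f' x"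
proof -
  have "(\<lambda>x. if x \<in> S then f x else 0) \<in> borel_measurable lebesgue"
    using assms by (subst borel_measurable_if) auto
  then obtain g where [measurable]: "g \<in> borel_measurable lborel"
    and g: "AE x in lborel. (if x \<in> S then f x else 0) = g x"
    using completion_ex_borel_measurable_real by blast
  show ?thesis
  proof
    show "(\<lambda>x. if x \<in> S then g x else 0) \<in> borel_measurable borel" by measurable
    show "AE x in lebesgue_on S. f x = (if x \<in> S then g x else 0)"
      unfolding AE_lebesgue_on_iff[OF \<open>S \<in> sets borel\<close>] using g by eventually_elim auto
  qed auto
qed

text \<open>Completeness of Lebesgue measure: the preimages under the two functions differ by a
  subset of a null set.\<close>

lemma borel_measurable_lebesgue_on_AE:
  fixes f :: "'a::euclidean_space \<Rightarrow> real"
  assumes [measurable]: "g \<in> borel_measurable borel" and S: "S \<in> sets borel"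
    and ae: "AE x in lebesgue_on S. f x = g x"
  shows "f \<in> borel_measurable (lebesgue_on S)"
proof -
  let ?f = "\<lambda>x. if x \<in> S then f x else 0" and ?g = "\<lambda>x. if x \<in> S then g x else 0"
  have "?g \<in> borel_measurable borel" using S by measurable
  then have g: "?g \<in> borel_measurable lebesgue" by (simp add: measurable_completion)
  have "AE x in lebesgue. ?f x = ?g x"
    using AE_completion[OF ae[unfolded AE_lebesgue_on_iff[OF S]]] by eventually_elim simp
  then obtain N where N: "N \<in> null_sets lebesgue" and sub: "{x. ?f x \<noteq> ?g x} \<subseteq> N"
    by (elim AE_E3) auto
  have "?f \<in> borel_measurable lebesgue"
  proof (rule measurableI)
    fix A :: "real set" assume A: "A \<in> sets borel"
    have eq: "?f -` A \<inter> space lebesgue = ((?g -` A \<inter> space lebesgue) - N) \<union> (N \<inter> ?f -` A)"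
      using sub by auto
    have "?g -` A \<inter> space lebesgue \<in> sets lebesgue" using g A by (rule measurable_sets)
    moreover have "N \<inter> ?f -` A \<in> sets lebesgue" using N by (rule completion.complete[rotated]) auto
    ultimately show "?f -` A \<inter> space lebesgue \<in> sets lebesgue"
      unfolding eq by (intro sets.Un sets.Diff null_setsD2[OF N])
  qed simp
  then show ?thesis using S by (subst (asm) borel_measurable_if) auto
qed

text \<open>The bridge from the notions of the theorem, which live on \<open>lebesgue_on S\<close>,
  to integrals of Borel functions against \<open>lborel\<close>, where Fubini applies.\<close>

lemma integral_lebesgue_on_eq:
  fixes f :: "'a::euclidean_space \<Rightarrow> real"
  assumes [measurable]: "f' \<in> borel_measurable borel" and S: "S \<in> sets borel"
    and ae: "AE x in lebesgue_on S. f x = f' x" and out: "\<And>x. x \<notin> S \<Longrightarrow> f' x = 0"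
  shows "(LINT x|lebesgue_on S. f x) = (LINT x|lborel. f' x)"
    and "integrable (lebesgue_on S) f \<longleftrightarrow> integrable lborel f'"
proof -
  have fm: "f \<in> borel_measurable (lebesgue_on S)"
    using assms by (intro borel_measurable_lebesgue_on_AE)
  have f'm: "f' \<in> borel_measurable (lebesgue_on S)"
    using S by (simp add: measurable_restrict_space1 measurable_completion)
  have eq: "(\<lambda>x. indicator S x *\<^sub>R f' x) = f'" using out by (auto simp: indicator_def fun_eq_iff)
  have "(LINT x|lebesgue_on S. f x) = (LINT x|lebesgue_on S. f' x)"
    using fm f'm ae by (rule integral_cong_AE)
  also have "\<dots> = (LINT x|lebesgue. f' x)"
    using S eq by (subst integral_restrict_space) auto
  finally show "(LINT x|lebesgue_on S. f x) = (LINT x|lborel. f' x)"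
    by (simp add: integral_completion)
  have "integrable (lebesgue_on S) f \<longleftrightarrow> integrable (lebesgue_on S) f'"
    using fm f'm ae by (rule integrable_cong_AE)
  also have "\<dots> \<longleftrightarrow> integrable lebesgue f'"
    using S eq by (subst integrable_restrict_space) auto
  finally show "integrable (lebesgue_on S) f \<longleftrightarrow> integrable lborel f'"
    by (simp add: integrable_completion)
qed

lemma borel_L2_imp_L2:
  assumes f: "f' \<in> borel_L2 S" and S: "S \<in> sets borel" and ae: "AE x in lebesgue_on S. f x = f' x"
  shows "L2 S f" and "L2_norm S f = sqrt (LINT x|lborel. (f' x)\<^sup>2)"
proof -
  have [measurable]: "f' \<in> borel_measurable borel" using f by (rule borel_L2_measurable)
  have ae2: "AE x in lebesgue_on S. (f x)\<^sup>2 = (f' x)\<^sup>2" using ae by eventually_elim simp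
  have out: "\<And>x. x \<notin> S \<Longrightarrow> (f' x)\<^sup>2 = 0" using borel_L2_outside[OF f] by simp
  show "L2 S f" unfolding L2_def
    using borel_measurable_lebesgue_on_AE[OF _ S ae] borel_L2_square_integrable[OF f]
      integral_lebesgue_on_eq(2)[OF _ S ae2 out] by simp
  show "L2_norm S f = sqrt (LINT x|lborel. (f' x)\<^sup>2)" unfolding L2_norm_def
    using integral_lebesgue_on_eq(1)[OF _ S ae2 out] by simp
qed

lemma L2_obtain_borel:
  assumes f: "L2 S f" and S: "S \<in> sets borel"
  obtains f' where "f' \<in> borel_L2 S" "AE x in lebesgue_on S. f x = f' x"
proof -
  obtain f' where f': "f' \<in> borel_measurable borel" "\<And>x. x \<notin> S \<Longrightarrow> f' x = 0"
    "AE x in lebesgue_on S. f x = f' x"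
    using borel_representative_ex f S unfolding L2_def by blast
  have [measurable]: "f' \<in> borel_measurable borel" by fact
  have ae2: "AE x in lebesgue_on S. (f x)\<^sup>2 = (f' x)\<^sup>2" using f'(3) by eventually_elim simp
  have "integrable lborel (\<lambda>x. (f' x)\<^sup>2)"
    using integral_lebesgue_on_eq(2)[OF _ S ae2] f f'(2) by (simp add: L2_def)
  then show ?thesis using f' by (intro that) (auto simp: borel_L2_def)
qed

subsection \<open>Sections of functions on the plane\<close>

lemma AE_plane_sections:
  assumes "AE p in (lborel :: (real \<times> real) measure). P p"
  shows "AE x in lborel. AE t in lborel. P (x, t)" "AE t in lborel. AE x in lborel. P (x, t)"
proof -
  have 1: "AE p in lborel \<Otimes>\<^sub>M (lborel :: real measure). P p" using assms unfolding lborel_prod .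
  show "AE x in lborel. AE t in lborel. P (x, t)" by (rule lborel_pair.AE_pair[OF 1])
  have "AE p in distr (lborel \<Otimes>\<^sub>M lborel) (lborel \<Otimes>\<^sub>M lborel) (\<lambda>(x, y). (y, x :: real)). P p"
    by (subst lborel_pair.distr_pair_swap[symmetric]) (rule 1)
  from AE_distrD[OF measurable_pair_swap' this]
  have "AE p in lborel \<Otimes>\<^sub>M (lborel :: real measure). P (case p of (x, y) \<Rightarrow> (y, x))" .
  from lborel_pair.AE_pair[OF this] show "AE t in lborel. AE x in lborel. P (x, t)" by simp
qed

text \<open>Null sections give a null set in the plane only if the exceptional set is measurable,
  which is why Borel functions are compared.\<close>

lemma AE_plane_eqI:
  fixes f g :: "real \<times> real \<Rightarrow> real"
  assumes [measurable]: "f \<in> borel_measurable borel" "g \<in> borel_measurable borel"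
  shows "AE x in lborel. AE t in lborel. f (x, t) = g (x, t) \<Longrightarrow> AE p in lborel. f p = g p"
    and "AE t in lborel. AE x in lborel. f (x, t) = g (x, t) \<Longrightarrow> AE p in lborel. f p = g p"
proof -
  have [measurable]: "f \<in> borel_measurable (lborel \<Otimes>\<^sub>M lborel)" "g \<in> borel_measurable (lborel \<Otimes>\<^sub>M lborel)"
    using assms by (auto simp: lborel_prod)
  show 1: "AE p in lborel. f p = g p" if "AE x in lborel. AE t in lborel. f (x, t) = g (x, t)"
    unfolding lborel_prod[symmetric]
    by (rule lborel_pair.AE_pair_measure) (use that in measurable)
  show "AE p in lborel. f p = g p" if "AE t in lborel. AE x in lborel. f (x, t) = g (x, t)"
  proof (rule 1)
    have "(AE x in lborel. AE t in lborel. f (x, t) = g (x, t))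
        \<longleftrightarrow> (AE t in lborel. AE x in lborel. f (x, t) = g (x, t))"
    proof (rule lborel_pair.AE_commute)
      have "{p \<in> space (lborel \<Otimes>\<^sub>M lborel). f p = g p} \<in> sets (lborel \<Otimes>\<^sub>M lborel)" by measurable
      then show "{p \<in> space (lborel \<Otimes>\<^sub>M lborel). f (fst p, snd p) = g (fst p, snd p)} \<in> sets (lborel \<Otimes>\<^sub>M lborel)"
        by simp
    qed
    then show "AE x in lborel. AE t in lborel. f (x, t) = g (x, t)" using that by simp
  qed
qed

lemma integrable_plane:
  fixes f :: "real \<times> real \<Rightarrow> real"
  assumes "integrable lborel f"
  shows "AE x in lborel. integrable lborel (\<lambda>t. f (x, t))" "AE t in lborel. integrable lborel (\<lambda>x. f (x, t))"
    "integrable lborel (\<lambda>x. LINT t|lborel. f (x, t))" "integrable lborel (\<lambda>t. LINT x|lborel. f (x, t))"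
    "(LINT x|lborel. LINT t|lborel. f (x, t)) = (LINT p|lborel. f p)"
    "(LINT t|lborel. LINT x|lborel. f (x, t)) = (LINT p|lborel. f p)"
proof -
  have 1: "integrable (lborel \<Otimes>\<^sub>M lborel) (\<lambda>(x, t). f (x, t))" using assms by (simp add: lborel_prod)
  show "AE x in lborel. integrable lborel (\<lambda>t. f (x, t))" by (rule lborel_pair.AE_integrable_fst[OF 1])
  show "AE t in lborel. integrable lborel (\<lambda>x. f (x, t))" by (rule lborel_pair.AE_integrable_snd[OF 1])
  show "integrable lborel (\<lambda>x. LINT t|lborel. f (x, t))" by (rule lborel_pair.integrable_fst[OF 1])
  show "integrable lborel (\<lambda>t. LINT x|lborel. f (x, t))" by (rule lborel_pair.integrable_snd[OF 1])
  show "(LINT x|lborel. LINT t|lborel. f (x, t)) = (LINT p|lborel. f p)"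
    using lborel_pair.integral_fst[OF 1] by (simp add: lborel_prod)
  show "(LINT t|lborel. LINT x|lborel. f (x, t)) = (LINT p|lborel. f p)"
    using lborel_pair.integral_snd[OF 1] by (simp add: lborel_prod)
qed

lemma borel_L2_sections:
  fixes f :: "real \<times> real \<Rightarrow> real"
  assumes f: "f \<in> borel_L2 (X \<times> Y)"
  shows "AE x in lborel. (\<lambda>t. f (x, t)) \<in> borel_L2 Y" "AE t in lborel. (\<lambda>x. f (x, t)) \<in> borel_L2 X"
proof -
  have [measurable]: "f \<in> borel_measurable (borel \<Otimes>\<^sub>M borel)"
    using borel_L2_measurable[OF f] by (simp add: borel_prod)
  note i = integrable_plane[OF borel_L2_square_integrable[OF f]]
  show "AE x in lborel. (\<lambda>t. f (x, t)) \<in> borel_L2 Y"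
    using i(1) by eventually_elim (use borel_L2_outside[OF f] in \<open>auto simp: borel_L2_def\<close>)
  show "AE t in lborel. (\<lambda>x. f (x, t)) \<in> borel_L2 X"
    using i(2) by eventually_elim (use borel_L2_outside[OF f] in \<open>auto simp: borel_L2_def\<close>)
qed

subsection \<open>Integral operators with bounded kernels\<close>

text \<open>Boundedness lets the operator act on every integrable function and have a meaningful
  value at every point, so that many identities hold without exceptional sets. The support condition
  makes its values vanish outside \<open>J\<close>.\<close>

definition kernel_on :: "real set \<Rightarrow> (real \<times> real \<Rightarrow> real) \<Rightarrow> bool" where
  "kernel_on J k \<longleftrightarrow> k \<in> borel_measurable borel \<and> (\<exists>B. \<forall>p. \<bar>k p\<bar> \<le> B) \<and> (\<forall>p. p \<notin> J \<times> J \<longrightarrow> k p = 0)"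

definition kernel_op :: "(real \<times> real \<Rightarrow> real) \<Rightarrow> (real \<Rightarrow> real) \<Rightarrow> real \<Rightarrow> real" where
  "kernel_op k f t = (LINT s|lborel. k (t, s) * f s)"

definition transpose_kernel :: "(real \<times> real \<Rightarrow> real) \<Rightarrow> real \<times> real \<Rightarrow> real" where
  "transpose_kernel k = (\<lambda>p. k (snd p, fst p))"

lemma kernel_on_measurable: "kernel_on J k \<Longrightarrow> k \<in> borel_measurable (borel \<Otimes>\<^sub>M borel)"
  by (simp add: kernel_on_def borel_prod)

lemma kernel_on_bound: 
  assumes "kernel_on J k" obtains B where "B \<ge> 0" "\<And>p. \<bar>k p\<bar> \<le> B"
  using assms by (auto simp: kernel_on_def) (meson abs_ge_zero order_trans)

lemma kernel_on_outside: "kernel_on J k \<Longrightarrow> t \<notin> J \<or> s \<notin> J \<Longrightarrow> k (t, s) = 0"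
  by (auto simp: kernel_on_def)

lemma kernel_on_transpose:
  assumes k: "kernel_on J k" shows "kernel_on J (transpose_kernel k)"
proof -
  have [measurable]: "k \<in> borel_measurable (borel \<Otimes>\<^sub>M borel)" by (rule kernel_on_measurable[OF k])
  have "transpose_kernel k \<in> borel_measurable (borel \<Otimes>\<^sub>M borel)" unfolding transpose_kernel_def by measurable
  moreover obtain B where "\<And>p. \<bar>k p\<bar> \<le> B" using kernel_on_bound[OF k] by blast
  ultimately show ?thesis using kernel_on_outside[OF k]
    by (auto simp: kernel_on_def borel_prod transpose_kernel_def)
qed

lemma kernel_row_borel_L2:
  assumes k: "kernel_on J k" and J: "bounded J"
  shows "(\<lambda>s. k (t, s)) \<in> borel_L2 J"
proof -
  have [measurable]: "k \<in> borel_measurable (borel \<Otimes>\<^sub>M borel)" by (rule kernel_on_measurable[OF k])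
  obtain B where "\<And>p. \<bar>k p\<bar> \<le> B" using kernel_on_bound[OF k] by blast
  then show ?thesis using kernel_on_outside[OF k] J by (intro borel_L2_bounded) auto
qed

lemma kernel_op_measurable [measurable (raw)]:
  assumes [measurable]: "k \<in> borel_measurable (borel \<Otimes>\<^sub>M borel)" "f \<in> borel_measurable borel"
  shows "kernel_op k f \<in> borel_measurable borel"
  unfolding kernel_op_def[abs_def] by measurable

lemma kernel_op_integrable:
  assumes k: "kernel_on J k" and f: "integrable lborel f"
  shows "integrable lborel (\<lambda>s. k (t, s) * f s)"
proof -
  have [measurable]: "k \<in> borel_measurable (borel \<Otimes>\<^sub>M borel)" by (rule kernel_on_measurable[OF k])
  have [measurable]: "f \<in> borel_measurable borel" using borel_measurable_integrable[OF f] by simp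
  obtain B where B: "\<And>p. \<bar>k p\<bar> \<le> B" using kernel_on_bound[OF k] by blast
  show ?thesis
  proof (rule Bochner_Integration.integrable_bound)
    show "integrable lborel (\<lambda>s. B * f s)" using f by simp
    show "AE s in lborel. norm (k (t, s) * f s) \<le> norm (B * f s)"
      using B by (auto simp: abs_mult intro!: mult_right_mono order_trans[OF B abs_ge_self])
  qed measurable
qed

lemma kernel_op_linear:
  assumes k: "kernel_on J k" and f: "integrable lborel f" and g: "integrable lborel g"
  shows "kernel_op k (\<lambda>s. f s + g s) t = kernel_op k f t + kernel_op k g t"
    and "kernel_op k (\<lambda>s. f s - g s) t = kernel_op k f t - kernel_op k g t"
  using kernel_op_integrable[OF k f] kernel_op_integrable[OF k g] by (simp_all add: kernel_op_def distrib_left right_diff_distrib)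

lemma kernel_op_scale: "kernel_op k (\<lambda>s. c * f s) t = c * kernel_op k f t"
  unfolding kernel_op_def by (simp add: mult.left_commute)

text \<open>Equality holds at every point, because each value is an integral over the altered
  variable.\<close>

lemma kernel_op_cong_AE:
  assumes k: "kernel_on J k" and [measurable]: "f \<in> borel_measurable borel" "g \<in> borel_measurable borel"
    and ae: "AE s in lborel. f s = g s"
  shows "kernel_op k f = kernel_op k g"
proof
  have [measurable]: "k \<in> borel_measurable (borel \<Otimes>\<^sub>M borel)" by (rule kernel_on_measurable[OF k])
  fix t show "kernel_op k f t = kernel_op k g t"
    unfolding kernel_op_def by (intro integral_cong_AE) (use ae in auto)
qed

lemma kernel_op_zero: "kernel_on J k \<Longrightarrow> t \<notin> J \<Longrightarrow> kernel_op k f t = 0"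
  by (simp add: kernel_op_def kernel_on_outside)

lemma kernel_op_abs_le:
  assumes k: "kernel_on J k" and B: "\<And>p. \<bar>k p\<bar> \<le> B" and f: "integrable lborel f"
  shows "\<bar>kernel_op k f t\<bar> \<le> B * (LINT s|lborel. \<bar>f s\<bar>)"
proof -
  have "\<bar>kernel_op k f t\<bar> \<le> (LINT s|lborel. \<bar>k (t, s) * f s\<bar>)"
    unfolding kernel_op_def using integral_norm_bound[of lborel "\<lambda>s. k (t, s) * f s"] by simp
  also have "\<dots> \<le> (LINT s|lborel. B * \<bar>f s\<bar>)"
    using integrable_abs[OF kernel_op_integrable[OF k f, of t]] f B
    by (intro integral_mono) (auto simp: abs_mult intro!: mult_right_mono)
  finally show ?thesis by simp
qed

text \<open>A bounded kernel maps integrable functions to bounded ones, and these are square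
  integrable on the bounded set \<open>J\<close>.\<close>

lemma kernel_op_borel_L2:
  assumes k: "kernel_on J k" and J: "bounded J" and f: "integrable lborel f"
  shows "kernel_op k f \<in> borel_L2 J"
proof -
  have [measurable]: "k \<in> borel_measurable (borel \<Otimes>\<^sub>M borel)" by (rule kernel_on_measurable[OF k])
  have [measurable]: "f \<in> borel_measurable borel" using borel_measurable_integrable[OF f] by simp
  obtain B where B: "\<And>p. \<bar>k p\<bar> \<le> B" using kernel_on_bound[OF k] by blast
  show ?thesis by (rule borel_L2_bounded[OF _ kernel_op_abs_le[OF k B f] kernel_op_zero[OF k] J]) measurable
qed

lemma kernel_op_square_le:
  assumes k: "kernel_on J k" and J: "bounded J" and f: "f \<in> borel_L2 J'"
  shows "(kernel_op k f t)\<^sup>2 \<le> (LINT s|lborel. (k (t, s))\<^sup>2) * (LINT s|lborel. (f s)\<^sup>2)"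
  unfolding kernel_op_def using kernel_row_borel_L2[OF k J, of t] f
  by (intro Cauchy_Schwarz_integral) (auto dest: borel_L2_measurable borel_L2_square_integrable)

lemma integrable_lborel_product:
  fixes f g :: "real \<Rightarrow> real"
  assumes f: "integrable lborel f" and g: "integrable lborel g"
  shows "integrable lborel (\<lambda>p. f (fst p) * g (snd p))"
proof -
  have [measurable]: "f \<in> borel_measurable borel" "g \<in> borel_measurable borel"
    using borel_measurable_integrable[OF f] borel_measurable_integrable[OF g] by simp_all
  have "integrable (lborel \<Otimes>\<^sub>M lborel) (\<lambda>p. f (fst p) * g (snd p))"
    by (rule lborel_pair.Fubini_integrable) (use f g in \<open>auto simp: abs_mult\<close>)
  then show ?thesis by (simp add: lborel_prod)
qed

lemma integrable_bounded_mult: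
  fixes c f :: "'a::euclidean_space \<Rightarrow> real"
  assumes f: "integrable lborel f" and [measurable]: "c \<in> borel_measurable borel" and c: "\<And>x. \<bar>c x\<bar> \<le> B"
  shows "integrable lborel (\<lambda>x. c x * f x)"
proof (rule Bochner_Integration.integrable_bound)
  show "integrable lborel (\<lambda>s. B * f s)" using f by simp
  have "B \<ge> 0" using c[of undefined] by (meson abs_ge_zero order_trans)
  then show "AE s in lborel. norm (c s * f s) \<le> norm (B * f s)"
    using c by (auto simp: abs_mult intro!: mult_right_mono)
  have [measurable]: "f \<in> borel_measurable borel" using borel_measurable_integrable[OF f] by simp
  show "(\<lambda>x. c x * f x) \<in> borel_measurable lborel" by simp
qed

lemma kernel_op_adjoint:
  assumes k: "kernel_on J k" and f: "integrable lborel f" and g: "integrable lborel g"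
  shows "(LINT t|lborel. g t * kernel_op k f t) = (LINT s|lborel. f s * kernel_op (transpose_kernel k) g s)"
proof -
  obtain B where B: "\<And>p. \<bar>k p\<bar> \<le> B" using kernel_on_bound[OF k] by blast
  have i: "integrable lborel (\<lambda>p. k p * (g (fst p) * f (snd p)))"
    by (rule integrable_bounded_mult[OF integrable_lborel_product[OF g f] _ B])
       (use k in \<open>auto simp: kernel_on_def\<close>)
  have "(LINT t|lborel. g t * kernel_op k f t) = (LINT t|lborel. LINT s|lborel. k (t, s) * (g t * f s))"
    by (simp add: kernel_op_def mult.left_commute flip: integral_mult_right_zero)
  also have "\<dots> = (LINT s|lborel. LINT t|lborel. k (t, s) * (g t * f s))"
    using integrable_plane(5,6)[OF i] by simp
  also have "\<dots> = (LINT s|lborel. f s * kernel_op (transpose_kernel k) g s)"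
    by (simp add: kernel_op_def transpose_kernel_def mult_ac flip: integral_mult_right_zero)
  finally show ?thesis .
qed

text \<open>The inner operator is moved, as its adjoint, onto the row of \<open>k\<close> at
  \<open>t\<close>; its transposed action on that row is the composed kernel.\<close>

lemma kernel_op_comp:
  assumes k: "kernel_on J k" and m: "kernel_on J m" and J: "bounded J" and f: "integrable lborel f"
  shows "kernel_op k (kernel_op m f) t = (LINT r|lborel. (LINT s|lborel. k (t, s) * m (s, r)) * f r)"
proof -
  have "integrable lborel (\<lambda>s. k (t, s))" using kernel_row_borel_L2[OF k J] J by (rule borel_L2_integrable)
  from kernel_op_adjoint[OF m f this] show ?thesis
    unfolding kernel_op_def[of k] kernel_op_def[of "transpose_kernel m"]
    by (simp add: transpose_kernel_def mult.commute)
qed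

subsection \<open>Operators acting in one of two variables\<close>

definition in_time :: "((real \<Rightarrow> real) \<Rightarrow> real \<Rightarrow> real) \<Rightarrow> (real \<times> real \<Rightarrow> real) \<Rightarrow> real \<times> real \<Rightarrow> real" where
  "in_time A f = (\<lambda>p. A (\<lambda>s. f (fst p, s)) (snd p))"

definition in_space :: "((real \<Rightarrow> real) \<Rightarrow> real \<Rightarrow> real) \<Rightarrow> (real \<times> real \<Rightarrow> real) \<Rightarrow> real \<times> real \<Rightarrow> real" where
  "in_space A f = (\<lambda>p. A (\<lambda>y. f (y, snd p)) (fst p))"

lemma in_time_apply: "in_time A f (x, t) = A (\<lambda>s. f (x, s)) t"
  and in_space_apply: "in_space A f (x, t) = A (\<lambda>y. f (y, t)) x"
  by (simp_all add: in_time_def in_space_def)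

lemma in_time_kernel_op_measurable:
  assumes [measurable]: "k \<in> borel_measurable (borel \<Otimes>\<^sub>M borel)" "f \<in> borel_measurable borel"
  shows "in_time (kernel_op k) f \<in> borel_measurable borel"
proof -
  have [measurable]: "f \<in> borel_measurable (borel \<Otimes>\<^sub>M borel)" by (simp add: borel_prod)
  have "in_time (kernel_op k) f \<in> borel_measurable (borel \<Otimes>\<^sub>M borel)"
    unfolding in_time_def kernel_op_def by measurable
  then show ?thesis by (simp add: borel_prod)
qed

lemma in_space_kernel_op_measurable:
  assumes [measurable]: "k \<in> borel_measurable (borel \<Otimes>\<^sub>M borel)" "f \<in> borel_measurable borel"
  shows "in_space (kernel_op k) f \<in> borel_measurable borel"
proof -
  have [measurable]: "f \<in> borel_measurable (borel \<Otimes>\<^sub>M borel)" by (simp add: borel_prod)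
  have "in_space (kernel_op k) f \<in> borel_measurable (borel \<Otimes>\<^sub>M borel)"
    unfolding in_space_def kernel_op_def by measurable
  then show ?thesis by (simp add: borel_prod)
qed

lemma kernel_row_square_bound:
  assumes k: "kernel_on J k" and J: "bounded J"
  obtains C where "\<And>t. (LINT s|lborel. (k (t, s))\<^sup>2) \<le> C"
proof -
  have [measurable]: "k \<in> borel_measurable (borel \<Otimes>\<^sub>M borel)" by (rule kernel_on_measurable[OF k])
  obtain a where a: "J \<subseteq> cbox (-a) a" using J bounded_subset_cbox_symmetric by blast
  obtain B where B: "\<And>p. \<bar>k p\<bar> \<le> B" using kernel_on_bound[OF k] by blast
  have i: "integrable lborel (indicat_real (cbox (-a) a))"
    using borel_L2_integrable[OF indicator_cbox_borel_L2 bounded_cbox] .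
  have "(LINT s|lborel. (k (t, s))\<^sup>2) \<le> (LINT s|lborel. B\<^sup>2 * indicat_real (cbox (-a) a) s)" for t
  proof (rule integral_mono)
    show "integrable lborel (\<lambda>s. (k (t, s))\<^sup>2)"
      by (rule borel_L2_square_integrable[OF kernel_row_borel_L2[OF k J]])
    show "(k (t, s))\<^sup>2 \<le> B\<^sup>2 * indicat_real (cbox (-a) a) s" for s
    proof (cases "s \<in> J")
      case True
      then have "indicat_real (cbox (-a) a) s = 1" using a by (auto simp: indicator_def)
      moreover have "(k (t, s))\<^sup>2 \<le> B\<^sup>2" using B[of "(t, s)"] by (simp add: abs_le_square_iff[symmetric])
      ultimately show ?thesis by simp
    qed (simp add: kernel_on_outside[OF k])
  qed (use i in simp)
  then show ?thesis by (rule that)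
qed

text \<open>On almost every line the Cauchy-Schwarz inequality bounds the square at (x, t) by a
  constant times the squared norm of the section at x. Multiplied by the indicator of a box in t,
  this majorant is integrable in the plane.\<close>

lemma in_time_borel_L2:
  assumes k: "kernel_on Y k" and Y: "bounded Y" and f: "f \<in> borel_L2 (X \<times> Y)"
  shows "in_time (kernel_op k) f \<in> borel_L2 (X \<times> Y)"
proof -
  have km [measurable]: "k \<in> borel_measurable (borel \<Otimes>\<^sub>M borel)" by (rule kernel_on_measurable[OF k])
  have fm [measurable]: "f \<in> borel_measurable borel" by (rule borel_L2_measurable[OF f])
  then have [measurable]: "f \<in> borel_measurable (borel \<Otimes>\<^sub>M borel)" by (simp add: borel_prod)
  have gm [measurable]: "in_time (kernel_op k) f \<in> borel_measurable borel" by (rule in_time_kernel_op_measurable[OF km fm])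
  define N where "N x = (LINT s|lborel. (f (x, s))\<^sup>2)" for x
  have Nm [measurable]: "N \<in> borel_measurable borel" unfolding N_def[abs_def] by measurable
  obtain C where C: "\<And>t. (LINT s|lborel. (k (t, s))\<^sup>2) \<le> C" using kernel_row_square_bound[OF k Y] by blast
  obtain a where a: "Y \<subseteq> cbox (-a) a" using Y bounded_subset_cbox_symmetric by blast
  have i: "integrable lborel (indicat_real (cbox (-a) a))"
    using borel_L2_integrable[OF indicator_cbox_borel_L2 bounded_cbox] .
  have N: "integrable lborel N" unfolding N_def[abs_def] using integrable_plane(3)[OF borel_L2_square_integrable[OF f]] .
  have int: "integrable lborel (\<lambda>p. C * N (fst p) * indicat_real (cbox (-a) a) (snd p))"
    by (rule integrable_lborel_product) (use N i in auto)
  have le: "AE x in lborel. \<forall>t. (in_time (kernel_op k) f (x, t))\<^sup>2 \<le> C * N x * indicat_real (cbox (-a) a) t"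
    using borel_L2_sections(1)[OF f]
  proof eventually_elim
    case (elim x)
    show ?case
    proof
      fix t
      show "(in_time (kernel_op k) f (x, t))\<^sup>2 \<le> C * N x * indicat_real (cbox (-a) a) t"
      proof (cases "t \<in> Y")
        case True
        have "(in_time (kernel_op k) f (x, t))\<^sup>2 \<le> (LINT s|lborel. (k (t, s))\<^sup>2) * N x"
          unfolding in_time_apply N_def by (rule kernel_op_square_le[OF k Y elim])
        also have "\<dots> \<le> C * N x" by (rule mult_right_mono[OF C]) (simp add: N_def)
        finally show ?thesis using True a by (auto simp: indicator_def)
      next
        case False
        have "0 \<le> C * N x"
        proof (rule mult_nonneg_nonneg)
          have "0 \<le> (LINT s|lborel. (k (0, s))\<^sup>2)" by simp
          then show "0 \<le> C" using C[of 0] by linarith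
        qed (simp add: N_def)
        then show ?thesis using False unfolding in_time_apply kernel_op_zero[OF k False]
          by (simp add: indicator_def)
      qed
    qed
  qed
  have "integrable lborel (\<lambda>p. (in_time (kernel_op k) f p)\<^sup>2)"
  proof (rule Bochner_Integration.integrable_bound[OF int])
    let ?P = "\<lambda>p. norm ((in_time (kernel_op k) f p)\<^sup>2) \<le> norm (C * N (fst p) * indicat_real (cbox (-a) a) (snd p))"
    have "in_time (kernel_op k) f \<in> borel_measurable (borel \<Otimes>\<^sub>M borel)" using gm by (simp add: borel_prod)
    note [measurable] = this
    have "AE p in lborel \<Otimes>\<^sub>M lborel. ?P p"
    proof (rule lborel_pair.AE_pair_measure)
      show "{p \<in> space (lborel \<Otimes>\<^sub>M lborel). ?P p} \<in> sets (lborel \<Otimes>\<^sub>M lborel)" by measurable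
      show "AE x in lborel. AE t in lborel. ?P (x, t)"
        using le by eventually_elim (auto intro!: AE_I2 order_trans[OF _ abs_ge_self])
    qed
    then show "AE p in lborel. ?P p" unfolding lborel_prod .
  qed simp
  moreover have "in_time (kernel_op k) f p = 0" if "p \<notin> X \<times> Y" for p
  proof (cases "snd p \<in> Y")
    case True
    then have "f (fst p, s) = 0" for s using that borel_L2_outside[OF f] by (cases p) auto
    then show ?thesis by (simp add: in_time_def kernel_op_def)
  qed (simp add: in_time_def kernel_op_zero[OF k])
  ultimately show ?thesis using gm by (simp add: borel_L2_def)
qed

lemma borel_L2_swap:
  fixes f :: "real \<times> real \<Rightarrow> real"
  assumes f: "f \<in> borel_L2 (X \<times> Y)" shows "(\<lambda>p. f (snd p, fst p)) \<in> borel_L2 (Y \<times> X)"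
proof -
  have [measurable]: "f \<in> borel_measurable (borel \<Otimes>\<^sub>M borel)" using borel_L2_measurable[OF f] by (simp add: borel_prod)
  have "(\<lambda>p. f (snd p, fst p)) \<in> borel_measurable (borel \<Otimes>\<^sub>M borel)" by measurable
  moreover have "integrable (lborel \<Otimes>\<^sub>M lborel) (\<lambda>p. (f p)\<^sup>2)"
    using borel_L2_square_integrable[OF f] by (simp add: lborel_prod)
  then have "integrable (lborel \<Otimes>\<^sub>M lborel) (\<lambda>(x, y). (f (y, x))\<^sup>2)" by (rule lborel_pair.integrable_product_swap)
  ultimately show ?thesis using borel_L2_outside[OF f]
    by (auto simp: borel_L2_def borel_prod lborel_prod case_prod_unfold)
qed

lemma in_space_borel_L2:
  assumes k: "kernel_on X k" and X: "bounded X" and f: "f \<in> borel_L2 (X \<times> Y)"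
  shows "in_space (kernel_op k) f \<in> borel_L2 (X \<times> Y)"
  using borel_L2_swap[OF in_time_borel_L2[OF k X borel_L2_swap[OF f]]]
  by (simp add: in_space_def in_time_def)

lemma in_time_adjoint:
  assumes k: "kernel_on Y k" and Y: "bounded Y" and f: "f \<in> borel_L2 (X \<times> Y)" and g: "g \<in> borel_L2 (X \<times> Y)"
  shows "(LINT p|lborel. g p * in_time (kernel_op k) f p) = (LINT p|lborel. f p * in_time (kernel_op (transpose_kernel k)) g p)"
proof -
  have k': "kernel_on Y (transpose_kernel k)" by (rule kernel_on_transpose[OF k])
  note i1 = integrable_plane[OF borel_L2_mult_integrable[OF g in_time_borel_L2[OF k Y f]]]
  note i2 = integrable_plane[OF borel_L2_mult_integrable[OF f in_time_borel_L2[OF k' Y g]]]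
  have "AE x in lborel. (LINT t|lborel. g (x, t) * in_time (kernel_op k) f (x, t))
      = (LINT t|lborel. f (x, t) * in_time (kernel_op (transpose_kernel k)) g (x, t))"
    using borel_L2_sections(1)[OF f] borel_L2_sections(1)[OF g]
  proof eventually_elim
    case (elim x)
    show ?case unfolding in_time_apply
      by (rule kernel_op_adjoint[OF k]) (use elim Y in \<open>auto intro: borel_L2_integrable\<close>)
  qed
  then have "(LINT x|lborel. LINT t|lborel. g (x, t) * in_time (kernel_op k) f (x, t))
      = (LINT x|lborel. LINT t|lborel. f (x, t) * in_time (kernel_op (transpose_kernel k)) g (x, t))"
    using borel_measurable_integrable[OF i1(3)] borel_measurable_integrable[OF i2(3)] by (intro integral_cong_AE)
  then show ?thesis by (simp add: i1(5) i2(5))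
qed

text \<open>Fubini for the product of the two bounded kernels. The equality of functions, not only
  up to null sets, later allows one test function to be read in two ways.\<close>

lemma in_time_in_space_commute:
  assumes k: "kernel_on Y k" and m: "kernel_on X m" and f: "integrable lborel f"
    and XY: "bounded X" "bounded Y"
  shows "in_time (kernel_op k) (in_space (kernel_op m) f) = in_space (kernel_op m) (in_time (kernel_op k) f)"
proof
  fix p :: "real \<times> real" obtain x t where p: "p = (x, t)" by (cases p)
  have [measurable]: "k \<in> borel_measurable (borel \<Otimes>\<^sub>M borel)" "m \<in> borel_measurable (borel \<Otimes>\<^sub>M borel)"
    using k m by (auto intro: kernel_on_measurable)
  obtain B where B: "B \<ge> 0" "\<And>p. \<bar>k p\<bar> \<le> B" using kernel_on_bound[OF k] by blast
  obtain C where C: "C \<ge> 0" "\<And>p. \<bar>m p\<bar> \<le> C" using kernel_on_bound[OF m] by blast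
  have i: "integrable lborel (\<lambda>q. (k (t, snd q) * m (x, fst q)) * f q)"
  proof (rule integrable_bounded_mult[OF f])
    show "\<bar>k (t, snd q) * m (x, fst q)\<bar> \<le> B * C" for q
      unfolding abs_mult by (rule mult_mono) (use B C in auto)
    have "(\<lambda>q. k (t, snd q) * m (x, fst q)) \<in> borel_measurable (borel \<Otimes>\<^sub>M borel)" by measurable
    then show "(\<lambda>q. k (t, snd q) * m (x, fst q)) \<in> borel_measurable borel" by (simp add: borel_prod)
  qed
  have "in_time (kernel_op k) (in_space (kernel_op m) f) p = (LINT s|lborel. LINT y|lborel. k (t, s) * m (x, y) * f (y, s))"
    by (simp add: p in_time_def in_space_def kernel_op_def mult.assoc flip: integral_mult_right_zero)
  also have "\<dots> = (LINT y|lborel. LINT s|lborel. k (t, s) * m (x, y) * f (y, s))"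
    using integrable_plane(5,6)[OF i] by simp
  also have "\<dots> = in_space (kernel_op m) (in_time (kernel_op k) f) p"
    by (simp add: p in_time_def in_space_def kernel_op_def mult_ac flip: integral_mult_right_zero)
  finally show "in_time (kernel_op k) (in_space (kernel_op m) f) p = in_space (kernel_op m) (in_time (kernel_op k) f) p" .
qed

lemma in_time_cong_AE:
  assumes k: "kernel_on Y k" and [measurable]: "f \<in> borel_measurable borel" "g \<in> borel_measurable borel"
    and ae: "AE p in lborel. f p = g p"
  shows "AE p in lborel. in_time (kernel_op k) f p = in_time (kernel_op k) g p"
proof (rule AE_plane_eqI(1))
  have [measurable]: "f \<in> borel_measurable (borel \<Otimes>\<^sub>M borel)" "g \<in> borel_measurable (borel \<Otimes>\<^sub>M borel)"
    using assms by (auto simp: borel_prod)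
  show "AE x in lborel. AE t in lborel. in_time (kernel_op k) f (x, t) = in_time (kernel_op k) g (x, t)"
    using AE_plane_sections(1)[OF ae]
  proof eventually_elim
    case (elim x)
    then show ?case unfolding in_time_apply by (subst kernel_op_cong_AE[OF k _ _ elim]) auto
  qed
qed (auto intro!: in_time_kernel_op_measurable kernel_on_measurable[OF k])

subsection \<open>Smooth bump functions\<close>

text \<open>A class closed under differentiation consists of smooth functions: membership passes to
  every iterated derivative, so no formula for the derivatives is required.\<close>

lemma smooth_coinduct:
  fixes f :: "real \<Rightarrow> real"
  assumes "f \<in> C" and step: "\<And>g. g \<in> C \<Longrightarrow> \<exists>g'\<in>C. \<forall>x. (g has_real_derivative g' x) (at x)"
  shows "((deriv ^^ n) f) differentiable (at x)"
proof -
  have "(deriv ^^ n) f \<in> C"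
  proof (induction n)
    case (Suc n)
    then obtain g' where "g' \<in> C" "\<forall>x. ((deriv ^^ n) f has_real_derivative g' x) (at x)" using step by blast
    moreover from this have "deriv ((deriv ^^ n) f) = g'" by (auto intro: DERIV_imp_deriv)
    ultimately show ?case by simp
  qed (use assms in simp)
  then show ?thesis using step by (meson real_differentiable_def)
qed

lemma power_div_fact_le_exp:
  fixes x :: real assumes "x \<ge> 0" shows "x ^ n / fact n \<le> exp x"
proof -
  have "sum (\<lambda>n. x ^ n /\<^sub>R fact n) {n} \<le> exp x"
    using sums_unique[OF exp_converges[of x]] assms
    by (subst sums_unique[OF exp_converges[of x]], intro sum_le_suminf summable_exp_generic) auto
  then show ?thesis by (simp add: divide_inverse mult.commute)
qed

text \<open>For gluing a bump to zero at the ends of its support.\<close>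

lemma has_derivative_zero_quadratic:
  fixes f :: "real \<Rightarrow> real"
  assumes "\<And>y. \<bar>f y\<bar> \<le> M * (y - z)\<^sup>2"
  shows "(f has_real_derivative 0) (at z)"
proof -
  have z: "f z = 0" using assms[of z] by simp
  have "((\<lambda>h. (f (z + h) - f z) / h) \<longlongrightarrow> 0) (at 0)"
  proof (rule Lim_null_comparison)
    show "\<forall>\<^sub>F h in at 0. norm ((f (z + h) - f z) / h) \<le> M * \<bar>h\<bar>"
    proof (intro always_eventually allI)
      fix h show "norm ((f (z + h) - f z) / h) \<le> M * \<bar>h\<bar>"
        using assms[of "z + h"] z
        by (cases "h = 0") (auto simp: divide_simps power2_eq_square abs_mult)
    qed
    show "((\<lambda>h. M * \<bar>h\<bar>) \<longlongrightarrow> 0) (at 0)" by (auto intro!: tendsto_eq_intros)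
  qed
  then show ?thesis by (simp add: DERIV_def)
qed

text \<open>A class of functions that is closed under differentiation and contains bump functions.\<close>

definition exp_rational :: "real \<Rightarrow> real \<Rightarrow> real \<Rightarrow> real poly \<Rightarrow> nat \<Rightarrow> real \<Rightarrow> real" where
  "exp_rational c d a p k x = (if c < x \<and> x < d
     then poly p x / ((x - c) * (d - x)) ^ k * exp (- a / ((x - c) * (d - x))) else 0)"

text \<open>With q = (y - c) (d - y), one term of the exponential series gives exp (a / q) \<ge> (a
  / q)^(k+2) / (k+2)!. This cancels the pole q^k and leaves two powers of q, enough for a vanishing
  derivative at the ends.\<close>

lemma exp_rational_quadratic_bound:
  assumes "c < d" "a > 0"
  obtains M where "M \<ge> 0" "\<And>y. \<bar>exp_rational c d a p k y\<bar> \<le> M * ((y - c) * (d - y))\<^sup>2"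
proof -
  have "bounded (poly p ` {c..d})"
    by (intro compact_imp_bounded compact_continuous_image continuous_intros) auto
  then obtain P where P: "P > 0" "\<And>y. y \<in> {c..d} \<Longrightarrow> \<bar>poly p y\<bar> \<le> P"
    unfolding bounded_pos by auto
  define M where "M = P * (fact (k + 2) / a ^ (k + 2))"
  show ?thesis
  proof (rule that[of M])
    show "M \<ge> 0" using P assms by (simp add: M_def)
    fix y show "\<bar>exp_rational c d a p k y\<bar> \<le> M * ((y - c) * (d - y))\<^sup>2"
    proof (cases "c < y \<and> y < d")
      case True
      define q where "q = (y - c) * (d - y)"
      have q: "q > 0" using True by (simp add: q_def)
      have "(a / q) ^ (k + 2) / fact (k + 2) \<le> exp (a / q)"
        by (rule power_div_fact_le_exp) (use q assms in auto)
      then have "a ^ (k + 2) \<le> exp (a / q) * fact (k + 2) * q ^ (k + 2)"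
      proof -
        have "A / X / N \<le> E \<Longrightarrow> X > 0 \<Longrightarrow> N > 0 \<Longrightarrow> A \<le> E * N * X" for A E N X :: real
          by (simp add: field_simps)
        from this[of "a ^ (k + 2)" "q ^ (k + 2)" "fact (k + 2)" "exp (a / q)"] show ?thesis
          using q \<open>(a / q) ^ (k + 2) / fact (k + 2) \<le> exp (a / q)\<close>
          unfolding power_divide by (metis fact_gt_zero zero_less_power)
      qed
      then have "exp (- a / q) \<le> fact (k + 2) / a ^ (k + 2) * q ^ (k + 2)"
      proof -
        have "A \<le> E * N * X \<Longrightarrow> A > 0 \<Longrightarrow> E > 0 \<Longrightarrow> inverse E \<le> N / A * X" for A E N X :: real
          by (simp add: field_simps)
        from this[of "a ^ (k + 2)" "exp (a / q)"] show ?thesis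
          using assms \<open>a ^ (k + 2) \<le> exp (a / q) * fact (k + 2) * q ^ (k + 2)\<close>
          unfolding minus_divide_left[symmetric] exp_minus by (metis exp_gt_zero zero_less_power)
      qed
      then have "\<bar>poly p y\<bar> / q ^ k * exp (- a / q) \<le> P / q ^ k * (fact (k + 2) / a ^ (k + 2) * q ^ (k + 2))"
        using True q P(2)[of y] by (intro mult_mono divide_right_mono) auto
      also have "\<dots> = M * q\<^sup>2" using q by (simp add: M_def power_add power2_eq_square)
      finally show ?thesis using True q by (simp add: exp_rational_def abs_mult flip: q_def)
    next
      case False
      then have "exp_rational c d a p k y = 0" by (simp only: exp_rational_def if_False)
      then show ?thesis using \<open>M \<ge> 0\<close> by simp
    qed
  qed
qed

lemma exp_rational_deriv:
  assumes "c < d" "a > 0"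
  shows "\<exists>p' k'. \<forall>x. (exp_rational c d a p k has_real_derivative exp_rational c d a p' k' x) (at x)"
proof -
  define Q where "Q = [:-c, 1:] * [:d, -1:]"
  have Q: "poly Q x = (x - c) * (d - x)" for x by (simp add: Q_def algebra_simps)
  \<comment> \<open>The numerator left after differentiating p Q^(-k) exp (- a / Q) and extracting
    Q^(-(k+2)): the three summands come from p, from the power and from the exponential.\<close>
  define p' where "p' = pderiv p * Q ^ 2 - smult (of_nat k) (p * pderiv Q * Q) + smult a (p * pderiv Q)"
  have "(exp_rational c d a p k has_real_derivative exp_rational c d a p' (k + 2) x) (at x)" for x
  proof -
    consider "c < x" "x < d" | "x < c \<or> x > d" | "x = c \<or> x = d" by linarith
    then show ?thesis
    proof cases
      case 1
      define q where "q = poly Q x"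
      have q: "q > 0" using 1 by (simp add: q_def Q)
      let ?f = "\<lambda>x. poly p x / poly Q x ^ k * exp (- a / poly Q x)"
      have "(?f has_real_derivative (poly (pderiv p) x * q ^ k - poly p x * (real k * (poly (pderiv Q) x * q ^ (k - 1)))) / (q ^ k * q ^ k)
          * exp (- a / q) + exp (- a / q) * (a * poly (pderiv Q) x / (q * q)) * (poly p x / q ^ k)) (at x)"
        unfolding q_def
        by (rule derivative_eq_intros refl | use q in \<open>simp add: q_def\<close>)+
      moreover have "(poly (pderiv p) x * q ^ k - poly p x * (real k * (poly (pderiv Q) x * q ^ (k - 1)))) / (q ^ k * q ^ k)
          * exp (- a / q) + exp (- a / q) * (a * poly (pderiv Q) x / (q * q)) * (poly p x / q ^ k)
          = poly p' x / q ^ (k + 2) * exp (- a / q)"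
      proof (cases k)
        case 0
        then show ?thesis using q by (simp add: p'_def q_def[symmetric] field_simps power2_eq_square)
      next
        case (Suc j)
        then show ?thesis using q by (simp add: p'_def q_def[symmetric] field_simps power2_eq_square)
      qed
      ultimately have "(?f has_real_derivative exp_rational c d a p' (k + 2) x) (at x)"
        using 1 by (simp add: exp_rational_def q_def Q)
      then show ?thesis
        by (rule has_field_derivative_transform_within_open[where S="{c<..<d}"])
           (use 1 in \<open>auto simp: exp_rational_def Q\<close>)
    next
      case 2
      have "((\<lambda>_. 0) has_real_derivative 0) (at x)" by simp
      then have "(exp_rational c d a p k has_real_derivative 0) (at x)"
        by (rule has_field_derivative_transform_within_open[where S="- {c..d}"])
           (use 2 in \<open>auto simp: exp_rational_def\<close>)
      then show ?thesis using 2 by (auto simp: exp_rational_def)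
    next
      case 3
      \<comment> \<open>At an end point x, one of the two factors of the quadratic bound is at most
        \<bar>y - x\<bar> and the other at most d - c, so the bound is quadratic in y - x.\<close>
      obtain M where M: "M \<ge> 0" "\<And>y. \<bar>exp_rational c d a p k y\<bar> \<le> M * ((y - c) * (d - y))\<^sup>2"
        using exp_rational_quadratic_bound[OF assms] by blast
      have "\<bar>exp_rational c d a p k y\<bar> \<le> M * (d - c)\<^sup>2 * (y - x)\<^sup>2" for y
      proof (cases "c < y \<and> y < d")
        case True
        have "((y - c) * (d - y))\<^sup>2 \<le> ((d - c) * \<bar>y - x\<bar>)\<^sup>2"
        proof (rule power_mono)
          show "(y - c) * (d - y) \<le> (d - c) * \<bar>y - x\<bar>"
            using 3
          proof
            assume "x = c" then show ?thesis using True
              by (subst mult.commute) (auto intro!: mult_mono)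
          next
            assume "x = d" then show ?thesis using True by (auto intro!: mult_mono)
          qed
        qed (use True in simp)
        then have "M * ((y - c) * (d - y))\<^sup>2 \<le> M * ((d - c) * \<bar>y - x\<bar>)\<^sup>2" using M(1) by (rule mult_left_mono)
        then show ?thesis using M(2)[of y] by (simp add: power_mult_distrib mult.assoc)
      next
        case False
        then have "exp_rational c d a p k y = 0" by (simp only: exp_rational_def if_False)
        then show ?thesis using M(1) by simp
      qed
      then have "(exp_rational c d a p k has_real_derivative 0) (at x)"
        by (rule has_derivative_zero_quadratic)
      moreover have "exp_rational c d a p' (k + 2) x = 0" using 3 by (auto simp: exp_rational_def)
      ultimately show ?thesis by simp
    qed
  qed
  then show ?thesis by blast
qed

lemma exp_rational_smooth:
  assumes "c < d" "a > 0"
  shows "((deriv ^^ n) (exp_rational c d a p k)) differentiable (at x)"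
  by (rule smooth_coinduct[where C="{exp_rational c d a p k | p k. True}"])
     (use exp_rational_deriv[OF assms] in fastforce)+

text \<open>The factor 1 / (n + 1) in the exponent makes the bumps tend to 1 inside the interval,
  also when the ends move with n. They approximate indicators of intervals from below.\<close>

definition bump :: "nat \<Rightarrow> real \<Rightarrow> real \<Rightarrow> real \<Rightarrow> real" where
  "bump n c d = exp_rational c d (1 / Suc n) 1 0"

lemma bump_eq: "bump n c d x = (if c < x \<and> x < d then exp (- (1 / Suc n) / ((x - c) * (d - x))) else 0)"
  by (simp add: bump_def exp_rational_def)

lemma bump_smooth: "c < d \<Longrightarrow> ((deriv ^^ m) (bump n c d)) differentiable (at x)"
  unfolding bump_def by (rule exp_rational_smooth) auto

lemma bump_bounds: "0 \<le> bump n c d x" "bump n c d x \<le> 1"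
  by (auto simp: bump_eq divide_nonneg_nonneg)

lemma bump_outside: "x \<notin> {c<..<d} \<Longrightarrow> bump n c d x = 0"
  by (auto simp: bump_eq)

subsection \<open>Test functions\<close>

lemma test_functions_differentiable:
  "\<phi> \<in> test_functions a b \<Longrightarrow> (\<phi> has_real_derivative deriv \<phi> x) (at x)"
  "\<phi> \<in> test_functions a b \<Longrightarrow> (deriv \<phi> has_real_derivative deriv (deriv \<phi>) x) (at x)"
proof -
  assume "\<phi> \<in> test_functions a b"
  then have "((deriv ^^ n) \<phi>) differentiable (at x)" for n x by (auto simp: test_functions_def)
  from this[of 0 x] this[of 1 x] show "(\<phi> has_real_derivative deriv \<phi> x) (at x)"
    "(deriv \<phi> has_real_derivative deriv (deriv \<phi>) x) (at x)"
    by (auto simp: DERIV_deriv_iff_real_differentiable)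
qed

lemma test_functions_continuous:
  assumes "\<phi> \<in> test_functions a b"
  shows "continuous_on A \<phi>" "continuous_on A (deriv \<phi>)" 
    "\<phi> \<in> borel_measurable borel" "deriv \<phi> \<in> borel_measurable borel"
proof -
  have *: "continuous_on UNIV \<phi>" "continuous_on UNIV (deriv \<phi>)"
    using test_functions_differentiable[OF assms]
    by (auto intro!: continuous_at_imp_continuous_on DERIV_isCont)
  then show "continuous_on A \<phi>" "continuous_on A (deriv \<phi>)" by (auto intro: continuous_on_subset)
  show "\<phi> \<in> borel_measurable borel" "deriv \<phi> \<in> borel_measurable borel"
    using * by (auto intro: borel_measurable_continuous_onI)
qed

lemma test_functions_outside:
  assumes \<phi>: "\<phi> \<in> test_functions a b" and x: "x \<notin> {a<..<b}"
  shows "\<phi> x = 0" "deriv \<phi> x = 0"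
proof -
  obtain K where K: "compact K" "K \<subseteq> {a<..<b}" "\<And>x. x \<notin> K \<Longrightarrow> \<phi> x = 0"
    using \<phi> by (auto simp: test_functions_def)
  have "x \<notin> K" using K x by auto
  then show "\<phi> x = 0" by (rule K)
  have "((\<lambda>_. 0) has_real_derivative 0) (at x)" by simp
  then have "(\<phi> has_real_derivative 0) (at x)"
    by (rule has_field_derivative_transform_within_open[where S="- K"])
       (use K x in \<open>auto intro: compact_imp_closed\<close>)
  then show "deriv \<phi> x = 0" by (rule DERIV_imp_deriv)
qed

lemma continuous_zero_outside_bounded:
  fixes f :: "real \<Rightarrow> real"
  assumes "continuous_on {a..b} f" "\<And>x. x \<notin> {a<..<b} \<Longrightarrow> f x = 0"
  obtains B where "\<And>x. \<bar>f x\<bar> \<le> B"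
proof -
  have "bounded (f ` {a..b})"
    by (intro compact_imp_bounded compact_continuous_image assms) auto
  then obtain B where B: "B > 0" "\<And>x. x \<in> {a..b} \<Longrightarrow> \<bar>f x\<bar> \<le> B" unfolding bounded_pos by auto
  have "\<bar>f x\<bar> \<le> B" for x using B assms(2)[of x] by (cases "x \<in> {a..b}") auto
  then show ?thesis by (rule that)
qed

lemma test_functions_bounded:
  assumes \<phi>: "\<phi> \<in> test_functions a b"
  obtains B where "\<And>x. \<bar>\<phi> x\<bar> \<le> B" "\<And>x. \<bar>deriv \<phi> x\<bar> \<le> B"
proof -
  note o = test_functions_outside[OF \<phi>]
  obtain B where B: "\<And>x. \<bar>\<phi> x\<bar> \<le> B"
    using continuous_zero_outside_bounded[OF test_functions_continuous(1)[OF \<phi>] o(1)] by blast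
  obtain C where C: "\<And>x. \<bar>deriv \<phi> x\<bar> \<le> C"
    using continuous_zero_outside_bounded[OF test_functions_continuous(2)[OF \<phi>] o(2)] by blast
  show ?thesis by (rule that[of "max B C"]) (use B C in \<open>auto simp: le_max_iff_disj\<close>)
qed

lemma test_functions_borel_L2:
  assumes \<phi>: "\<phi> \<in> test_functions a b"
  shows "\<phi> \<in> borel_L2 {a<..<b}" "deriv \<phi> \<in> borel_L2 {a<..<b}"
proof -
  obtain B where B: "\<And>x. \<bar>\<phi> x\<bar> \<le> B" "\<And>x. \<bar>deriv \<phi> x\<bar> \<le> B"
    using test_functions_bounded[OF \<phi>] by blast
  show "\<phi> \<in> borel_L2 {a<..<b}"
    by (rule borel_L2_bounded[OF test_functions_continuous(3)[OF \<phi>] B(1)])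
       (use test_functions_outside[OF \<phi>] in auto)
  show "deriv \<phi> \<in> borel_L2 {a<..<b}"
    by (rule borel_L2_bounded[OF test_functions_continuous(4)[OF \<phi>] B(2)])
       (use test_functions_outside[OF \<phi>] in auto)
qed

lemma bump_test_function: "a < c \<Longrightarrow> c < d \<Longrightarrow> d < b \<Longrightarrow> bump n c d \<in> test_functions a b"
  using bump_smooth[of c d]
  by (auto simp: test_functions_def intro!: exI[of _ "{c..d}"] bump_outside)

text \<open>Rational ends keep the family countable, yet rich enough to approximate the indicator of
  every subinterval.\<close>

definition rational_bumps :: "real \<Rightarrow> real \<Rightarrow> (real \<Rightarrow> real) set" where
  "rational_bumps a b = {bump n c d | n c d. c \<in> \<rat> \<and> d \<in> \<rat> \<and> a < c \<and> c < d \<and> d < b}"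

lemma countable_rational_bumps: "countable (rational_bumps a b)"
proof -
  have "rational_bumps a b \<subseteq> (\<lambda>(n, c, d). bump n c d) ` (UNIV \<times> \<rat> \<times> \<rat>)"
    by (force simp: rational_bumps_def)
  then show ?thesis by (rule countable_subset) (auto intro!: countable_image countable_SIGMA simp: countable_rat)
qed

lemma bump_tendsto:
  assumes y: "x < y" "y < b" and c: "c \<longlonglongrightarrow> x" and d: "d \<longlonglongrightarrow> b"
  shows "(\<lambda>n. bump n (c n) (d n) y) \<longlonglongrightarrow> 1"
proof -
  have "(\<lambda>n. exp (- (1 / real (Suc n)) / ((y - c n) * (d n - y)))) \<longlonglongrightarrow> exp (- 0 / ((y - x) * (b - y)))"
    using y by (intro tendsto_intros c d LIMSEQ_Suc[OF lim_1_over_n]) auto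
  moreover have "\<forall>\<^sub>F n in sequentially. c n < y \<and> y < d n"
    using order_tendstoD(2)[OF c y(1)] order_tendstoD(1)[OF d y(2)] by eventually_elim auto
  then have "\<forall>\<^sub>F n in sequentially. exp (- (1 / real (Suc n)) / ((y - c n) * (d n - y))) = bump n (c n) (d n) y"
    by eventually_elim (simp add: bump_eq)
  ultimately show ?thesis by (simp add: tendsto_cong)
qed

text \<open>The positive and negative parts of \<open>g\<close> are densities of two measures that
  agree on all half-lines, hence of the same measure, and densities are unique almost
  everywhere.\<close>

lemma AE_zero_if_tail_integrals_zero:
  fixes g :: "real \<Rightarrow> real"
  assumes g: "integrable lborel g" and zero: "\<And>x. (LINT y|lborel. indicator {x<..} y * g y) = 0"
  shows "AE y in lborel. g y = 0"
proof -
  have [measurable]: "g \<in> borel_measurable borel" using borel_measurable_integrable[OF g] by simp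
  let ?p = "\<lambda>y. max 0 (g y)" and ?n = "\<lambda>y. max 0 (- g y)"
  have p: "integrable lborel (\<lambda>y. ?p y * indicator {x<..} y)" for x
    by (rule integrable_real_mult_indicator) (use g in auto)
  have n: "integrable lborel (\<lambda>y. ?n y * indicator {x<..} y)" for x
    by (rule integrable_real_mult_indicator) (use g in auto)
  have ep: "emeasure (density lborel (\<lambda>y. ennreal (?p y))) {x<..} = ennreal (LINT y|lborel. ?p y * indicator {x<..} y)" for x
    by (subst emeasure_density) (auto simp: ennreal_indicator[symmetric] ennreal_mult[symmetric] nn_integral_eq_integral[OF p])
  have en: "emeasure (density lborel (\<lambda>y. ennreal (?n y))) {x<..} = ennreal (LINT y|lborel. ?n y * indicator {x<..} y)" for x
    by (subst emeasure_density) (auto simp: ennreal_indicator[symmetric] ennreal_mult[symmetric] nn_integral_eq_integral[OF n])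
  have eq: "(LINT y|lborel. ?p y * indicator {x<..} y) = (LINT y|lborel. ?n y * indicator {x<..} y)" for x
  proof -
    have "(LINT y|lborel. ?p y * indicator {x<..} y) - (LINT y|lborel. ?n y * indicator {x<..} y)
        = (LINT y|lborel. indicator {x<..} y * g y)"
      unfolding Bochner_Integration.integral_diff[OF p n, symmetric]
      by (intro Bochner_Integration.integral_cong) (auto simp: max_def)
    then show ?thesis using zero[of x] by simp
  qed
  have "density lborel (\<lambda>y. ennreal (?p y)) = density lborel (\<lambda>y. ennreal (?n y))"
    by (rule measure_eqI_lessThan) (auto simp: ep en eq)
  then have "AE y in lborel. ennreal (?p y) = ennreal (?n y)"
    by (intro sigma_finite_measure.density_unique[OF sigma_finite_lborel]) auto
  then show ?thesis by eventually_elim (auto simp: max_def split: if_splits)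
qed

text \<open>Bumps whose rational ends converge to the ends of a tail of the interval converge
  boundedly to its indicator. By dominated convergence all tail integrals vanish.\<close>

lemma AE_zero_if_orthogonal_to_bumps:
  fixes g :: "real \<Rightarrow> real"
  assumes g: "integrable lborel g" and orth: "\<And>\<eta>. \<eta> \<in> rational_bumps a b \<Longrightarrow> (LINT y|lborel. g y * \<eta> y) = 0"
    and ab: "a < b"
  shows "AE y in lborel. y \<in> {a<..<b} \<longrightarrow> g y = 0"
proof -
  let ?g = "\<lambda>y. g y * indicator {a<..<b} y"
  have [measurable]: "g \<in> borel_measurable borel" using borel_measurable_integrable[OF g] by simp
  have "AE y in lborel. ?g y = 0"
  proof (rule AE_zero_if_tail_integrals_zero)
    show "integrable lborel ?g" by (rule integrable_real_mult_indicator) (use g in auto)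
    fix x0 :: real
    define x where "x = max a x0"
    show "(LINT y|lborel. indicator {x0<..} y * ?g y) = 0"
    proof (cases "x < b")
      case False
      then have "(\<lambda>y. indicator {x0<..} y * ?g y) = (\<lambda>_. 0)"
        using ab by (auto simp: x_def indicator_def max_def fun_eq_iff split: if_splits)
      then show ?thesis by simp
    next
      case True
      \<comment> \<open>The divisor n + 3 ensures 3 h n \<le> b - x, so that the left end chosen
        within h n of x lies before the right end chosen within h n of b for every n, not merely
        eventually.\<close>
      define h where "h n = (b - x) / real (n + 3)" for n :: nat
      have h: "h n > 0" "3 * h n \<le> b - x" for n
        using True mult_left_mono[of 3 "real n + 3" "b - x"] by (auto simp: h_def divide_simps mult.commute)
      have hlim: "h \<longlonglongrightarrow> 0" unfolding h_def
        using LIMSEQ_ignore_initial_segment[OF tendsto_mult_right_zero[OF lim_1_over_n], of "b - x" 3] by simp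
      have "\<forall>n. \<exists>c. c \<in> \<rat> \<and> x < c \<and> c < x + h n" using Rats_dense_in_real[of x "x + h _"] h by force
      then obtain c where c: "\<And>n. c n \<in> \<rat>" "\<And>n. x < c n" "\<And>n. c n < x + h n" by metis
      have "\<forall>n. \<exists>d. d \<in> \<rat> \<and> b - h n < d \<and> d < b" using Rats_dense_in_real[of "b - h _" b] h by force
      then obtain d where d: "\<And>n. d n \<in> \<rat>" "\<And>n. b - h n < d n" "\<And>n. d n < b" by metis
      have clim: "c \<longlonglongrightarrow> x"
        by (rule tendsto_sandwich[of "\<lambda>_. x" _ _ "\<lambda>n. x + h n"])
           (use c tendsto_add[OF tendsto_const hlim, of x] in \<open>auto intro!: always_eventually less_imp_le\<close>)
      have dlim: "d \<longlonglongrightarrow> b"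
        by (rule tendsto_sandwich[of "\<lambda>n. b - h n" _ _ "\<lambda>_. b"])
           (use d tendsto_diff[OF tendsto_const hlim, of b] in \<open>auto intro!: always_eventually less_imp_le\<close>)
      have cd: "c n < d n" for n using c(3)[of n] d(2)[of n] h[of n] by linarith
      let ?\<eta> = "\<lambda>n. bump n (c n) (d n)"
      have "?\<eta> n \<in> rational_bumps a b" for n
        using c(1,2)[of n] d(1,3)[of n] cd[of n] by (auto simp: rational_bumps_def x_def)
      then have z: "(LINT y|lborel. g y * ?\<eta> n y) = 0" for n by (rule orth)
      have \<eta>m: "?\<eta> n \<in> borel_measurable borel" for n
        by (rule test_functions_continuous(3)[OF bump_test_function[of "c n - 1" _ _ "d n + 1"]]) (use cd in auto)
      have "(\<lambda>n. LINT y|lborel. g y * ?\<eta> n y) \<longlonglongrightarrow> (LINT y|lborel. indicator {x0<..} y * ?g y)"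
      proof (rule integral_dominated_convergence)
        show "(\<lambda>y. g y * ?\<eta> n y) \<in> borel_measurable lborel" for n using \<eta>m by simp
        show "integrable lborel (\<lambda>y. \<bar>g y\<bar>)" using g by simp
        show "AE y in lborel. norm (g y * ?\<eta> n y) \<le> \<bar>g y\<bar>" for n
          using bump_bounds[of n "c n" "d n"] by (auto simp: abs_mult intro!: mult_left_le)
        show "AE y in lborel. (\<lambda>n. g y * ?\<eta> n y) \<longlonglongrightarrow> indicator {x0<..} y * ?g y"
        proof (rule AE_I2)
          fix y
          show "(\<lambda>n. g y * ?\<eta> n y) \<longlonglongrightarrow> indicator {x0<..} y * ?g y"
          proof (cases "x < y \<and> y < b")
            case True
            then have "(\<lambda>n. g y * ?\<eta> n y) \<longlonglongrightarrow> g y * 1"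
              by (intro tendsto_intros bump_tendsto[of x _ b]) (use clim dlim in auto)
            then show ?thesis using True by (auto simp: x_def)
          next
            case False
            have "?\<eta> n y = 0" for n
              by (rule bump_outside) (use False c(2)[of n] d(3)[of n] in auto)
            moreover have "indicator {x0<..} y * ?g y = 0" using False by (auto simp: x_def indicator_def)
            ultimately show ?thesis by (simp only: mult_zero_right tendsto_const)
          qed
        qed
      qed simp
      then show ?thesis by (simp add: z LIMSEQ_const_iff)
    qed
  qed
  then show ?thesis by eventually_elim (auto simp: indicator_def)
qed

subsection \<open>The du Bois-Reymond lemma\<close>

lemma smooth_lincomb:
  fixes f g :: "real \<Rightarrow> real"
  assumes "\<And>n x. ((deriv ^^ n) f) differentiable (at x)" "\<And>n x. ((deriv ^^ n) g) differentiable (at x)"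
  shows "((deriv ^^ n) (\<lambda>x. \<alpha> * f x + \<beta> * g x)) differentiable (at x)"
proof (rule smooth_coinduct[where C="{\<lambda>x. \<alpha> * (deriv ^^ m) f x + \<beta> * (deriv ^^ m) g x | m. True}"])
  show "(\<lambda>x. \<alpha> * f x + \<beta> * g x) \<in> {\<lambda>x. \<alpha> * (deriv ^^ m) f x + \<beta> * (deriv ^^ m) g x | m. True}"
    by (auto intro!: exI[of _ 0])
  fix h assume "h \<in> {\<lambda>x. \<alpha> * (deriv ^^ m) f x + \<beta> * (deriv ^^ m) g x | m. True}"
  then obtain m where h: "h = (\<lambda>x. \<alpha> * (deriv ^^ m) f x + \<beta> * (deriv ^^ m) g x)" by blast
  have "(h has_real_derivative \<alpha> * (deriv ^^ Suc m) f x + \<beta> * (deriv ^^ Suc m) g x) (at x)" for x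
    unfolding h using assms[of m x]
    by (auto intro!: DERIV_add DERIV_cmult simp: DERIV_deriv_iff_real_differentiable)
  then show "\<exists>h'\<in>{\<lambda>x. \<alpha> * (deriv ^^ m) f x + \<beta> * (deriv ^^ m) g x | m. True}. \<forall>x. (h has_real_derivative h' x) (at x)"
    by (intro bexI[of _ "\<lambda>x. \<alpha> * (deriv ^^ Suc m) f x + \<beta> * (deriv ^^ Suc m) g x"]) blast+
qed

lemma smooth_if_deriv_smooth:
  fixes f :: "real \<Rightarrow> real"
  assumes "\<And>x. (f has_real_derivative f' x) (at x)" "\<And>n x. ((deriv ^^ n) f') differentiable (at x)"
  shows "((deriv ^^ n) f) differentiable (at x)"
proof (cases n)
  case 0
  then show ?thesis using assms(1) by (auto simp: real_differentiable_def)
next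
  case (Suc m)
  have "deriv f = f'" using assms(1) by (auto intro: DERIV_imp_deriv)
  then show ?thesis using assms(2) by (simp only: Suc funpow_Suc_right o_apply)
qed

text \<open>The zero integral makes the primitive vanish to the right of the support as well, so
  that it is again compactly supported.\<close>

lemma test_function_antiderivative:
  fixes f :: "real \<Rightarrow> real"
  assumes smooth: "\<And>n x. ((deriv ^^ n) f) differentiable (at x)"
    and ab: "a < c" "c < d" "d < b" and out: "\<And>x. x \<notin> {c..d} \<Longrightarrow> f x = 0"
    and zero: "(LINT x|lborel. f x) = 0"
  shows "\<exists>\<psi>\<in>test_functions a b. deriv \<psi> = f"
proof -
  have "f differentiable (at x)" for x using smooth[of 0 x] by simp
  then have cont: "continuous_on A f" for A
    by (auto intro!: continuous_at_imp_continuous_on differentiable_imp_continuous_within)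
  define \<psi> where "\<psi> x = (if x \<in> {a..b} then integral {a..x} f else 0)" for x
  have tot: "integral {a..x} f = 0" if "d \<le> x" for x
  proof -
    have si: "set_integrable lborel {a..x} f"
      using borel_integrable_atLeastAtMost'[OF cont] by (simp add: set_integrable_def)
    have "integral {a..x} f = (LINT y:{a..x}|lborel. f y)"
      using set_borel_integral_eq_integral(2)[OF si] by simp
    also have "\<dots> = (LINT y|lborel. f y)" unfolding set_lebesgue_integral_def
    proof (rule Bochner_Integration.integral_cong)
      fix y show "indicator {a..x} y *\<^sub>R f y = f y"
        using out[of y] ab that by (cases "y \<in> {c..d}") auto
    qed simp
    finally show ?thesis using zero by simp
  qed
  have start: "integral {a..x} f = 0" if "x \<le> c" for x
  proof -
    have "integral {a..x} f = integral {a..x} (\<lambda>_. 0)"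
      by (rule integral_spike[of "{c}"]) (use that out in auto)
    then show ?thesis by simp
  qed
  have \<psi>0: "\<psi> x = 0" if "x \<notin> {c<..<d}" for x
    using that tot[of x] start[of x] by (auto simp: \<psi>_def not_less)
  have der: "(\<psi> has_real_derivative f x) (at x)" for x
  proof (cases "x \<in> {a<..<b}")
    case True
    have "((\<lambda>x. integral {a..x} f) has_real_derivative f x) (at x within {a..b})"
      by (rule integral_has_real_derivative[OF cont]) (use True in auto)
    then have "((\<lambda>x. integral {a..x} f) has_real_derivative f x) (at x)"
      using True by (subst (asm) at_within_interior) auto
    then show ?thesis
      by (rule has_field_derivative_transform_within_open[where S="{a<..<b}"])
         (use True in \<open>auto simp: \<psi>_def\<close>)
  next
    case False
    have "((\<lambda>_. 0) has_real_derivative 0) (at x)" by simp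
    then have "(\<psi> has_real_derivative 0) (at x)"
      by (rule has_field_derivative_transform_within_open[where S="- {c..d}"])
         (use False ab \<psi>0 in auto)
    then show ?thesis using out[of x] False ab by auto
  qed
  have "\<psi> \<in> test_functions a b"
    unfolding test_functions_def
    using smooth_if_deriv_smooth[OF der smooth] ab \<psi>0 by (auto intro!: exI[of _ "{c..d}"])
  moreover have "deriv \<psi> = f" using der by (auto intro: DERIV_imp_deriv)
  ultimately show ?thesis by blast
qed

section \<open>Volterra operators and the primitive\<close>

text \<open>The kernel of the causal convolution with \<open>\<phi>\<close> on (0, L). The constant
  1 gives the primitive vanishing at 0, a decaying exponential the average over the past.\<close>

definition volterra :: "real \<Rightarrow> (real \<Rightarrow> real) \<Rightarrow> real \<times> real \<Rightarrow> real" where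
  "volterra L \<phi> = (\<lambda>(t, s). if 0 < s \<and> s \<le> t \<and> t < L then \<phi> (t - s) else 0)"

lemma volterra_kernel:
  assumes \<phi>: "continuous_on UNIV \<phi>" shows "kernel_on {0<..<L} (volterra L \<phi>)"
proof -
  have [measurable]: "\<phi> \<in> borel_measurable borel" using \<phi> by (rule borel_measurable_continuous_onI)
  have "volterra L \<phi> \<in> borel_measurable (borel \<Otimes>\<^sub>M borel)" unfolding volterra_def by measurable
  moreover have "bounded (\<phi> ` {0..L})"
    by (intro compact_imp_bounded compact_continuous_image continuous_on_subset[OF \<phi>]) auto
  then obtain B where "B > 0" "\<And>x. x \<in> {0..L} \<Longrightarrow> \<bar>\<phi> x\<bar> \<le> B" unfolding bounded_pos by auto
  then have "\<forall>p. \<bar>volterra L \<phi> p\<bar> \<le> B" by (auto simp: volterra_def split: prod.split)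
  then have "\<exists>B. \<forall>p. \<bar>volterra L \<phi> p\<bar> \<le> B" by blast
  moreover have "\<forall>p. p \<notin> {0<..<L} \<times> {0<..<L} \<longrightarrow> volterra L \<phi> p = 0" by (auto simp: volterra_def)
  ultimately show ?thesis unfolding kernel_on_def borel_prod by blast
qed

abbreviation primitive :: "real \<Rightarrow> (real \<Rightarrow> real) \<Rightarrow> real \<Rightarrow> real" where
  "primitive L \<equiv> kernel_op (volterra L (\<lambda>_. 1))"

lemma kernel_primitive: "kernel_on {0<..<L} (volterra L (\<lambda>_. 1))"
  by (rule volterra_kernel) simp

text \<open>Transposing reverses the direction: the integral runs from y to L, where the test
  function vanishes.\<close>

lemma transpose_primitive_deriv:
  assumes \<phi>: "\<phi> \<in> test_functions 0 L"
  shows "kernel_op (transpose_kernel (volterra L (\<lambda>_. 1))) (deriv \<phi>) y = - \<phi> y"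
proof (cases "y \<in> {0<..<L}")
  case True
  have "kernel_op (transpose_kernel (volterra L (\<lambda>_. 1))) (deriv \<phi>) y
      = (LINT t|lborel. indicator {y..L} t *\<^sub>R deriv \<phi> t)"
    unfolding kernel_op_def transpose_kernel_def volterra_def
    by (rule Bochner_Integration.integral_cong)
       (use True test_functions_outside[OF \<phi>] in \<open>auto simp: indicator_def\<close>)
  also have "\<dots> = \<phi> L - \<phi> y"
    using True test_functions_differentiable[OF \<phi>] test_functions_continuous[OF \<phi>]
    by (intro integral_FTC_atLeastAtMost)
       (auto intro: has_field_derivative_at_within simp flip: has_real_derivative_iff_has_vector_derivative)
  finally show ?thesis using test_functions_outside[OF \<phi>] by simp
next
  case False
  then show ?thesis
    using kernel_op_zero[OF kernel_on_transpose[OF kernel_primitive]] test_functions_outside[OF \<phi>] by simp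
qed

lemma integral_primitive_mult_deriv:
  assumes \<phi>: "\<phi> \<in> test_functions 0 L" and g: "integrable lborel g"
  shows "(LINT x|lborel. primitive L g x * deriv \<phi> x) = - (LINT x|lborel. g x * \<phi> x)"
proof -
  have "integrable lborel (deriv \<phi>)"
    using borel_L2_integrable[OF test_functions_borel_L2(2)[OF \<phi>]] by simp
  from kernel_op_adjoint[OF kernel_primitive g this] show ?thesis
    by (simp add: transpose_primitive_deriv[OF \<phi>] mult.commute)
qed

lemma integral_deriv_test_function:
  assumes \<phi>: "\<phi> \<in> test_functions a b" and ab: "a \<le> b"
  shows "(LINT x|lborel. deriv \<phi> x) = 0"
proof -
  have "(LINT x|lborel. deriv \<phi> x) = (LINT t|lborel. indicator {a..b} t *\<^sub>R deriv \<phi> t)"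
  proof (rule Bochner_Integration.integral_cong)
    fix y show "deriv \<phi> y = indicator {a..b} y *\<^sub>R deriv \<phi> y"
      using test_functions_outside(2)[OF \<phi>, of y] by (cases "y \<in> {a<..<b}") auto
  qed simp
  also have "\<dots> = \<phi> b - \<phi> a"
    using ab test_functions_differentiable[OF \<phi>] test_functions_continuous[OF \<phi>]
    by (intro integral_FTC_atLeastAtMost)
       (auto intro: has_field_derivative_at_within simp flip: has_real_derivative_iff_has_vector_derivative)
  finally show ?thesis using test_functions_outside[OF \<phi>] by simp
qed

text \<open>Indirectly: if every bump had integral zero, the indicator of (a, b) would be orthogonal
  to all of them and hence vanish almost everywhere.\<close>

lemma normalized_test_function_ex:
  assumes "a < b"
  obtains n c d m where "a < c" "c < d" "d < b" "m \<noteq> 0" "m = (LINT x|lborel. bump n c d x)"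
proof (rule ccontr)
  assume *: "\<not> thesis"
  note th = that
  have z: "(LINT x|lborel. bump n c d x) = 0" if "a < c" "c < d" "d < b" for n c d
    using th[OF that, of "LINT x|lborel. bump n c d x" n] * by blast
  then have "(LINT y|lborel. indicator {a<..<b} y * \<eta> y) = 0" if "\<eta> \<in> rational_bumps a b" for \<eta>
    using that
  proof -
    have eq: "(\<lambda>y. indicator {a<..<b} y * bump n c d y) = bump n c d" if "a < c" "d < b" for n c d
      using that by (auto simp: fun_eq_iff indicator_def bump_eq)
    show ?thesis using that z
      by (auto simp: rational_bumps_def eq)
  qed
  moreover have "integrable lborel (indicat_real {a<..<b})"
    using assms by (intro integrable_real_indicator) auto
  ultimately have ae: "AE y in lborel. y \<in> {a<..<b} \<longrightarrow> indicat_real {a<..<b} y = 0"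
    using AE_zero_if_orthogonal_to_bumps[OF _ _ assms, of "indicator {a<..<b}"] by auto
  then have "AE y in lborel. y \<notin> {a<..<b}" by eventually_elim auto
  then have "{a<..<b} \<in> null_sets lborel" by (subst AE_iff_null_sets) auto
  then have "emeasure lborel {a<..<b} = 0" by (rule null_setsD1)
  then show False using assms by simp
qed

text \<open>That countably many test functions suffice is needed for \<^const>\<open>has_time_derivative\<close>, where the
  exceptional null set depends on the test function. The constant is an explicit integral so that it
  is measurable in a parameter.\<close>

lemma du_Bois_Reymond:
  assumes L: "0 < L"
  obtains \<D> \<eta>\<^sub>0 B where "countable \<D>" "\<D> \<subseteq> test_functions 0 L"
    "\<eta>\<^sub>0 \<in> borel_measurable borel" "\<And>x. \<bar>\<eta>\<^sub>0 x\<bar> \<le> B" 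
    "\<And>f g. integrable lborel f \<Longrightarrow> integrable lborel g \<Longrightarrow>
      (\<And>\<psi>. \<psi> \<in> \<D> \<Longrightarrow> (LINT x|lborel. f x * deriv \<psi> x) = - (LINT x|lborel. g x * \<psi> x)) \<Longrightarrow>
      AE x in lborel. x \<in> {0<..<L} \<longrightarrow> f x = (LINT y|lborel. (f y - primitive L g y) * \<eta>\<^sub>0 y) + primitive L g x"
proof -
  obtain n\<^sub>0 c\<^sub>0 d\<^sub>0 m\<^sub>0 where 0: "0 < c\<^sub>0" "c\<^sub>0 < d\<^sub>0" "d\<^sub>0 < L" "m\<^sub>0 \<noteq> 0"
    and m\<^sub>0: "m\<^sub>0 = (LINT x|lborel. bump n\<^sub>0 c\<^sub>0 d\<^sub>0 x)"
    by (rule normalized_test_function_ex[OF L])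
  define \<eta>\<^sub>0 where "\<eta>\<^sub>0 x = bump n\<^sub>0 c\<^sub>0 d\<^sub>0 x / m\<^sub>0" for x
  have b0: "bump n\<^sub>0 c\<^sub>0 d\<^sub>0 \<in> test_functions 0 L" by (rule bump_test_function) (use 0 in auto)
  have ib: "integrable lborel \<phi>" if "\<phi> \<in> test_functions 0 L" for \<phi>
    using borel_L2_integrable[OF test_functions_borel_L2(1)[OF that]] by simp
  have rb: "\<eta> \<in> test_functions 0 L" if "\<eta> \<in> rational_bumps 0 L" for \<eta>
    using that by (auto simp: rational_bumps_def intro: bump_test_function)
  \<comment> \<open>A bump minus its integral times \<open>\<eta>\<^sub>0\<close> has integral zero
    and is therefore the derivative of a test function. The countable set of the statement consists
    of these antiderivatives.\<close>
  have "\<exists>\<psi>\<in>test_functions 0 L. deriv \<psi> = (\<lambda>x. \<eta> x - (LINT y|lborel. \<eta> y) * \<eta>\<^sub>0 x)"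
    if \<eta>: "\<eta> \<in> rational_bumps 0 L" for \<eta>
  proof -
    obtain n c d where cd: "0 < c" "c < d" "d < L" and eq: "\<eta> = bump n c d"
      using \<eta> by (auto simp: rational_bumps_def)
    define m where "m = (LINT y|lborel. \<eta> y)"
    have form: "(\<lambda>x. \<eta> x - m * \<eta>\<^sub>0 x) = (\<lambda>x. 1 * bump n c d x + (- m / m\<^sub>0) * bump n\<^sub>0 c\<^sub>0 d\<^sub>0 x)"
      by (auto simp: eq \<eta>\<^sub>0_def)
    have "\<exists>\<psi>\<in>test_functions 0 L. deriv \<psi> = (\<lambda>x. \<eta> x - m * \<eta>\<^sub>0 x)"
    proof (rule test_function_antiderivative[of _ _ "min c c\<^sub>0" "max d d\<^sub>0"])
      show "((deriv ^^ n) (\<lambda>x. \<eta> x - m * \<eta>\<^sub>0 x)) differentiable (at x)" for n x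
        unfolding form by (rule smooth_lincomb; rule bump_smooth) (use cd 0 in auto)
      show "\<eta> x - m * \<eta>\<^sub>0 x = 0" if "x \<notin> {min c c\<^sub>0..max d d\<^sub>0}" for x
      proof -
        have "bump n c d x = 0" "bump n\<^sub>0 c\<^sub>0 d\<^sub>0 x = 0" by (rule bump_outside; use that in auto)+
        then show ?thesis by (simp add: eq \<eta>\<^sub>0_def)
      qed
      have "(LINT x|lborel. \<eta> x - m * \<eta>\<^sub>0 x) = m - m * ((LINT x|lborel. bump n\<^sub>0 c\<^sub>0 d\<^sub>0 x) / m\<^sub>0)"
        unfolding \<eta>\<^sub>0_def m_def using ib[OF rb[OF \<eta>]] ib[OF b0] by simp
      then show "(LINT x|lborel. \<eta> x - m * \<eta>\<^sub>0 x) = 0" using 0 by (simp flip: m\<^sub>0)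
    qed (use cd 0 in auto)
    then show ?thesis by (simp add: m_def)
  qed
  then obtain \<Psi> where \<Psi>: "\<And>\<eta>. \<eta> \<in> rational_bumps 0 L \<Longrightarrow> \<Psi> \<eta> \<in> test_functions 0 L"
    "\<And>\<eta>. \<eta> \<in> rational_bumps 0 L \<Longrightarrow> deriv (\<Psi> \<eta>) = (\<lambda>x. \<eta> x - (LINT y|lborel. \<eta> y) * \<eta>\<^sub>0 x)"
    by metis
  have \<eta>\<^sub>0m [measurable]: "\<eta>\<^sub>0 \<in> borel_measurable borel"
    using test_functions_continuous(3)[OF b0] unfolding \<eta>\<^sub>0_def[abs_def] by measurable
  have \<eta>\<^sub>0b: "\<bar>\<eta>\<^sub>0 x\<bar> \<le> 1 / \<bar>m\<^sub>0\<bar>" for x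
    using bump_bounds[of n\<^sub>0 c\<^sub>0 d\<^sub>0 x] by (simp add: \<eta>\<^sub>0_def abs_divide divide_right_mono)
  show ?thesis
  proof (rule that[of "\<Psi> ` rational_bumps 0 L" \<eta>\<^sub>0 "1 / \<bar>m\<^sub>0\<bar>"])
    show "countable (\<Psi> ` rational_bumps 0 L)" by (intro countable_image countable_rational_bumps)
    show "\<Psi> ` rational_bumps 0 L \<subseteq> test_functions 0 L" using \<Psi>(1) by auto
    fix f g assume f: "integrable lborel f" and g: "integrable lborel g"
      and weak: "\<And>\<psi>. \<psi> \<in> \<Psi> ` rational_bumps 0 L \<Longrightarrow>
        (LINT x|lborel. f x * deriv \<psi> x) = - (LINT x|lborel. g x * \<psi> x)"
    have p: "integrable lborel (primitive L g)"
      using borel_L2_integrable[OF kernel_op_borel_L2[OF kernel_primitive _ g]] by simp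
    define F where "F x = f x - primitive L g x" for x
    have F: "integrable lborel F" unfolding F_def[abs_def] using f p by simp
    define C where "C = (LINT y|lborel. F y * \<eta>\<^sub>0 y)"
    have bm: "integrable lborel (\<lambda>x. h x * \<phi> x)" "integrable lborel (\<lambda>x. h x * deriv \<phi> x)"
      if h: "integrable lborel h" and \<phi>: "\<phi> \<in> test_functions 0 L" for h \<phi>
    proof -
      obtain B where B: "\<And>x. \<bar>\<phi> x\<bar> \<le> B" "\<And>x. \<bar>deriv \<phi> x\<bar> \<le> B"
        using test_functions_bounded[OF \<phi>] by metis
      show "integrable lborel (\<lambda>x. h x * \<phi> x)" "integrable lborel (\<lambda>x. h x * deriv \<phi> x)"
        using integrable_bounded_mult[OF h test_functions_continuous(3)[OF \<phi>] B(1)]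
          integrable_bounded_mult[OF h test_functions_continuous(4)[OF \<phi>] B(2)]
        by (simp_all add: mult.commute)
    qed
    have F0: "integrable lborel (\<lambda>x. F x * \<eta>\<^sub>0 x)"
      using integrable_bounded_mult[OF F \<eta>\<^sub>0m \<eta>\<^sub>0b] by (simp add: mult.commute)
    have i1: "integrable lborel (indicat_real {0<..<L})" using L by (intro integrable_real_indicator) auto
    \<comment> \<open>\<open>F\<close> is orthogonal to every combination of integral zero.
      Unfolding \<open>C\<close>, this says that \<open>F\<close> minus the constant
      \<open>C\<close> is orthogonal to the bumps themselves.\<close>
    have "AE y in lborel. y \<in> {0<..<L} \<longrightarrow> F y - C * indicator {0<..<L} y = 0"
    proof (rule AE_zero_if_orthogonal_to_bumps[OF _ _ L])
      show "integrable lborel (\<lambda>y. F y - C * indicator {0<..<L} y)" using F i1 by simp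
      fix \<eta> assume \<eta>: "\<eta> \<in> rational_bumps 0 L"
      note \<psi> = \<Psi>[OF \<eta>]
      have "(LINT x|lborel. F x * deriv (\<Psi> \<eta>) x)
          = (LINT x|lborel. f x * deriv (\<Psi> \<eta>) x) - (LINT x|lborel. primitive L g x * deriv (\<Psi> \<eta>) x)"
        unfolding F_def left_diff_distrib using bm(2)[OF f \<psi>(1)] bm(2)[OF p \<psi>(1)] by simp
      also have "\<dots> = 0" using weak[of "\<Psi> \<eta>"] integral_primitive_mult_deriv[OF \<psi>(1) g] \<eta> by simp
      finally have "0 = (LINT x|lborel. F x * \<eta> x - (LINT y|lborel. \<eta> y) * (F x * \<eta>\<^sub>0 x))"
        unfolding \<psi>(2) by (simp add: algebra_simps)
      also have "\<dots> = (LINT x|lborel. F x * \<eta> x) - (LINT y|lborel. \<eta> y) * C"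
        using bm(1)[OF F rb[OF \<eta>]] F0 by (simp add: C_def)
      finally have 1: "(LINT x|lborel. F x * \<eta> x) = C * (LINT y|lborel. \<eta> y)" by simp
      have "(LINT y|lborel. (F y - C * indicator {0<..<L} y) * \<eta> y) = (LINT y|lborel. F y * \<eta> y - C * \<eta> y)"
        by (rule Bochner_Integration.integral_cong)
           (use test_functions_outside[OF rb[OF \<eta>]] in \<open>auto simp: indicator_def algebra_simps\<close>)
      also have "\<dots> = 0" using 1 bm(1)[OF F rb[OF \<eta>]] ib[OF rb[OF \<eta>]] by simp
      finally show "(LINT y|lborel. (F y - C * indicator {0<..<L} y) * \<eta> y) = 0" .
    qed
    then show "AE x in lborel. x \<in> {0<..<L} \<longrightarrow>
        f x = (LINT y|lborel. (f y - primitive L g y) * \<eta>\<^sub>0 y) + primitive L g x"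
      by eventually_elim (auto simp: F_def C_def)
  qed (fact \<eta>\<^sub>0m \<eta>\<^sub>0b)+
qed

subsection \<open>Weak derivatives and primitives\<close>

lemma L2_weak_derivative_borel:
  assumes w: "has_L2_weak_derivative a b f g"
    and f': "f' \<in> borel_L2 {a<..<b}" "AE x in lebesgue_on {a<..<b}. f x = f' x"
    and g': "g' \<in> borel_L2 {a<..<b}" "AE x in lebesgue_on {a<..<b}. g x = g' x"
    and \<phi>: "\<phi> \<in> test_functions a b"
  shows "(LINT x|lborel. f' x * deriv \<phi> x) = - (LINT x|lborel. g' x * \<phi> x)"
proof -
  note [measurable] = borel_L2_measurable[OF f'(1)] borel_L2_measurable[OF g'(1)]
    test_functions_continuous(3,4)[OF \<phi>]
  have "(LINT x|lebesgue_on {a<..<b}. f x * deriv \<phi> x) = (LINT x|lborel. f' x * deriv \<phi> x)"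
    by (rule integral_lebesgue_on_eq(1))
       (use f'(2) borel_L2_outside[OF f'(1)] in \<open>auto elim: eventually_mono\<close>)
  moreover have "(LINT x|lebesgue_on {a<..<b}. g x * \<phi> x) = (LINT x|lborel. g' x * \<phi> x)"
    by (rule integral_lebesgue_on_eq(1))
       (use g'(2) borel_L2_outside[OF g'(1)] in \<open>auto elim: eventually_mono\<close>)
  ultimately show ?thesis using w \<phi> by (simp add: has_L2_weak_derivative_def)
qed

lemma has_L2_weak_derivativeI:
  assumes f: "f \<in> borel_L2 {a<..<b}" and g: "g \<in> borel_L2 {a<..<b}"
    and w: "\<And>\<phi>. \<phi> \<in> test_functions a b \<Longrightarrow> (LINT x|lborel. f x * deriv \<phi> x) = - (LINT x|lborel. g x * \<phi> x)"
  shows "has_L2_weak_derivative a b f g"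
proof -
  note [measurable] = borel_L2_measurable[OF f] borel_L2_measurable[OF g]
  have "(LINT x|lebesgue_on {a<..<b}. f x * deriv \<phi> x) = - (LINT x|lebesgue_on {a<..<b}. g x * \<phi> x)"
    if \<phi>: "\<phi> \<in> test_functions a b" for \<phi>
  proof -
    note [measurable] = test_functions_continuous(3,4)[OF \<phi>]
    have "(LINT x|lebesgue_on {a<..<b}. f x * deriv \<phi> x) = (LINT x|lborel. f x * deriv \<phi> x)"
      by (rule integral_lebesgue_on_eq(1)) (use borel_L2_outside[OF f] in auto)
    moreover have "(LINT x|lebesgue_on {a<..<b}. g x * \<phi> x) = (LINT x|lborel. g x * \<phi> x)"
      by (rule integral_lebesgue_on_eq(1)) (use borel_L2_outside[OF g] in auto)
    ultimately show ?thesis using w[OF \<phi>] by simp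
  qed
  then show ?thesis
    using borel_L2_imp_L2(1)[OF f] borel_L2_imp_L2(1)[OF g] by (auto simp: has_L2_weak_derivative_def)
qed

lemma has_L2_weak_derivative_primitive:
  assumes g: "g \<in> borel_L2 {0<..<L}" and f: "f \<in> borel_L2 {0<..<L}" and L: "0 < L"
    and eq: "AE x in lborel. x \<in> {0<..<L} \<longrightarrow> f x = c + primitive L g x"
  shows "has_L2_weak_derivative 0 L f g"
proof (rule has_L2_weak_derivativeI[OF f g])
  fix \<phi> assume \<phi>: "\<phi> \<in> test_functions 0 L"
  note d = test_functions_borel_L2(2)[OF \<phi>]
  have gi: "integrable lborel g" using borel_L2_integrable[OF g] by simp
  have p: "primitive L g \<in> borel_L2 {0<..<L}" by (rule kernel_op_borel_L2[OF kernel_primitive _ gi]) simp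
  note [measurable] = borel_L2_measurable[OF f] borel_L2_measurable[OF p] borel_L2_measurable[OF d]
  have "(LINT x|lborel. f x * deriv \<phi> x) = (LINT x|lborel. c * deriv \<phi> x + primitive L g x * deriv \<phi> x)"
  proof (rule integral_cong_AE)
    show "AE x in lborel. f x * deriv \<phi> x = c * deriv \<phi> x + primitive L g x * deriv \<phi> x"
      using eq
    proof eventually_elim
      case (elim x)
      then show ?case using test_functions_outside(2)[OF \<phi>, of x]
        by (cases "x \<in> {0<..<L}") (auto simp: algebra_simps)
    qed
  qed auto
  also have "\<dots> = c * (LINT x|lborel. deriv \<phi> x) + (LINT x|lborel. primitive L g x * deriv \<phi> x)"
    using borel_L2_integrable[OF d] borel_L2_mult_integrable[OF p d] by simp
  also have "\<dots> = - (LINT x|lborel. g x * \<phi> x)"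
    using integral_deriv_test_function[OF \<phi>] integral_primitive_mult_deriv[OF \<phi> gi] L by simp
  finally show "(LINT x|lborel. f x * deriv \<phi> x) = - (LINT x|lborel. g x * \<phi> x)" .
qed

lemma L2_weak_derivative_imp_primitive:
  assumes w: "has_L2_weak_derivative 0 L f g" and L: "0 < L"
    and f': "f' \<in> borel_L2 {0<..<L}" "AE x in lebesgue_on {0<..<L}. f x = f' x"
    and g': "g' \<in> borel_L2 {0<..<L}" "AE x in lebesgue_on {0<..<L}. g x = g' x"
  obtains c where "AE x in lborel. x \<in> {0<..<L} \<longrightarrow> f' x = c + primitive L g' x"
proof -
  obtain \<D> \<eta>\<^sub>0 B where D: "countable \<D>" "\<D> \<subseteq> test_functions 0 L"
    "\<eta>\<^sub>0 \<in> borel_measurable borel" "\<And>x. \<bar>\<eta>\<^sub>0 x\<bar> \<le> B" 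
    "\<And>f g. integrable lborel f \<Longrightarrow> integrable lborel g \<Longrightarrow>
      (\<And>\<psi>. \<psi> \<in> \<D> \<Longrightarrow> (LINT x|lborel. f x * deriv \<psi> x) = - (LINT x|lborel. g x * \<psi> x)) \<Longrightarrow>
      AE x in lborel. x \<in> {0<..<L} \<longrightarrow> f x = (LINT y|lborel. (f y - primitive L g y) * \<eta>\<^sub>0 y) + primitive L g x"
    by (rule du_Bois_Reymond[OF L]) iprover
  have "AE x in lborel. x \<in> {0<..<L} \<longrightarrow>
      f' x = (LINT y|lborel. (f' y - primitive L g' y) * \<eta>\<^sub>0 y) + primitive L g' x"
  proof (rule D(5))
    show "integrable lborel f'" "integrable lborel g'"
      using borel_L2_integrable[OF f'(1)] borel_L2_integrable[OF g'(1)] by simp_all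
    show "(LINT x|lborel. f' x * deriv \<psi> x) = - (LINT x|lborel. g' x * \<psi> x)" if "\<psi> \<in> \<D>" for \<psi>
      using that D(2) by (intro L2_weak_derivative_borel[OF w f' g']) auto
  qed
  then show ?thesis by (rule that)
qed

lemma L2_weak_derivative_unique:
  assumes 1: "has_L2_weak_derivative a b f g\<^sub>1" and 2: "has_L2_weak_derivative a b f g\<^sub>2" and ab: "a < b"
  shows "AE x in lebesgue_on {a<..<b}. g\<^sub>1 x = g\<^sub>2 x"
proof -
  have m: "{a<..<b} \<in> sets borel" by simp
  from 1 2 have L: "L2 {a<..<b} f" "L2 {a<..<b} g\<^sub>1" "L2 {a<..<b} g\<^sub>2" by (auto simp: has_L2_weak_derivative_def)
  obtain f' where f': "f' \<in> borel_L2 {a<..<b}" "AE x in lebesgue_on {a<..<b}. f x = f' x"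
    using L2_obtain_borel[OF L(1) m] by blast
  obtain h\<^sub>1 where h1: "h\<^sub>1 \<in> borel_L2 {a<..<b}" "AE x in lebesgue_on {a<..<b}. g\<^sub>1 x = h\<^sub>1 x"
    using L2_obtain_borel[OF L(2) m] by blast
  obtain h\<^sub>2 where h2: "h\<^sub>2 \<in> borel_L2 {a<..<b}" "AE x in lebesgue_on {a<..<b}. g\<^sub>2 x = h\<^sub>2 x"
    using L2_obtain_borel[OF L(3) m] by blast
  have "AE x in lborel. x \<in> {a<..<b} \<longrightarrow> h\<^sub>1 x - h\<^sub>2 x = 0"
  proof (rule AE_zero_if_orthogonal_to_bumps[OF _ _ ab])
    show "integrable lborel (\<lambda>x. h\<^sub>1 x - h\<^sub>2 x)"
      using borel_L2_integrable[OF h1(1)] borel_L2_integrable[OF h2(1)] by simp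
    fix \<eta> assume "\<eta> \<in> rational_bumps a b"
    then have \<eta>: "\<eta> \<in> test_functions a b" by (auto simp: rational_bumps_def intro: bump_test_function)
    note i = borel_L2_mult_integrable[OF _ test_functions_borel_L2(1)[OF \<eta>]]
    show "(LINT y|lborel. (h\<^sub>1 y - h\<^sub>2 y) * \<eta> y) = 0"
      using L2_weak_derivative_borel[OF 1 f' h1 \<eta>] L2_weak_derivative_borel[OF 2 f' h2 \<eta>]
        i[OF h1(1)] i[OF h2(1)] by (simp add: left_diff_distrib)
  qed
  then have "AE x in lebesgue_on {a<..<b}. h\<^sub>1 x = h\<^sub>2 x"
    by (simp add: AE_lebesgue_on_iff)
  with h1(2) h2(2) show ?thesis by eventually_elim simp
qed

text \<open>The set where the chosen and the given continuous function agree is closed in the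
  interval and contains almost every point of (a, b); it therefore contains (a, b) and its closure,
  so the choice does not matter.\<close>

lemma continuous_representative_eq:
  assumes g: "continuous_on {a..b} g" and ae: "AE x in lebesgue_on {a<..<b}. g x = f x" and ab: "a < b"
    and x: "x \<in> {a..b}"
  shows "continuous_representative a b f x = g x"
proof -
  let ?h = "continuous_representative a b f"
  have "continuous_on {a..b} ?h \<and> (AE x in lebesgue_on {a<..<b}. ?h x = f x)"
    unfolding continuous_representative_def by (rule someI[of _ g]) (use g ae in auto)
  then have h: "continuous_on {a..b} ?h" "AE x in lebesgue_on {a<..<b}. ?h x = f x" by auto
  let ?C = "{x \<in> {a..b}. ?h x = g x}"
  have "?C = {x \<in> {a..b}. ?h x - g x = 0}" by auto
  moreover have "closed {x \<in> {a..b}. ?h x - g x = 0}"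
    using continuous_closed_preimage_constant[OF continuous_on_diff[OF h(1) g], of 0] by simp
  ultimately have C: "closed ?C" by simp
  have "AE x in lebesgue_on {a<..<b}. x \<in> ?C"
    using ae h(2) AE_space by eventually_elim (auto simp: space_restrict_space)
  then have "AE x \<in> {a<..<b} in lebesgue. x \<in> ?C"
    by (subst (asm) AE_restrict_space_iff) auto
  then have "{a<..<b} \<subseteq> ?C" using mem_closed_if_AE_lebesgue_open[OF open_greaterThanLessThan C] by blast
  then have "closure {a<..<b} \<subseteq> ?C" using C by (rule closure_minimal)
  then show ?thesis using x ab by auto
qed

text \<open>\<open>primitive\<close> is cut to 0 outside the open interval and so has the wrong
  value at the right end. This version is continuous on the whole line and can serve as a continuous
  representative.\<close>

definition tail_primitive :: "(real \<Rightarrow> real) \<Rightarrow> real \<Rightarrow> real" where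
  "tail_primitive h x = (LINT y|lborel. indicator {..x} y * h y)"

lemma tail_primitive_continuous:
  assumes h: "integrable lborel h" shows "continuous_on A (tail_primitive h)"
proof -
  have [measurable]: "h \<in> borel_measurable borel" using borel_measurable_integrable[OF h] by simp
  have "isCont (tail_primitive h) x" for x
  proof (rule continuous_at_sequentiallyI)
    fix u :: "nat \<Rightarrow> real" assume u: "u \<longlonglongrightarrow> x"
    show "(\<lambda>n. tail_primitive h (u n)) \<longlonglongrightarrow> tail_primitive h x"
      unfolding tail_primitive_def
    proof (rule integral_dominated_convergence)
      show "integrable lborel (\<lambda>y. \<bar>h y\<bar>)" using h by simp
      show "AE y in lborel. norm (indicator {..u n} y * h y) \<le> \<bar>h y\<bar>" for n
        by (auto simp: indicator_def)
      show "AE y in lborel. (\<lambda>n. indicator {..u n} y * h y) \<longlonglongrightarrow> indicator {..x} y * h y"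
        using AE_lborel_singleton[of x]
      proof eventually_elim
        case (elim y)
        have "\<forall>\<^sub>F n in sequentially. indicator {..u n} y * h y = indicator {..x} y * h y"
        proof (cases "y < x")
          case True
          with order_tendstoD(1)[OF u] have "\<forall>\<^sub>F n in sequentially. y < u n" by blast
          then show ?thesis by eventually_elim (use True in \<open>auto simp: indicator_def\<close>)
        next
          case False
          with elim order_tendstoD(2)[OF u, of y] have "\<forall>\<^sub>F n in sequentially. u n < y" by auto
          then show ?thesis by eventually_elim (use False elim in \<open>auto simp: indicator_def\<close>)
        qed
        then show ?case by (rule tendsto_eventually)
      qed
    qed auto
  qed
  then show ?thesis by (auto intro: continuous_at_imp_continuous_on)
qed

lemma tail_primitive_eq_primitive:
  assumes h: "h \<in> borel_L2 {0<..<L}" and x: "x \<in> {0<..<L}"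
  shows "tail_primitive h x = primitive L h x"
  unfolding tail_primitive_def kernel_op_def volterra_def
proof (rule Bochner_Integration.integral_cong)
  fix y show "indicator {..x} y * h y = (case (x, y) of (t, s) \<Rightarrow> if 0 < s \<and> s \<le> t \<and> t < L then 1 else 0) * h y"
    using x borel_L2_outside[OF h, of y] by (cases "y \<in> {0<..<L}") (auto simp: indicator_def)
qed simp

lemma tail_primitive_ends:
  assumes h: "h \<in> borel_L2 {0<..<L}"
  shows "tail_primitive h 0 = 0" "tail_primitive h L = (LINT y|lborel. h y)"
proof -
  have "(\<lambda>y. indicator {..0} y * h y) = (\<lambda>_. 0)"
    using borel_L2_outside[OF h] by (auto simp: indicator_def fun_eq_iff)
  then show "tail_primitive h 0 = 0" by (simp add: tail_primitive_def)
  have "(\<lambda>y. indicator {..L} y * h y) = h"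
  proof
    fix y show "indicator {..L} y * h y = h y"
      using borel_L2_outside[OF h, of y] by (cases "y \<in> {0<..<L}") (auto simp: indicator_def)
  qed
  then show "tail_primitive h L = (LINT y|lborel. h y)" by (simp add: tail_primitive_def)
qed

subsection \<open>The Green kernel of the second derivative\<close>

text \<open>The solution of w'' = delta at y with w(0) = w(l) = 0, that is, the negative of the
  usual positive Green function. The form "particular solution minus linear correction" exhibits the
  x-derivative as a step minus a constant.\<close>

definition green :: "real \<Rightarrow> real \<times> real \<Rightarrow> real" where
  "green l = (\<lambda>(x, y). if 0 < x \<and> x < l \<and> 0 < y \<and> y < l
     then (if y \<le> x then x - y else 0) - x * (l - y) / l else 0)"

definition green_deriv :: "real \<Rightarrow> real \<times> real \<Rightarrow> real" where
  "green_deriv l = (\<lambda>(x, y). if 0 < x \<and> x < l \<and> 0 < y \<and> y < l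
     then (if y \<le> x then 1 else 0) - (l - y) / l else 0)"

lemma green_slope_bounds: "0 \<le> y \<Longrightarrow> y \<le> l \<Longrightarrow> 0 \<le> (l - y) / l \<and> (l - y) / l \<le> (1 :: real)"
  by (cases "l = 0") (auto simp: divide_simps)

lemma kernel_green_deriv: "kernel_on {0<..<l} (green_deriv l)"
proof -
  have "green_deriv l \<in> borel_measurable (borel \<Otimes>\<^sub>M borel)" unfolding green_deriv_def by measurable
  moreover have "\<bar>green_deriv l (x, y)\<bar> \<le> 2" for x y
  proof (cases "0 < x \<and> x < l \<and> 0 < y \<and> y < l")
    case True
    then have "0 \<le> (l - y) / l" "(l - y) / l \<le> 1" using green_slope_bounds[of y l] by auto
    with True show ?thesis unfolding green_deriv_def
      by (simp only: split simp_thms if_True abs_le_iff split: if_split) linarith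
  qed (auto simp: green_deriv_def)
  then have "\<forall>p. \<bar>green_deriv l p\<bar> \<le> 2" by auto
  moreover have "\<forall>p. p \<notin> {0<..<l} \<times> {0<..<l} \<longrightarrow> green_deriv l p = 0" by (auto simp: green_deriv_def)
  ultimately show ?thesis unfolding kernel_on_def borel_prod by blast
qed

lemma kernel_green: "kernel_on {0<..<l} (green l)"
proof -
  have "green l \<in> borel_measurable (borel \<Otimes>\<^sub>M borel)" unfolding green_def by measurable
  moreover have "\<bar>green l (x, y)\<bar> \<le> 2 * \<bar>l\<bar>" for x y
  proof (cases "0 < x \<and> x < l \<and> 0 < y \<and> y < l")
    case True
    have "x * ((l - y) / l) \<le> l * 1" by (rule mult_mono) (use True in auto)
    moreover have "0 \<le> x * ((l - y) / l)" using True by simp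
    ultimately have "0 \<le> x * (l - y) / l" "x * (l - y) / l \<le> l" by simp_all
    with True show ?thesis unfolding green_def by (auto simp only: split simp_thms if_True split: if_splits)
  qed (auto simp: green_def)
  then have "\<forall>p. \<bar>green l p\<bar> \<le> 2 * \<bar>l\<bar>" by auto
  moreover have "\<forall>p. p \<notin> {0<..<l} \<times> {0<..<l} \<longrightarrow> green l p = 0" by (auto simp: green_def)
  ultimately show ?thesis unfolding kernel_on_def borel_prod by blast
qed

text \<open>The case x = l is included: it says that every column of \<open>green_deriv\<close> has
  integral zero, which yields the boundary condition at l.\<close>

lemma integral_green_deriv:
  assumes y: "0 < y" "y < l" and x: "0 < x" "x \<le> l"
  shows "(LINT z|lborel. indicator {..x} z * green_deriv l (z, y)) = (if y \<le> x then x - y else 0) - x * (l - y) / l"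
proof -
  have "(LINT z|lborel. indicator {..x} z * green_deriv l (z, y))
      = (LINT z|lborel. indicator {y..x} z - (l - y) / l * indicator {0..x} z)"
  proof (rule integral_cong_AE)
    show "AE z in lborel. indicator {..x} z * green_deriv l (z, y) = indicator {y..x} z - (l - y) / l * indicator {0..x} z"
      using AE_lborel_singleton[of 0] AE_lborel_singleton[of l]
      by eventually_elim (use y x in \<open>auto simp: green_deriv_def indicator_def\<close>)
    show "(\<lambda>z. indicator {..x} z * green_deriv l (z, y)) \<in> borel_measurable lborel"
      using kernel_on_measurable[OF kernel_green_deriv, measurable] by measurable
  qed simp
  also have "\<dots> = measure lborel {y..x} - (l - y) / l * measure lborel {0..x}"
    by (subst Bochner_Integration.integral_diff) (auto intro!: integrable_real_indicator simp: emeasure_lborel_Icc_eq)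
  finally show ?thesis using x by (auto simp: measure_def emeasure_lborel_Icc_eq)
qed

text \<open>The kernel is a step function minus a function of y alone, so the operator is the
  primitive minus a number depending on \<open>h\<close>. On the right stands the continuous
  representative, from which the slopes at the ends are read off.\<close>

lemma kernel_op_green_deriv_eq:
  assumes h: "h \<in> borel_L2 {0<..<l}" and x: "x \<in> {0<..<l}"
  shows "kernel_op (green_deriv l) h x = tail_primitive h x - (LINT y|lborel. (l - y) / l * h y)"
proof -
  have hi: "integrable lborel h" using borel_L2_integrable[OF h] by simp
  have [measurable]: "h \<in> borel_measurable borel" using borel_L2_measurable[OF h] .
  have i1: "integrable lborel (\<lambda>y. indicator {..x} y * h y)"
    using integrable_real_mult_indicator[OF _ hi, of "{..x}"] by (simp add: mult.commute)
  have "integrable lborel (\<lambda>y. (indicator {0..l} y * ((l - y) / l)) * h y)"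
    by (rule integrable_bounded_mult[OF hi, of _ 1]) (use green_slope_bounds[of _ l] in \<open>auto simp: indicator_def\<close>)
  also have "(\<lambda>y. (indicator {0..l} y * ((l - y) / l)) * h y) = (\<lambda>y. (l - y) / l * h y)"
  proof
    fix y show "(indicator {0..l} y * ((l - y) / l)) * h y = (l - y) / l * h y"
      using borel_L2_outside[OF h, of y] by (cases "y \<in> {0<..<l}") (auto simp: indicator_def)
  qed
  finally have i2: "integrable lborel (\<lambda>y. (l - y) / l * h y)" .
  have "kernel_op (green_deriv l) h x = (LINT y|lborel. indicator {..x} y * h y - (l - y) / l * h y)"
    unfolding kernel_op_def
  proof (rule Bochner_Integration.integral_cong)
    fix y show "green_deriv l (x, y) * h y = indicator {..x} y * h y - (l - y) / l * h y"
      using x borel_L2_outside[OF h, of y]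
      by (cases "y \<in> {0<..<l}") (auto simp: green_deriv_def indicator_def algebra_simps)
  qed simp
  then show ?thesis using i1 i2 by (simp add: tail_primitive_def)
qed

lemma primitive_green_deriv:
  assumes h: "h \<in> borel_L2 {0<..<l}" and x: "x \<in> {0<..<l}"
  shows "primitive l (kernel_op (green_deriv l) h) x = kernel_op (green l) h x"
proof -
  have hi: "integrable lborel h" using borel_L2_integrable[OF h] by simp
  have "(LINT s|lborel. volterra l (\<lambda>_. 1) (x, s) * green_deriv l (s, y)) = green l (x, y)" for y
  proof (cases "y \<in> {0<..<l}")
    case True
    have "(LINT s|lborel. volterra l (\<lambda>_. 1) (x, s) * green_deriv l (s, y))
        = (LINT s|lborel. indicator {..x} s * green_deriv l (s, y))"
      by (rule Bochner_Integration.integral_cong) (use x in \<open>auto simp: volterra_def green_deriv_def indicator_def\<close>)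
    then show ?thesis using integral_green_deriv[of y l x] True x by (simp add: green_def)
  next
    case False
    then have "\<And>s. green_deriv l (s, y) = 0" "green l (x, y) = 0" by (auto simp: green_deriv_def green_def)
    then show ?thesis by simp
  qed
  then show ?thesis
    by (simp add: kernel_op_comp[OF kernel_primitive kernel_green_deriv _ hi]) (simp add: kernel_op_def)
qed

text \<open>By duality with the indicator this reduces to the zero integral of the columns. For G h
  it means that the boundary value at l is zero.\<close>

lemma integral_kernel_op_green_deriv:
  assumes h: "h \<in> borel_L2 {0<..<l}" and l: "0 < l"
  shows "(LINT x|lborel. kernel_op (green_deriv l) h x) = 0"
proof -
  have hi: "integrable lborel h" using borel_L2_integrable[OF h] by simp
  have 1: "integrable lborel (indicat_real {0<..<l})" using l by (intro integrable_real_indicator) auto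
  have z: "kernel_op (transpose_kernel (green_deriv l)) (indicator {0<..<l}) y = 0" for y
  proof (cases "y \<in> {0<..<l}")
    case True
    have "kernel_op (transpose_kernel (green_deriv l)) (indicator {0<..<l}) y = (LINT s|lborel. indicator {..l} s * green_deriv l (s, y))"
      unfolding kernel_op_def transpose_kernel_def
      by (rule Bochner_Integration.integral_cong) (auto simp: green_deriv_def indicator_def)
    then show ?thesis using integral_green_deriv[of y l l] True l by simp
  qed (use kernel_op_zero[OF kernel_on_transpose[OF kernel_green_deriv]] in simp)
  have "(LINT x|lborel. kernel_op (green_deriv l) h x) = (LINT x|lborel. indicator {0<..<l} x * kernel_op (green_deriv l) h x)"
  proof (rule Bochner_Integration.integral_cong)
    fix x show "kernel_op (green_deriv l) h x = indicator {0<..<l} x * kernel_op (green_deriv l) h x"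
      using kernel_op_zero[OF kernel_green_deriv, of x l h] by (cases "x \<in> {0<..<l}") auto
  qed simp
  also have "\<dots> = 0" unfolding kernel_op_adjoint[OF kernel_green_deriv hi 1] z by simp
  finally show ?thesis .
qed

lemma V2_green:
  assumes h: "h \<in> borel_L2 {0<..<l}" and l: "0 < l"
  shows "V2 l (kernel_op (green l) h) (kernel_op (green_deriv l) h) h"
proof -
  have hi: "integrable lborel h" using borel_L2_integrable[OF h] by simp
  have G': "kernel_op (green_deriv l) h \<in> borel_L2 {0<..<l}" by (rule kernel_op_borel_L2[OF kernel_green_deriv _ hi]) simp
  have G: "kernel_op (green l) h \<in> borel_L2 {0<..<l}" by (rule kernel_op_borel_L2[OF kernel_green _ hi]) simp
  have w1: "has_L2_weak_derivative 0 l (kernel_op (green l) h) (kernel_op (green_deriv l) h)"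
    by (rule has_L2_weak_derivative_primitive[OF G' G l, of 0]) (auto simp: primitive_green_deriv[OF h])
  have w2: "has_L2_weak_derivative 0 l (kernel_op (green_deriv l) h) h"
    by (rule has_L2_weak_derivative_primitive[OF h G' l, of "- (LINT y|lborel. (l - y) / l * h y)"])
       (auto simp: kernel_op_green_deriv_eq[OF h] tail_primitive_eq_primitive[OF h])
  have rep: "continuous_representative 0 l (kernel_op (green l) h) x = tail_primitive (kernel_op (green_deriv l) h) x"
    if "x \<in> {0..l}" for x
  proof (rule continuous_representative_eq[OF _ _ l that])
    show "continuous_on {0..l} (tail_primitive (kernel_op (green_deriv l) h))"
      using borel_L2_integrable[OF G'] by (intro tail_primitive_continuous) simp
    show "AE x in lebesgue_on {0<..<l}. tail_primitive (kernel_op (green_deriv l) h) x = kernel_op (green l) h x"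
      by (simp add: AE_lebesgue_on_iff tail_primitive_eq_primitive[OF G'] primitive_green_deriv[OF h])
  qed
  show ?thesis unfolding V2_def
    using w1 w2 rep[of 0] rep[of l] l tail_primitive_ends[OF G'] integral_kernel_op_green_deriv[OF h l] by simp
qed

text \<open>Applying the du Bois-Reymond lemma twice determines v up to an affine function: v = G h
  + c0 + c2 x. The boundary value at 0 forces c0 = 0, then the one at l forces c2 = 0.\<close>

lemma V2_imp_green:
  assumes V: "V2 l v v1 v2" and l: "0 < l"
    and h: "h \<in> borel_L2 {0<..<l}" "AE x in lebesgue_on {0<..<l}. v2 x = h x"
  shows "AE x in lebesgue_on {0<..<l}. v x = kernel_op (green l) h x"
    and "AE x in lebesgue_on {0<..<l}. v1 x = kernel_op (green_deriv l) h x"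
proof -
  have m: "{0<..<l} \<in> sets borel" by simp
  from V have w1: "has_L2_weak_derivative 0 l v v1" and w2: "has_L2_weak_derivative 0 l v1 v2"
    and bc: "continuous_representative 0 l v 0 = 0" "continuous_representative 0 l v l = 0"
    by (auto simp: V2_def)
  then have L: "L2 {0<..<l} v" "L2 {0<..<l} v1" by (auto simp: has_L2_weak_derivative_def)
  obtain v' where v': "v' \<in> borel_L2 {0<..<l}" "AE x in lebesgue_on {0<..<l}. v x = v' x"
    using L2_obtain_borel[OF L(1) m] by blast
  obtain v1' where v1': "v1' \<in> borel_L2 {0<..<l}" "AE x in lebesgue_on {0<..<l}. v1 x = v1' x"
    using L2_obtain_borel[OF L(2) m] by blast
  have hi: "integrable lborel h" using borel_L2_integrable[OF h(1)] by simp
  have G': "kernel_op (green_deriv l) h \<in> borel_L2 {0<..<l}" by (rule kernel_op_borel_L2[OF kernel_green_deriv _ hi]) simp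
  have G'i: "integrable lborel (kernel_op (green_deriv l) h)" using borel_L2_integrable[OF G'] by simp
  obtain c1 where c1: "AE x in lborel. x \<in> {0<..<l} \<longrightarrow> v1' x = c1 + primitive l h x"
    by (rule L2_weak_derivative_imp_primitive[OF w2 l v1' h])
  \<comment> \<open>\<open>c1\<close> is the constant relative to the primitive of \<open>h\<close>;
    adding the rank-one part of \<open>green_deriv\<close> makes it the constant relative to G'
    h.\<close>
  define c2 where "c2 = c1 + (LINT y|lborel. (l - y) / l * h y)"
  have v1'eq: "AE x in lborel. x \<in> {0<..<l} \<longrightarrow> v1' x = c2 + kernel_op (green_deriv l) h x"
    using c1 by eventually_elim (auto simp: c2_def kernel_op_green_deriv_eq[OF h(1)] tail_primitive_eq_primitive[OF h(1)])
  obtain c0 where c0: "AE x in lborel. x \<in> {0<..<l} \<longrightarrow> v' x = c0 + primitive l v1' x"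
    by (rule L2_weak_derivative_imp_primitive[OF w1 l v' v1'])
  have 1: "indicat_real {0<..<l} \<in> borel_L2 {0<..<l}"
    by (rule borel_L2_bounded[of _ 1]) (auto simp: indicator_def)
  have 1: "integrable lborel (\<lambda>x. c2 * indicat_real {0<..<l} x)"
    using borel_L2_integrable[OF 1] by simp
  have "primitive l v1' = primitive l (\<lambda>x. c2 * indicator {0<..<l} x + kernel_op (green_deriv l) h x)"
  proof (rule kernel_op_cong_AE[OF kernel_primitive])
    show "AE x in lborel. v1' x = c2 * indicator {0<..<l} x + kernel_op (green_deriv l) h x"
      using v1'eq
    proof eventually_elim
      case (elim x)
      then show ?case
        using borel_L2_outside[OF v1'(1), of x] borel_L2_outside[OF G', of x] by (cases "x \<in> {0<..<l}") auto
    qed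
  qed (use borel_L2_measurable[OF v1'(1)] borel_L2_measurable[OF G'] in simp_all)
  moreover have "primitive l (indicator {0<..<l}) x = x" if x: "x \<in> {0<..<l}" for x
  proof -
    have "primitive l (indicator {0<..<l}) x = (LINT s|lborel. indicator {0<..x} s)"
      unfolding kernel_op_def volterra_def
      by (rule Bochner_Integration.integral_cong) (use x in \<open>auto simp: indicator_def\<close>)
    then show ?thesis using x by simp
  qed
  ultimately have prim: "primitive l v1' x = c2 * x + primitive l (kernel_op (green_deriv l) h) x" if "x \<in> {0<..<l}" for x
    using that by (simp add: kernel_op_linear(1)[OF kernel_primitive 1 G'i] kernel_op_scale)
  have veq: "AE x in lebesgue_on {0<..<l}. c0 + c2 * x + tail_primitive (kernel_op (green_deriv l) h) x = v x"
  proof -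
    have "AE x in lebesgue_on {0<..<l}. v' x = c0 + primitive l v1' x" using c0 by (simp add: AE_lebesgue_on_iff)
    with v'(2) AE_space show ?thesis
      by eventually_elim (simp add: space_restrict_space prim tail_primitive_eq_primitive[OF G'])
  qed
  have rep: "continuous_representative 0 l v x = c0 + c2 * x + tail_primitive (kernel_op (green_deriv l) h) x"
    if "x \<in> {0..l}" for x
    by (rule continuous_representative_eq[OF _ veq l that]) (intro continuous_intros tail_primitive_continuous G'i)
  have "c0 = 0" using rep[of 0] bc(1) l tail_primitive_ends[OF G'] by simp
  moreover from this have "c2 = 0"
    using rep[of l] bc(2) l tail_primitive_ends[OF G'] integral_kernel_op_green_deriv[OF h(1) l] by simp
  ultimately show "AE x in lebesgue_on {0<..<l}. v x = kernel_op (green l) h x"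
    using veq AE_space
    by (auto elim!: eventually_elim2 simp: space_restrict_space tail_primitive_eq_primitive[OF G'] primitive_green_deriv[OF h(1)])
  have "AE x in lebesgue_on {0<..<l}. v1' x = kernel_op (green_deriv l) h x"
    using v1'eq \<open>c2 = 0\<close> by (simp add: AE_lebesgue_on_iff)
  with v1'(2) show "AE x in lebesgue_on {0<..<l}. v1 x = kernel_op (green_deriv l) h x" by eventually_elim simp
qed

text \<open>The slope is defined through a chosen weak derivative. By uniqueness it agrees almost
  everywhere with G' h, whose continuous representative has known values at the ends.\<close>

lemma V2_boundary_slope:
  assumes V: "V2 l v v1 v2" and l: "0 < l"
    and h: "h \<in> borel_L2 {0<..<l}" "AE x in lebesgue_on {0<..<l}. v2 x = h x"
  shows "continuous_representative 0 l (L2_weak_derivative 0 l v) 0 = - (LINT y|lborel. (l - y) / l * h y)"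
    and "continuous_representative 0 l (L2_weak_derivative 0 l v) l
      = (LINT y|lborel. h y) - (LINT y|lborel. (l - y) / l * h y)"
proof -
  have w: "has_L2_weak_derivative 0 l v v1" using V by (simp add: V2_def)
  then have "has_L2_weak_derivative 0 l v (L2_weak_derivative 0 l v)"
    unfolding L2_weak_derivative_def by (metis someI)
  then have "AE x in lebesgue_on {0<..<l}. L2_weak_derivative 0 l v x = v1 x"
    using w l by (rule L2_weak_derivative_unique)
  with V2_imp_green(2)[OF V l h] AE_space
  have ae: "AE x in lebesgue_on {0<..<l}.
      tail_primitive h x - (LINT y|lborel. (l - y) / l * h y) = L2_weak_derivative 0 l v x"
    by eventually_elim (simp add: space_restrict_space kernel_op_green_deriv_eq[OF h(1)])
  have "continuous_representative 0 l (L2_weak_derivative 0 l v) x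
      = tail_primitive h x - (LINT y|lborel. (l - y) / l * h y)" if "x \<in> {0..l}" for x
    by (rule continuous_representative_eq[OF _ ae l that])
       (use borel_L2_integrable[OF h(1)] in \<open>auto intro!: continuous_intros tail_primitive_continuous\<close>)
  from this[of 0] this[of l] show
    "continuous_representative 0 l (L2_weak_derivative 0 l v) 0 = - (LINT y|lborel. (l - y) / l * h y)"
    "continuous_representative 0 l (L2_weak_derivative 0 l v) l
      = (LINT y|lborel. h y) - (LINT y|lborel. (l - y) / l * h y)"
    using l tail_primitive_ends[OF h(1)] by simp_all
qed

subsection \<open>Integrating out one variable\<close>

text \<open>The Cauchy-Schwarz inequality in the integrated variable for almost every x, then
  integration over x.\<close>

lemma integral_snd_borel_L2:
  fixes g :: "real \<times> real \<Rightarrow> real"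
  assumes g: "g \<in> borel_L2 (X \<times> Y)" and \<omega>: "\<omega> \<in> borel_L2 Z"
  shows "(\<lambda>x. LINT s|lborel. \<omega> s * g (x, s)) \<in> borel_L2 X"
    and "(LINT x|lborel. (LINT s|lborel. \<omega> s * g (x, s))\<^sup>2) \<le> (LINT s|lborel. (\<omega> s)\<^sup>2) * (LINT p|lborel. (g p)\<^sup>2)"
proof -
  have [measurable]: "g \<in> borel_measurable (borel \<Otimes>\<^sub>M borel)"
    using borel_L2_measurable[OF g] by (simp add: borel_prod)
  note [measurable] = borel_L2_measurable[OF \<omega>]
  define W where "W x = (LINT s|lborel. \<omega> s * g (x, s))" for x
  define N where "N x = (LINT s|lborel. (g (x, s))\<^sup>2)" for x
  define q where "q = (LINT s|lborel. (\<omega> s)\<^sup>2)"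
  have [measurable]: "W \<in> borel_measurable borel" unfolding W_def[abs_def] by measurable
  note i = integrable_plane[OF borel_L2_square_integrable[OF g]]
  have N: "integrable lborel N" unfolding N_def[abs_def] by (rule i(3))
  have le: "AE x in lborel. (W x)\<^sup>2 \<le> q * N x"
    using borel_L2_sections(1)[OF g]
  proof eventually_elim
    case (elim x)
    then show ?case unfolding W_def q_def N_def
      by (intro Cauchy_Schwarz_integral)
         (use \<omega> in \<open>auto dest: borel_L2_measurable borel_L2_square_integrable\<close>)
  qed
  have W2: "integrable lborel (\<lambda>x. (W x)\<^sup>2)"
  proof (rule Bochner_Integration.integrable_bound)
    show "integrable lborel (\<lambda>x. q * N x)" using N by simp
    show "AE x in lborel. norm ((W x)\<^sup>2) \<le> norm (q * N x)" using le by eventually_elim simp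
  qed simp
  have "W x = 0" if "x \<notin> X" for x
    using borel_L2_outside[OF g] that by (simp add: W_def)
  then have "W \<in> borel_L2 X" using W2 by (simp add: borel_L2_def)
  then show "(\<lambda>x. LINT s|lborel. \<omega> s * g (x, s)) \<in> borel_L2 X" by (simp add: W_def[abs_def])
  have "(LINT x|lborel. (W x)\<^sup>2) \<le> (LINT x|lborel. q * N x)"
    by (rule integral_mono_AE) (use W2 N le in auto)
  also have "\<dots> = q * (LINT p|lborel. (g p)\<^sup>2)" using i(5) by (simp add: N_def)
  finally show "(LINT x|lborel. (LINT s|lborel. \<omega> s * g (x, s))\<^sup>2) \<le> (LINT s|lborel. (\<omega> s)\<^sup>2) * (LINT p|lborel. (g p)\<^sup>2)"
    by (simp add: W_def q_def)
qed

lemma AE_lebesgue_on_sections: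
  fixes P :: "real \<times> real \<Rightarrow> bool"
  assumes ae: "AE p in lebesgue_on (X \<times> Y). P p" and [measurable]: "X \<in> sets borel" "Y \<in> sets borel"
  shows "AE x in lborel. AE t in lborel. x \<in> X \<longrightarrow> t \<in> Y \<longrightarrow> P (x, t)"
    and "AE t in lborel. AE x in lborel. x \<in> X \<longrightarrow> t \<in> Y \<longrightarrow> P (x, t)"
proof -
  have "X \<times> Y \<in> sets (borel \<Otimes>\<^sub>M borel)" by simp
  then have "X \<times> Y \<in> sets borel" unfolding borel_prod .
  then have "AE p in lborel. p \<in> X \<times> Y \<longrightarrow> P p" using ae by (simp add: AE_lebesgue_on_iff)
  from AE_plane_sections[OF this]
  show "AE x in lborel. AE t in lborel. x \<in> X \<longrightarrow> t \<in> Y \<longrightarrow> P (x, t)"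
    "AE t in lborel. AE x in lborel. x \<in> X \<longrightarrow> t \<in> Y \<longrightarrow> P (x, t)" by auto
qed

lemma cylinder_sets [simp, measurable]: "cylinder l T \<in> sets borel"
proof -
  have "cylinder l T \<in> sets (borel \<Otimes>\<^sub>M borel)" by (simp add: cylinder_def)
  then show ?thesis unfolding borel_prod .
qed

lemma bounded_cylinder: "bounded (cylinder l T)"
  unfolding cylinder_def by (intro bounded_Times) auto

subsection \<open>Weak time derivatives\<close>

text \<open>The row of the kernel at time t is the indicator of (0, t], with squared norm t. The
  factor t makes the primitive tend to 0 in the mean square at the initial time.\<close>

lemma integral_primitive_square_le:
  assumes p: "p \<in> borel_L2 (cylinder l T)" and t: "t \<in> {0<..<T}"
  shows "(\<lambda>x. in_time (primitive T) p (x, t)) \<in> borel_L2 {0<..<l}"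
    and "(LINT x|lborel. (in_time (primitive T) p (x, t))\<^sup>2) \<le> t * (LINT q|lborel. (p q)\<^sup>2)"
proof -
  have row: "(\<lambda>s. volterra T (\<lambda>_. 1) (t, s)) \<in> borel_L2 {0<..<T}"
    by (rule kernel_row_borel_L2[OF kernel_primitive]) simp
  have p': "p \<in> borel_L2 ({0<..<l} \<times> {0<..<T})" using p by (simp add: cylinder_def)
  have "(\<lambda>s. (volterra T (\<lambda>_. 1) (t, s))\<^sup>2) = indicator {0<..t}"
    using t by (auto simp: volterra_def indicator_def fun_eq_iff)
  then have "(LINT s|lborel. (volterra T (\<lambda>_. 1) (t, s))\<^sup>2) = t" using t by simp
  with integral_snd_borel_L2[OF p' row]
  show "(\<lambda>x. in_time (primitive T) p (x, t)) \<in> borel_L2 {0<..<l}"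
    "(LINT x|lborel. (in_time (primitive T) p (x, t))\<^sup>2) \<le> t * (LINT q|lborel. (p q)\<^sup>2)"
    by (simp_all add: in_time_apply kernel_op_def)
qed

lemma time_derivative_imp_primitive:
  assumes d: "has_time_derivative l T u u\<^sub>t" and T: "0 < T"
    and u': "u' \<in> borel_L2 (cylinder l T)" "AE q in lebesgue_on (cylinder l T). u q = u' q"
    and p: "p \<in> borel_L2 (cylinder l T)" "AE q in lebesgue_on (cylinder l T). u\<^sub>t q = p q"
  obtains C where "C \<in> borel_measurable borel"
    "AE x in lborel. x \<in> {0<..<l} \<longrightarrow> (AE t in lborel. t \<in> {0<..<T} \<longrightarrow> u' (x, t) = C x + in_time (primitive T) p (x, t))"
proof -
  obtain \<D> \<eta>\<^sub>0 B where D: "countable \<D>" "\<D> \<subseteq> test_functions 0 T"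
    "\<eta>\<^sub>0 \<in> borel_measurable borel" "\<And>x. \<bar>\<eta>\<^sub>0 x\<bar> \<le> B" 
    "\<And>f g. integrable lborel f \<Longrightarrow> integrable lborel g \<Longrightarrow>
      (\<And>\<psi>. \<psi> \<in> \<D> \<Longrightarrow> (LINT x|lborel. f x * deriv \<psi> x) = - (LINT x|lborel. g x * \<psi> x)) \<Longrightarrow>
      AE x in lborel. x \<in> {0<..<T} \<longrightarrow> f x = (LINT y|lborel. (f y - primitive T g y) * \<eta>\<^sub>0 y) + primitive T g x"
    by (rule du_Bois_Reymond[OF T]) iprover
  note [measurable] = D(3)
  note um [measurable] = borel_L2_measurable[OF u'(1), folded borel_prod]
  note pm [measurable] = borel_L2_measurable[OF p(1), folded borel_prod]
  have Ipm [measurable]: "in_time (primitive T) p \<in> borel_measurable (borel \<Otimes>\<^sub>M borel)"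
    using in_time_kernel_op_measurable[OF kernel_on_measurable[OF kernel_primitive] borel_L2_measurable[OF p(1)]]
    by (simp add: borel_prod)
  define C where "C x = (LINT y|lborel. (u' (x, y) - in_time (primitive T) p (x, y)) * \<eta>\<^sub>0 y)" for x
  have C: "C \<in> borel_measurable borel" unfolding C_def[abs_def] by measurable
  have u'': "u' \<in> borel_L2 ({0<..<l} \<times> {0<..<T})" and p'': "p \<in> borel_L2 ({0<..<l} \<times> {0<..<T})"
    using u'(1) p(1) by (simp_all add: cylinder_def)
  \<comment> \<open>Countability of \<open>\<D>\<close> merges the exceptional sets of x belonging
    to the single test functions into one null set.\<close>
  have weak: "AE x in lborel. \<forall>\<psi>\<in>\<D>. x \<in> {0<..<l} \<longrightarrow>
      (LINT t|lebesgue_on {0<..<T}. u (x, t) * deriv \<psi> t) = - (LINT t|lebesgue_on {0<..<T}. u\<^sub>t (x, t) * \<psi> t)"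
  proof (subst AE_ball_countable[OF D(1)], intro ballI)
    fix \<psi> assume "\<psi> \<in> \<D>"
    then have "\<psi> \<in> test_functions 0 T" using D(2) by auto
    with d have "AE x in lebesgue_on {0<..<l}.
      (LINT t|lebesgue_on {0<..<T}. u (x, t) * deriv \<psi> t) = - (LINT t|lebesgue_on {0<..<T}. u\<^sub>t (x, t) * \<psi> t)"
      by (simp add: has_time_derivative_def)
    then show "AE x in lborel. x \<in> {0<..<l} \<longrightarrow>
      (LINT t|lebesgue_on {0<..<T}. u (x, t) * deriv \<psi> t) = - (LINT t|lebesgue_on {0<..<T}. u\<^sub>t (x, t) * \<psi> t)"
      by (simp add: AE_lebesgue_on_iff)
  qed
  have su: "AE x in lborel. AE t in lborel. x \<in> {0<..<l} \<longrightarrow> t \<in> {0<..<T} \<longrightarrow> u (x, t) = u' (x, t)"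
    by (rule AE_lebesgue_on_sections(1)[OF u'(2)[unfolded cylinder_def]]) auto
  have sp: "AE x in lborel. AE t in lborel. x \<in> {0<..<l} \<longrightarrow> t \<in> {0<..<T} \<longrightarrow> u\<^sub>t (x, t) = p (x, t)"
    by (rule AE_lebesgue_on_sections(1)[OF p(2)[unfolded cylinder_def]]) auto
  have "AE x in lborel. x \<in> {0<..<l} \<longrightarrow> (AE t in lborel. t \<in> {0<..<T} \<longrightarrow> u' (x, t) = C x + in_time (primitive T) p (x, t))"
    using weak su sp borel_L2_sections(1)[OF u''] borel_L2_sections(1)[OF p'']
  proof eventually_elim
    case (elim x)
    show ?case
    proof
      assume x: "x \<in> {0<..<l}"
      note u1 = elim(4) and p1 = elim(5)
      have ae: "AE t in lebesgue_on {0<..<T}. u (x, t) = u' (x, t)" "AE t in lebesgue_on {0<..<T}. u\<^sub>t (x, t) = p (x, t)"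
        using elim(2,3) x by (auto simp: AE_lebesgue_on_iff elim: eventually_mono)
      show "AE t in lborel. t \<in> {0<..<T} \<longrightarrow> u' (x, t) = C x + in_time (primitive T) p (x, t)"
        unfolding C_def in_time_apply
      proof (rule D(5))
        show "integrable lborel (\<lambda>s. u' (x, s))" "integrable lborel (\<lambda>s. p (x, s))"
          using borel_L2_integrable[OF u1] borel_L2_integrable[OF p1] by simp_all
        fix \<psi> assume "\<psi> \<in> \<D>"
        then have \<psi>: "\<psi> \<in> test_functions 0 T" using D(2) by auto
        note [measurable] = test_functions_continuous(3,4)[OF \<psi>]
        have "(LINT t|lebesgue_on {0<..<T}. u (x, t) * deriv \<psi> t) = (LINT t|lborel. u' (x, t) * deriv \<psi> t)"
          by (rule integral_lebesgue_on_eq(1))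
             (use ae(1) borel_L2_outside[OF u1] in \<open>auto elim: eventually_mono\<close>)
        moreover have "(LINT t|lebesgue_on {0<..<T}. u\<^sub>t (x, t) * \<psi> t) = (LINT t|lborel. p (x, t) * \<psi> t)"
          by (rule integral_lebesgue_on_eq(1))
             (use ae(2) borel_L2_outside[OF p1] in \<open>auto elim: eventually_mono\<close>)
        ultimately show "(LINT t|lborel. u' (x, t) * deriv \<psi> t) = - (LINT t|lborel. p (x, t) * \<psi> t)"
          using elim(1) \<open>\<psi> \<in> \<D>\<close> x by auto
      qed
    qed
  qed
  with C show ?thesis by (rule that)
qed

lemma square_add_le: "(a + b)\<^sup>2 \<le> 2 * a\<^sup>2 + 2 * (b :: real)\<^sup>2"
  using sum_squares_bound[of a b] by (simp add: power2_sum)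

text \<open>The difference of u and the primitive of u_t is a function c of x alone. At almost every
  small time t, c is the continuous representative at t minus the primitive at t, and both are small
  in the mean square; hence c = 0.\<close>

lemma time_derivative_vanishing_at_0:
  assumes d: "has_time_derivative l T u u\<^sub>t" and z: "vanishes_at_time l T u 0" and T: "0 < T"
    and u': "u' \<in> borel_L2 (cylinder l T)" "AE q in lebesgue_on (cylinder l T). u q = u' q"
    and p: "p \<in> borel_L2 (cylinder l T)" "AE q in lebesgue_on (cylinder l T). u\<^sub>t q = p q"
  shows "AE q in lborel. u' q = in_time (primitive T) p q"
proof -
  obtain C where Cm [measurable]: "C \<in> borel_measurable borel"
    and C: "AE x in lborel. x \<in> {0<..<l} \<longrightarrow> (AE t in lborel. t \<in> {0<..<T} \<longrightarrow> u' (x, t) = C x + in_time (primitive T) p (x, t))"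
    by (rule time_derivative_imp_primitive[OF d T u' p])
  define c where "c x = C x * indicator {0<..<l} x" for x
  have cm [measurable]: "c \<in> borel_measurable borel" unfolding c_def[abs_def] by measurable
  have Ip: "in_time (primitive T) p \<in> borel_L2 (cylinder l T)"
    using in_time_borel_L2[OF kernel_primitive] p(1) by (simp add: cylinder_def)
  note [measurable] = borel_L2_measurable[OF Ip, folded borel_prod] borel_L2_measurable[OF u'(1), folded borel_prod]
  have out: "u' (x, t) = 0" "in_time (primitive T) p (x, t) = 0" if "x \<notin> {0<..<l} \<or> t \<notin> {0<..<T}" for x t
    using that borel_L2_outside[OF u'(1), of "(x, t)"] borel_L2_outside[OF Ip, of "(x, t)"]
    by (auto simp: cylinder_def)
  have eq: "AE x in lborel. AE t in lborel. u' (x, t) = c x * indicator {0<..<T} t + in_time (primitive T) p (x, t)"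
    using C
  proof eventually_elim
    case (elim x)
    show ?case
    proof (cases "x \<in> {0<..<l}")
      case True
      with elim have "AE t in lborel. t \<in> {0<..<T} \<longrightarrow> u' (x, t) = C x + in_time (primitive T) p (x, t)" by simp
      then show ?thesis by eventually_elim (use True out in \<open>auto simp: c_def indicator_def\<close>)
    qed (simp add: out c_def)
  qed
  have eq2: "AE q in lborel. u' q = c (fst q) * indicator {0<..<T} (snd q) + in_time (primitive T) p q"
  proof (rule AE_plane_eqI(1))
    have "(\<lambda>q. c (fst q) * indicator {0<..<T} (snd q) + in_time (primitive T) p q) \<in> borel_measurable (borel \<Otimes>\<^sub>M borel)"
      by measurable
    then show "(\<lambda>q. c (fst q) * indicator {0<..<T} (snd q) + in_time (primitive T) p q) \<in> borel_measurable borel"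
      by (simp add: borel_prod)
  qed (use eq borel_L2_measurable[OF u'(1)] in auto)
  obtain w where w: "\<And>t. t \<in> {0..T} \<Longrightarrow> L2 {0<..<l} (\<lambda>x. w (x, t))"
    "((\<lambda>t'. L2_norm {0<..<l} (\<lambda>x. w (x, t') - w (x, 0))) \<longlongrightarrow> 0) (at 0 within {0..T})"
    "AE t in lebesgue_on {0<..<T}. AE x in lebesgue_on {0<..<l}. w (x, t) = u (x, t)"
    "AE x in lebesgue_on {0<..<l}. w (x, 0) = 0"
    using z T unfolding vanishes_at_time_def by force
  have su: "AE t in lborel. AE x in lborel. x \<in> {0<..<l} \<longrightarrow> t \<in> {0<..<T} \<longrightarrow> u (x, t) = u' (x, t)"
    by (rule AE_lebesgue_on_sections(2)[OF u'(2)[unfolded cylinder_def]]) auto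
  have good: "AE t in lborel. t \<in> {0<..<T} \<longrightarrow>
      (AE x in lebesgue_on {0<..<l}. w (x, t) = c x + in_time (primitive T) p (x, t))"
    using AE_plane_sections(2)[OF eq2] su w(3)[unfolded AE_lebesgue_on_iff[of "{0<..<T}", simplified]]
  proof eventually_elim
    case (elim t)
    show ?case
    proof
      assume t: "t \<in> {0<..<T}"
      have "AE x in lebesgue_on {0<..<l}. u' (x, t) = c x + in_time (primitive T) p (x, t)"
        "AE x in lebesgue_on {0<..<l}. u (x, t) = u' (x, t)"
        using elim(1,2) t by (auto simp: AE_lebesgue_on_iff elim: eventually_mono)
      moreover have "AE x in lebesgue_on {0<..<l}. w (x, t) = u (x, t)" using elim(3) t by simp
      ultimately show "AE x in lebesgue_on {0<..<l}. w (x, t) = c x + in_time (primitive T) p (x, t)"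
        by eventually_elim simp
    qed
  qed
  define M where "M = (LINT q|lborel. (p q)\<^sup>2)"
  have M: "M \<ge> 0" by (simp add: M_def)
  \<comment> \<open>Square integrability belongs to the claim: \<open>C\<close> is so far only
    measurable, and without integrability a vanishing integral would say nothing.\<close>
  have bound: "integrable lborel (\<lambda>x. (c x)\<^sup>2) \<and> (LINT x|lborel. (c x)\<^sup>2) \<le> 2 * \<delta>\<^sup>2 + 2 * (\<delta> * M)" if \<delta>: "\<delta> > 0" for \<delta>
  proof -
    have "\<forall>\<^sub>F t in at 0 within {0..T}. L2_norm {0<..<l} (\<lambda>x. w (x, t) - w (x, 0)) < \<delta>"
      using w(2) \<delta> by (rule order_tendstoD(2))
    then obtain d where d: "d > 0" "\<And>t. t \<in> {0..T} \<Longrightarrow> t \<noteq> 0 \<Longrightarrow> dist t 0 < d \<Longrightarrow> L2_norm {0<..<l} (\<lambda>x. w (x, t) - w (x, 0)) < \<delta>"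
      unfolding eventually_at by auto
    define m where "m = min (min d \<delta>) T"
    have m: "m > 0" using d \<delta> T by (simp add: m_def)
    \<comment> \<open>The representation holds for almost every time only; a suitable t below
      \<open>m\<close> exists because (0, m) is not a null set.\<close>
    obtain t where t: "t \<in> {0<..<m}" "AE x in lebesgue_on {0<..<l}. w (x, t) = c x + in_time (primitive T) p (x, t)"
    proof (rule ccontr)
      assume *: "\<not> thesis"
      note th = that
      have "AE t in lborel. t \<notin> {0<..<m}"
        using good
      proof eventually_elim
        case (elim t)
        then show ?case using * th[of t] by (auto simp: m_def)
      qed
      then have "{0<..<m} \<in> null_sets lborel" by (subst AE_iff_null_sets) auto
      then have "emeasure lborel {0<..<m} = 0" by (rule null_setsD1)
      then show False using m by simp
    qed
    have tT: "t \<in> {0<..<T}" "t < \<delta>" using t by (auto simp: m_def)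
    have n: "L2_norm {0<..<l} (\<lambda>x. w (x, t) - w (x, 0)) < \<delta>"
      by (rule d(2)) (use t in \<open>auto simp: m_def dist_real_def\<close>)
    obtain W where W: "W \<in> borel_L2 {0<..<l}" "AE x in lebesgue_on {0<..<l}. w (x, t) = W x"
      using L2_obtain_borel[OF w(1)[of t]] tT by auto
    have "AE x in lebesgue_on {0<..<l}. w (x, t) - w (x, 0) = W x"
      using W(2) w(4) by eventually_elim simp
    from borel_L2_imp_L2(2)[OF W(1) _ this] n
    have Wn: "(LINT x|lborel. (W x)\<^sup>2) \<le> \<delta>\<^sup>2"
      by (simp add: real_less_lsqrt sqrt_le_D less_imp_le)
    note I = integral_primitive_square_le[OF p(1) tT(1)]
    note [measurable] = borel_L2_measurable[OF W(1)] borel_L2_measurable[OF I(1)]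
    have ceq: "AE x in lborel. W x - in_time (primitive T) p (x, t) = c x"
    proof -
      have "AE x in lebesgue_on {0<..<l}. W x - in_time (primitive T) p (x, t) = c x"
        using W(2) t(2) by eventually_elim simp
      then have "AE x in lborel. x \<in> {0<..<l} \<longrightarrow> W x - in_time (primitive T) p (x, t) = c x"
        by (simp add: AE_lebesgue_on_iff)
      then show ?thesis
        by eventually_elim (use borel_L2_outside[OF W(1)] out in \<open>auto simp: c_def indicator_def\<close>)
    qed
    have cL: "c \<in> borel_L2 {0<..<l}"
      by (rule borel_L2_cong_AE[OF borel_L2_diff[OF W(1) I(1)] cm ceq]) (auto simp: c_def)
    have "(LINT x|lborel. (c x)\<^sup>2) \<le> (LINT x|lborel. 2 * (W x)\<^sup>2 + 2 * (in_time (primitive T) p (x, t))\<^sup>2)"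
    proof (rule integral_mono_AE)
      show "AE x in lborel. (c x)\<^sup>2 \<le> 2 * (W x)\<^sup>2 + 2 * (in_time (primitive T) p (x, t))\<^sup>2"
        using ceq
      proof eventually_elim
        case (elim x)
        show ?case unfolding elim[symmetric]
          using square_add_le[of "W x" "- in_time (primitive T) p (x, t)"] by simp
      qed
    qed (use borel_L2_square_integrable[OF cL] borel_L2_square_integrable[OF W(1)] borel_L2_square_integrable[OF I(1)] in auto)
    also have "\<dots> = 2 * (LINT x|lborel. (W x)\<^sup>2) + 2 * (LINT x|lborel. (in_time (primitive T) p (x, t))\<^sup>2)"
      using borel_L2_square_integrable[OF W(1)] borel_L2_square_integrable[OF I(1)] by simp
    also have "\<dots> \<le> 2 * \<delta>\<^sup>2 + 2 * (\<delta> * M)"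
    proof -
      have "t * M \<le> \<delta> * M" using tT(2) M by (intro mult_right_mono) auto
      then show ?thesis using Wn I(2) unfolding M_def by linarith
    qed
    finally show ?thesis using borel_L2_square_integrable[OF cL] by simp
  qed
  have "(LINT x|lborel. (c x)\<^sup>2) = 0"
  proof (rule ccontr)
    assume "(LINT x|lborel. (c x)\<^sup>2) \<noteq> 0"
    moreover have "0 \<le> (LINT x|lborel. (c x)\<^sup>2)" by simp
    ultimately have K: "(LINT x|lborel. (c x)\<^sup>2) > 0" by linarith
    have "((\<lambda>\<delta>. 2 * \<delta>\<^sup>2 + 2 * (\<delta> * M)) \<longlongrightarrow> 2 * 0\<^sup>2 + 2 * (0 * M)) (at_right 0)" by (intro tendsto_intros)
    then have "\<forall>\<^sub>F \<delta> in at_right 0. 2 * \<delta>\<^sup>2 + 2 * (\<delta> * M) < (LINT x|lborel. (c x)\<^sup>2)"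
      using K by (intro order_tendstoD(2)) auto
    moreover have "\<forall>\<^sub>F \<delta> in at_right (0::real). \<delta> > 0" by (rule eventually_at_right_less)
    ultimately have "\<forall>\<^sub>F \<delta> in at_right (0::real). False"
      by eventually_elim (use bound in force)
    then show False by simp
  qed
  then have "AE x in lborel. (c x)\<^sup>2 = 0"
    using bound[of 1] by (subst (asm) integral_nonneg_eq_0_iff_AE) auto
  then have "AE x in lborel. AE t in lborel. c x * indicator {0<..<T} t = 0" by eventually_elim simp
  with eq have "AE x in lborel. AE t in lborel. u' (x, t) = in_time (primitive T) p (x, t)"
  proof eventually_elim
    case (elim x)
    then show ?case by eventually_elim simp
  qed
  then show ?thesis
    using borel_L2_measurable[OF u'(1)] borel_L2_measurable[OF Ip] by (intro AE_plane_eqI(1))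
qed

subsection \<open>Exponential averages in time\<close>

definition exp_kernel :: "real \<Rightarrow> real \<Rightarrow> real \<times> real \<Rightarrow> real" where
  "exp_kernel T \<epsilon> = volterra T (\<lambda>\<tau>. exp (- \<tau> / \<epsilon>) / \<epsilon>)"

abbreviation past_average :: "real \<Rightarrow> real \<Rightarrow> (real \<Rightarrow> real) \<Rightarrow> real \<Rightarrow> real" where
  "past_average T \<epsilon> \<equiv> kernel_op (exp_kernel T \<epsilon>)"

abbreviation future_average :: "real \<Rightarrow> real \<Rightarrow> (real \<Rightarrow> real) \<Rightarrow> real \<Rightarrow> real" where
  "future_average T \<epsilon> \<equiv> kernel_op (transpose_kernel (exp_kernel T \<epsilon>))"

lemma kernel_exp: "\<epsilon> > 0 \<Longrightarrow> kernel_on {0<..<T} (exp_kernel T \<epsilon>)"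
  unfolding exp_kernel_def by (rule volterra_kernel) (auto intro!: continuous_intros)

text \<open>Integration by parts against the exponential; the boundary term at 0 vanishes with the
  test function.\<close>

lemma past_average_deriv:
  assumes \<phi>: "\<phi> \<in> test_functions 0 T" and \<epsilon>: "\<epsilon> > 0"
  shows "past_average T \<epsilon> (deriv \<phi>) s = (\<phi> s - past_average T \<epsilon> \<phi> s) / \<epsilon>"
proof (cases "s \<in> {0<..<T}")
  case True
  have i: "integrable lborel \<phi>" "integrable lborel (deriv \<phi>)"
    using borel_L2_integrable[OF test_functions_borel_L2(1)[OF \<phi>]]
      borel_L2_integrable[OF test_functions_borel_L2(2)[OF \<phi>]] by simp_all
  let ?E = "\<lambda>t. exp (- (s - t) / \<epsilon>) / \<epsilon>"
  have "past_average T \<epsilon> (deriv \<phi>) s + past_average T \<epsilon> \<phi> s / \<epsilon>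
      = (LINT t|lborel. exp_kernel T \<epsilon> (s, t) * deriv \<phi> t + exp_kernel T \<epsilon> (s, t) * \<phi> t / \<epsilon>)"
    using kernel_op_integrable[OF kernel_exp[OF \<epsilon>] i(1), where t=s] kernel_op_integrable[OF kernel_exp[OF \<epsilon>] i(2), where t=s]
    by (simp add: kernel_op_def)
  also have "\<dots> = (LINT t|lborel. indicator {0..s} t *\<^sub>R (?E t * deriv \<phi> t + ?E t * \<phi> t / \<epsilon>))"
  proof (rule Bochner_Integration.integral_cong)
    fix t
    show "exp_kernel T \<epsilon> (s, t) * deriv \<phi> t + exp_kernel T \<epsilon> (s, t) * \<phi> t / \<epsilon>
        = indicator {0..s} t *\<^sub>R (?E t * deriv \<phi> t + ?E t * \<phi> t / \<epsilon>)"
    proof (cases "0 < t \<and> t \<le> s")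
      case t: True
      then have "exp_kernel T \<epsilon> (s, t) = ?E t" using True by (simp add: exp_kernel_def volterra_def diff_divide_distrib)
      with t show ?thesis by simp
    next
      case False
      then have "exp_kernel T \<epsilon> (s, t) = 0" by (auto simp: exp_kernel_def volterra_def)
      with False show ?thesis using test_functions_outside[OF \<phi>, of t] by (auto simp: indicator_def)
    qed
  qed simp
  also have "\<dots> = ?E s * \<phi> s - ?E 0 * \<phi> 0"
  proof (rule integral_FTC_atLeastAtMost)
    fix t
    have "((\<lambda>t. ?E t * \<phi> t) has_real_derivative ?E t * deriv \<phi> t + ?E t * \<phi> t / \<epsilon>) (at t)"
      by (auto intro!: derivative_eq_intros test_functions_differentiable[OF \<phi>] simp: field_simps \<epsilon>[THEN less_imp_neq, symmetric])
    then show "((\<lambda>t. ?E t * \<phi> t) has_vector_derivative ?E t * deriv \<phi> t + ?E t * \<phi> t / \<epsilon>) (at t within {0..s})"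
      by (simp add: has_field_derivative_at_within flip: has_real_derivative_iff_has_vector_derivative)
  qed (use True \<epsilon> in \<open>auto intro!: continuous_intros test_functions_continuous[OF \<phi>]\<close>)
  also have "\<dots> = \<phi> s / \<epsilon>" using test_functions_outside(1)[OF \<phi>, of 0] by simp
  finally show ?thesis by (simp add: diff_divide_distrib)
next
  case False
  then show ?thesis
    using kernel_op_zero[OF kernel_exp[OF \<epsilon>]] test_functions_outside[OF \<phi>] by simp
qed

lemma transpose_transpose_kernel [simp]: "transpose_kernel (transpose_kernel k) = k"
  by (simp add: transpose_kernel_def)

text \<open>The weak form of v' = (v - g) / \<epsilon> for the future average v of \<open>g\<close>.
  Duality moves the average to the test function, where the derivative is classical.\<close>

lemma future_average_mult_deriv:
  assumes \<phi>: "\<phi> \<in> test_functions 0 T" and \<epsilon>: "\<epsilon> > 0" and g: "integrable lborel g"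
  shows "(LINT t|lborel. future_average T \<epsilon> g t * deriv \<phi> t)
    = - (LINT t|lborel. (future_average T \<epsilon> g t - g t) / \<epsilon> * \<phi> t)"
proof -
  note k = kernel_on_transpose[OF kernel_exp[OF \<epsilon>, of T]]
  note \<phi>L = test_functions_borel_L2[OF \<phi>]
  have i: "integrable lborel \<phi>" "integrable lborel (deriv \<phi>)"
    using borel_L2_integrable[OF \<phi>L(1)] borel_L2_integrable[OF \<phi>L(2)] by simp_all
  have fa: "future_average T \<epsilon> g \<in> borel_L2 {0<..<T}" by (rule kernel_op_borel_L2[OF k _ g]) simp
  obtain B where B: "\<And>x. \<bar>\<phi> x\<bar> \<le> B" "\<And>x. \<bar>deriv \<phi> x\<bar> \<le> B"
    using test_functions_bounded[OF \<phi>] by metis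
  have g\<phi>: "integrable lborel (\<lambda>s. g s * \<phi> s)"
    using integrable_bounded_mult[OF g test_functions_continuous(3)[OF \<phi>] B(1)] by (simp add: mult.commute)
  have pa: "past_average T \<epsilon> \<phi> \<in> borel_L2 {0<..<T}" by (rule kernel_op_borel_L2[OF kernel_exp[OF \<epsilon>] _ i(1)]) simp
  obtain K where K: "\<And>p. \<bar>exp_kernel T \<epsilon> p\<bar> \<le> K" using kernel_on_bound[OF kernel_exp[OF \<epsilon>]] by metis
  have gpa: "integrable lborel (\<lambda>s. g s * past_average T \<epsilon> \<phi> s)"
    using integrable_bounded_mult[OF g borel_L2_measurable[OF pa] kernel_op_abs_le[OF kernel_exp[OF \<epsilon>] K i(1)]]
    by (simp add: mult.commute)
  have "(LINT t|lborel. future_average T \<epsilon> g t * deriv \<phi> t) = (LINT s|lborel. g s * past_average T \<epsilon> (deriv \<phi>) s)"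
    using kernel_op_adjoint[OF k g i(2)] by (simp add: mult.commute)
  also have "\<dots> = (LINT s|lborel. (g s * \<phi> s - g s * past_average T \<epsilon> \<phi> s) / \<epsilon>)"
    by (simp add: past_average_deriv[OF \<phi> \<epsilon>] right_diff_distrib)
  also have "\<dots> = ((LINT s|lborel. g s * \<phi> s) - (LINT s|lborel. g s * past_average T \<epsilon> \<phi> s)) / \<epsilon>"
    using g\<phi> gpa by simp
  also have "(LINT s|lborel. g s * past_average T \<epsilon> \<phi> s) = (LINT t|lborel. future_average T \<epsilon> g t * \<phi> t)"
    using kernel_op_adjoint[OF k g i(1)] by (simp add: mult.commute)
  also have "((LINT s|lborel. g s * \<phi> s) - (LINT t|lborel. future_average T \<epsilon> g t * \<phi> t)) / \<epsilon>
      = (LINT t|lborel. (g t * \<phi> t - future_average T \<epsilon> g t * \<phi> t) / \<epsilon>)"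
    using g\<phi> borel_L2_mult_integrable[OF fa \<phi>L(1)] by simp
  also have "\<dots> = (LINT t|lborel. - ((future_average T \<epsilon> g t - g t) / \<epsilon> * \<phi> t))"
    by (rule Bochner_Integration.integral_cong) (auto simp: left_diff_distrib diff_divide_distrib)
  finally show ?thesis by simp
qed

subsection \<open>Admissible test functions\<close>

lemma L2_V2_green:
  assumes \<eta>: "\<eta> \<in> borel_L2 (cylinder l T)" and l: "0 < l"
  shows "L2_V2 l T (in_space (kernel_op (green l)) \<eta>) (in_space (kernel_op (green_deriv l)) \<eta>) \<eta>"
proof -
  have \<eta>': "\<eta> \<in> borel_L2 ({0<..<l} \<times> {0<..<T})" using \<eta> by (simp add: cylinder_def)
  have "in_space (kernel_op (green l)) \<eta> \<in> borel_L2 (cylinder l T)" "in_space (kernel_op (green_deriv l)) \<eta> \<in> borel_L2 (cylinder l T)"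
    unfolding cylinder_def
    by (rule in_space_borel_L2[OF kernel_green _ \<eta>'] in_space_borel_L2[OF kernel_green_deriv _ \<eta>']; simp)+
  moreover have "AE t in lebesgue_on {0<..<T}. V2 l (\<lambda>x. in_space (kernel_op (green l)) \<eta> (x, t))
      (\<lambda>x. in_space (kernel_op (green_deriv l)) \<eta> (x, t)) (\<lambda>x. \<eta> (x, t))"
    unfolding AE_lebesgue_on_iff[OF borel_open[OF open_greaterThanLessThan]]
    using borel_L2_sections(2)[OF \<eta>']
  proof eventually_elim
    case (elim t)
    then show ?case using V2_green[OF _ l] by (simp add: in_space_apply)
  qed
  ultimately show ?thesis
    unfolding L2_V2_def using \<eta> by (auto intro: borel_L2_imp_L2(1)[OF _ cylinder_sets])
qed

text \<open>The derivative is a separate function equal only almost everywhere to the quotient,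
  because it will be given as G applied to something, and linearity of G holds here up to null
  sets.\<close>

lemma has_time_derivative_future_average:
  assumes g: "g \<in> borel_L2 (cylinder l T)" and \<epsilon>: "\<epsilon> > 0" and v\<^sub>t: "v\<^sub>t \<in> borel_L2 (cylinder l T)"
    and eq: "AE q in lborel. v\<^sub>t q = (in_time (future_average T \<epsilon>) g q - g q) / \<epsilon>"
  shows "has_time_derivative l T (in_time (future_average T \<epsilon>) g) v\<^sub>t"
proof -
  note k = kernel_on_transpose[OF kernel_exp[OF \<epsilon>, of T]]
  have g': "g \<in> borel_L2 ({0<..<l} \<times> {0<..<T})" and v\<^sub>t': "v\<^sub>t \<in> borel_L2 ({0<..<l} \<times> {0<..<T})"
    using g v\<^sub>t by (simp_all add: cylinder_def)
  have v: "in_time (future_average T \<epsilon>) g \<in> borel_L2 (cylinder l T)"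
    unfolding cylinder_def by (rule in_time_borel_L2[OF k _ g']) simp
  then have v': "in_time (future_average T \<epsilon>) g \<in> borel_L2 ({0<..<l} \<times> {0<..<T})" by (simp add: cylinder_def)
  have "AE x in lebesgue_on {0<..<l}.
      (LINT t|lebesgue_on {0<..<T}. in_time (future_average T \<epsilon>) g (x, t) * deriv \<theta> t)
        = - (LINT t|lebesgue_on {0<..<T}. v\<^sub>t (x, t) * \<theta> t)" if \<theta>: "\<theta> \<in> test_functions 0 T" for \<theta>
  proof -
    note [measurable] = test_functions_continuous(3,4)[OF \<theta>]
    have "AE x in lborel. (LINT t|lebesgue_on {0<..<T}. in_time (future_average T \<epsilon>) g (x, t) * deriv \<theta> t)
        = - (LINT t|lebesgue_on {0<..<T}. v\<^sub>t (x, t) * \<theta> t)"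
      using AE_plane_sections(1)[OF eq] borel_L2_sections(1)[OF g'] borel_L2_sections(1)[OF v'] borel_L2_sections(1)[OF v\<^sub>t']
    proof eventually_elim
      case (elim x)
      note [measurable] = borel_L2_measurable[OF elim(2)] borel_L2_measurable[OF elim(3)] borel_L2_measurable[OF elim(4)]
      have gi: "integrable lborel (\<lambda>t. g (x, t))" using borel_L2_integrable[OF elim(2)] by simp
      have "(LINT t|lebesgue_on {0<..<T}. in_time (future_average T \<epsilon>) g (x, t) * deriv \<theta> t)
          = (LINT t|lborel. in_time (future_average T \<epsilon>) g (x, t) * deriv \<theta> t)"
        by (rule integral_lebesgue_on_eq(1)) (use test_functions_outside[OF \<theta>] in auto)
      also have "\<dots> = - (LINT t|lborel. (in_time (future_average T \<epsilon>) g (x, t) - g (x, t)) / \<epsilon> * \<theta> t)"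
        unfolding in_time_apply by (rule future_average_mult_deriv[OF \<theta> \<epsilon> gi])
      also have "(LINT t|lborel. (in_time (future_average T \<epsilon>) g (x, t) - g (x, t)) / \<epsilon> * \<theta> t) = (LINT t|lborel. v\<^sub>t (x, t) * \<theta> t)"
        by (rule integral_cong_AE) (use elim(1) in \<open>auto elim: eventually_mono\<close>)
      also have "\<dots> = (LINT t|lebesgue_on {0<..<T}. v\<^sub>t (x, t) * \<theta> t)"
        by (rule integral_lebesgue_on_eq(1)[symmetric]) (use test_functions_outside[OF \<theta>] in auto)
      finally show ?case .
    qed
    then show ?thesis by (auto simp: AE_lebesgue_on_iff elim: eventually_mono)
  qed
  then show ?thesis unfolding has_time_derivative_def
    using v v\<^sub>t by (auto intro: borel_L2_imp_L2(1)[OF _ cylinder_sets])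
qed

text \<open>Continuity in time is inherited from the mean-square continuity of the rows of the
  kernel, and the row at the final time is zero.\<close>

lemma vanishes_at_time_future_average:
  assumes g: "g \<in> borel_L2 (cylinder l T)" and \<epsilon>: "\<epsilon> > 0" and T: "0 < T"
  shows "vanishes_at_time l T (in_time (future_average T \<epsilon>) g) T"
proof -
  have g': "g \<in> borel_L2 ({0<..<l} \<times> {0<..<T})" using g by (simp add: cylinder_def)
  \<comment> \<open>In contrast to \<open>exp_kernel\<close>, which is zero unless both times lie in
    the open interval, this kernel is defined for t at the ends too, as the continuous
    representative requires.\<close>
  define \<kappa> where "\<kappa> t s = (if t \<le> s \<and> 0 < s \<and> s < T then exp (- (s - t) / \<epsilon>) / \<epsilon> else 0)" for t s
  have \<kappa>m [measurable]: "\<kappa> t \<in> borel_measurable borel" for t unfolding \<kappa>_def[abs_def] by measurable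
  have \<kappa>b: "\<bar>\<kappa> t s\<bar> \<le> 1 / \<epsilon>" for t s
    using \<epsilon> by (auto simp: \<kappa>_def intro!: divide_right_mono divide_nonpos_pos)
  have \<kappa>L: "\<kappa> t \<in> borel_L2 {0<..<T}" for t
    by (rule borel_L2_bounded[OF \<kappa>m \<kappa>b]) (auto simp: \<kappa>_def)
  define w where "w = (\<lambda>(x, t). LINT s|lborel. \<kappa> t s * g (x, s))"
  have wL: "(\<lambda>x. w (x, t)) \<in> borel_L2 {0<..<l}" for t
    unfolding w_def split by (rule integral_snd_borel_L2(1)[OF g' \<kappa>L])
  define M where "M = (LINT p|lborel. (g p)\<^sup>2)"
  define Q where "Q t t' = (LINT s|lborel. (\<kappa> t' s - \<kappa> t s)\<^sup>2)" for t t'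
  have diff: "L2_norm {0<..<l} (\<lambda>x. w (x, t') - w (x, t)) \<le> sqrt (Q t t' * M)" for t t'
  proof -
    note d = borel_L2_diff[OF \<kappa>L[of t'] \<kappa>L[of t]]
    have "AE x in lborel. w (x, t') - w (x, t) = (LINT s|lborel. (\<kappa> t' s - \<kappa> t s) * g (x, s))"
      using borel_L2_sections(1)[OF g']
    proof eventually_elim
      case (elim x)
      show ?case unfolding w_def split left_diff_distrib
        using borel_L2_mult_integrable[OF \<kappa>L[of t'] elim] borel_L2_mult_integrable[OF \<kappa>L[of t] elim] by simp
    qed
    then have "AE x in lebesgue_on {0<..<l}. w (x, t') - w (x, t) = (LINT s|lborel. (\<kappa> t' s - \<kappa> t s) * g (x, s))"
      by (auto simp: AE_lebesgue_on_iff elim: eventually_mono)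
    from borel_L2_imp_L2(2)[OF integral_snd_borel_L2(1)[OF g' d] _ this]
    show ?thesis using integral_snd_borel_L2(2)[OF g' d] by (simp add: Q_def M_def)
  qed
  have Qlim: "(Q t \<longlongrightarrow> 0) (at t within {0..T})" for t
    unfolding tendsto_at_iff_sequentially
  proof (intro allI impI)
    fix X :: "nat \<Rightarrow> real" assume X: "X \<longlonglongrightarrow> t"
    have "(\<lambda>n. Q t (X n)) \<longlonglongrightarrow> (LINT s|(lborel :: real measure). 0)"
      unfolding Q_def
    proof (rule integral_dominated_convergence)
      show "integrable lborel (\<lambda>s. (2 / \<epsilon>)\<^sup>2 * indicator {0<..<T} s)"
        using T by (intro integrable_mult_right integrable_real_indicator) auto
      show "AE s in lborel. norm ((\<kappa> (X n) s - \<kappa> t s)\<^sup>2) \<le> (2 / \<epsilon>)\<^sup>2 * indicator {0<..<T} s" for n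
      proof (rule AE_I2)
        fix s
        show "norm ((\<kappa> (X n) s - \<kappa> t s)\<^sup>2) \<le> (2 / \<epsilon>)\<^sup>2 * indicator {0<..<T} s"
        proof (cases "s \<in> {0<..<T}")
          case True
          have "\<bar>\<kappa> (X n) s - \<kappa> t s\<bar> \<le> \<bar>2 / \<epsilon>\<bar>" using \<kappa>b[of "X n" s] \<kappa>b[of t s] \<epsilon> by (simp add: abs_le_iff)
          then show ?thesis unfolding abs_le_square_iff using True by simp
        qed (auto simp: \<kappa>_def)
      qed
      \<comment> \<open>The rows can fail to converge only at the jump s = t, a null set.\<close>
      show "AE s in lborel. (\<lambda>n. (\<kappa> (X n) s - \<kappa> t s)\<^sup>2) \<longlonglongrightarrow> 0"
        using AE_lborel_singleton[of t]
      proof eventually_elim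
        case (elim s)
        have "(\<lambda>n. \<kappa> (X n) s) \<longlonglongrightarrow> \<kappa> t s"
        proof (cases "t < s \<and> 0 < s \<and> s < T")
          case True
          have "(\<lambda>n. exp (- (s - X n) / \<epsilon>) / \<epsilon>) \<longlonglongrightarrow> exp (- (s - t) / \<epsilon>) / \<epsilon>"
            using \<epsilon> by (intro tendsto_intros X) auto
          moreover have "\<forall>\<^sub>F n in sequentially. exp (- (s - X n) / \<epsilon>) / \<epsilon> = \<kappa> (X n) s"
          proof -
            have "\<forall>\<^sub>F n in sequentially. X n < s" using order_tendstoD(2)[OF X] True by blast
            then show ?thesis by eventually_elim (use True in \<open>simp add: \<kappa>_def\<close>)
          qed
          ultimately have "(\<lambda>n. \<kappa> (X n) s) \<longlonglongrightarrow> exp (- (s - t) / \<epsilon>) / \<epsilon>" by (rule Lim_transform_eventually)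
          then show ?thesis using True by (simp add: \<kappa>_def)
        next
          case False
          have "\<forall>\<^sub>F n in sequentially. \<kappa> (X n) s = \<kappa> t s"
          proof (cases "s < t")
            case True
            then have "\<forall>\<^sub>F n in sequentially. s < X n" using order_tendstoD(1)[OF X] by blast
            then show ?thesis by eventually_elim (use True in \<open>simp add: \<kappa>_def\<close>)
          qed (use False elim in \<open>auto simp: \<kappa>_def\<close>)
          then show ?thesis by (rule tendsto_eventually)
        qed
        then have "(\<lambda>n. (\<kappa> (X n) s - \<kappa> t s)\<^sup>2) \<longlonglongrightarrow> (\<kappa> t s - \<kappa> t s)\<^sup>2" by (intro tendsto_intros)
        then show ?case by simp
      qed
    qed auto
    then show "(Q t \<circ> X) \<longlonglongrightarrow> 0" by (simp add: o_def)
  qed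
  show ?thesis unfolding vanishes_at_time_def
  proof (intro exI[of _ w] conjI ballI)
    fix t assume t: "t \<in> {0..T}"
    show "L2 {0<..<l} (\<lambda>x. w (x, t))" by (rule borel_L2_imp_L2(1)[OF wL]) auto
    show "((\<lambda>t'. L2_norm {0<..<l} (\<lambda>x. w (x, t') - w (x, t))) \<longlongrightarrow> 0) (at t within {0..T})"
    proof (rule Lim_null_comparison)
      have "((\<lambda>t'. sqrt (Q t t' * M)) \<longlongrightarrow> sqrt (0 * M)) (at t within {0..T})" by (intro tendsto_intros Qlim)
      then show "((\<lambda>t'. sqrt (Q t t' * M)) \<longlongrightarrow> 0) (at t within {0..T})" by simp
      show "\<forall>\<^sub>F t' in at t within {0..T}. norm (L2_norm {0<..<l} (\<lambda>x. w (x, t') - w (x, t))) \<le> sqrt (Q t t' * M)"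
        by (intro always_eventually allI) (use diff in \<open>simp add: L2_norm_def\<close>)
    qed
  next
    have "w (x, t) = in_time (future_average T \<epsilon>) g (x, t)" if "t \<in> {0<..<T}" for x t
      unfolding w_def in_time_apply kernel_op_def split
      by (rule Bochner_Integration.integral_cong)
         (use that in \<open>auto simp: \<kappa>_def transpose_kernel_def exp_kernel_def volterra_def diff_divide_distrib\<close>)
    then show "AE t in lebesgue_on {0<..<T}. AE x in lebesgue_on {0<..<l}. w (x, t) = in_time (future_average T \<epsilon>) g (x, t)"
      by (auto simp: AE_lebesgue_on_iff)
  next
    have "\<kappa> T s = 0" for s by (simp add: \<kappa>_def)
    then have "w (x, T) = 0" for x by (simp add: w_def)
    then show "AE x in lebesgue_on {0<..<l}. w (x, T) = 0" by simp
  qed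
qed

subsection \<open>The variational equation averaged in time\<close>

abbreviation smoothed where "smoothed T \<epsilon> \<equiv> in_time (past_average T \<epsilon>)"

text \<open>The time derivative w' of w = R f, read off from \<epsilon> w' + w = f. Defined
  algebraically, it is square integrable for every square-integrable f.\<close>

definition smoothed_rate :: "real \<Rightarrow> real \<Rightarrow> (real \<times> real \<Rightarrow> real) \<Rightarrow> real \<times> real \<Rightarrow> real" where
  "smoothed_rate T \<epsilon> f = (\<lambda>q. (f q - smoothed T \<epsilon> f q) / \<epsilon>)"

abbreviation green_op where "green_op l \<equiv> in_space (kernel_op (green l))"
abbreviation green_deriv_op where "green_deriv_op l \<equiv> in_space (kernel_op (green_deriv l))"

text \<open>The variational equation for the test function \<open>G R\<^sup>* \<eta>\<close>, with all averages moved to the solution;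
  \<open>p\<close> and \<open>h\<close> are \<open>u\<^sub>t\<close> and \<open>u\<^sub>x\<^sub>x\<close>.\<close>

definition averaged_equation ::
  "real \<Rightarrow> real \<Rightarrow> real \<Rightarrow> (real \<Rightarrow> real) \<Rightarrow> (real \<Rightarrow> real) \<Rightarrow> (real \<Rightarrow> real) \<Rightarrow> (real \<Rightarrow> real) \<Rightarrow> (real \<Rightarrow> real)
    \<Rightarrow> (real \<times> real \<Rightarrow> real) \<Rightarrow> (real \<times> real \<Rightarrow> real) \<Rightarrow> (real \<times> real \<Rightarrow> real) \<Rightarrow> bool" where
  "averaged_equation l T \<epsilon> \<rho> \<mu> \<tau> r \<kappa> p h F \<longleftrightarrow> (\<forall>\<eta>\<in>borel_L2 (cylinder l T).
    (LINT q|lborel. \<rho> (fst q) * smoothed_rate T \<epsilon> p q * green_op l \<eta> q)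
    + (LINT q|lborel. \<mu> (fst q) * smoothed T \<epsilon> p q * green_op l \<eta> q)
    + (LINT q|lborel. \<tau> (fst q) * smoothed T \<epsilon> (green_deriv_op l h) q * green_deriv_op l \<eta> q)
    + (LINT q|lborel. r (fst q) * smoothed T \<epsilon> h q * \<eta> q)
    + (LINT q|lborel. \<kappa> (fst q) * smoothed_rate T \<epsilon> h q * \<eta> q)
    = (LINT q|lborel. smoothed T \<epsilon> F q * green_op l \<eta> q))"

lemma smoothed_L2: "f \<in> borel_L2 (cylinder l T) \<Longrightarrow> \<epsilon> > 0 \<Longrightarrow> smoothed T \<epsilon> f \<in> borel_L2 (cylinder l T)"
  unfolding cylinder_def by (rule in_time_borel_L2[OF kernel_exp]) auto

lemma smoothed_adjoint_L2:
  "f \<in> borel_L2 (cylinder l T) \<Longrightarrow> \<epsilon> > 0 \<Longrightarrow> in_time (future_average T \<epsilon>) f \<in> borel_L2 (cylinder l T)"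
  unfolding cylinder_def by (rule in_time_borel_L2[OF kernel_on_transpose[OF kernel_exp]]) auto

lemma green_op_L2: "f \<in> borel_L2 (cylinder l T) \<Longrightarrow> green_op l f \<in> borel_L2 (cylinder l T)"
  unfolding cylinder_def by (rule in_space_borel_L2[OF kernel_green]) auto

lemma green_deriv_op_L2: "f \<in> borel_L2 (cylinder l T) \<Longrightarrow> green_deriv_op l f \<in> borel_L2 (cylinder l T)"
  unfolding cylinder_def by (rule in_space_borel_L2[OF kernel_green_deriv]) auto

lemma smoothed_rate_L2: "f \<in> borel_L2 (cylinder l T) \<Longrightarrow> \<epsilon> > 0 \<Longrightarrow> smoothed_rate T \<epsilon> f \<in> borel_L2 (cylinder l T)"
  unfolding smoothed_rate_def divide_inverse
  using borel_L2_scale[OF borel_L2_diff[OF _ smoothed_L2], of f l T f \<epsilon> "inverse \<epsilon>"] by (simp add: mult.commute)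

lemma borel_measurable_fst_comp:
  fixes c :: "real \<Rightarrow> real"
  assumes [measurable]: "c \<in> borel_measurable borel"
  shows "(\<lambda>q. c (fst q)) \<in> borel_measurable (borel :: (real \<times> real) measure)"
proof -
  have "(\<lambda>q. c (fst q)) \<in> borel_measurable (borel \<Otimes>\<^sub>M (borel :: real measure))" by measurable
  then show ?thesis unfolding borel_prod .
qed

lemma coefficient_mult_L2:
  assumes "c \<in> borel_measurable borel" "\<And>x. \<bar>c x\<bar> \<le> B" "f \<in> borel_L2 S"
  shows "(\<lambda>q. c (fst q) * f q) \<in> borel_L2 (S :: (real \<times> real) set)"
  by (rule borel_L2_bounded_mult[OF assms(3) borel_measurable_fst_comp[OF assms(1)] assms(2)])

section \<open>Moving the averages from the test function to the solution\<close>

text \<open>The coefficients depend on x only and therefore commute with averages in time.\<close>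

lemma smoothed_adjoint:
  assumes c: "c \<in> borel_measurable borel" "\<And>x. \<bar>c x\<bar> \<le> B" and \<epsilon>: "\<epsilon> > 0"
    and f: "f \<in> borel_L2 (cylinder l T)" and g: "g \<in> borel_L2 (cylinder l T)"
  shows "(LINT q|lborel. c (fst q) * f q * in_time (future_average T \<epsilon>) g q)
    = (LINT q|lborel. c (fst q) * smoothed T \<epsilon> f q * g q)"
proof -
  have cf: "(\<lambda>q. c (fst q) * f q) \<in> borel_L2 ({0<..<l} \<times> {0<..<T})"
    using coefficient_mult_L2[OF c f] by (simp add: cylinder_def)
  have g': "g \<in> borel_L2 ({0<..<l} \<times> {0<..<T})" using g by (simp add: cylinder_def)
  have "smoothed T \<epsilon> (\<lambda>q. c (fst q) * f q) q = c (fst q) * smoothed T \<epsilon> f q" for q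
    by (simp add: in_time_def kernel_op_scale)
  then show ?thesis using in_time_adjoint[OF kernel_exp[OF \<epsilon>] _ cf g'] by (simp add: mult_ac)
qed

text \<open>The adjoint of a time derivative carries a minus sign; it will cancel the minus signs of
  the weak formulation.\<close>

lemma smoothed_rate_adjoint:
  assumes c: "c \<in> borel_measurable borel" "\<And>x. \<bar>c x\<bar> \<le> B" and \<epsilon>: "\<epsilon> > 0"
    and f: "f \<in> borel_L2 (cylinder l T)" and g: "g \<in> borel_L2 (cylinder l T)"
  shows "(LINT q|lborel. c (fst q) * f q * ((in_time (future_average T \<epsilon>) g q - g q) / \<epsilon>))
    = - (LINT q|lborel. c (fst q) * smoothed_rate T \<epsilon> f q * g q)"
proof -
  note i1 = borel_L2_mult_integrable[OF coefficient_mult_L2[OF c f] smoothed_adjoint_L2[OF g \<epsilon>]]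
  note i2 = borel_L2_mult_integrable[OF coefficient_mult_L2[OF c f] g]
  note i3 = borel_L2_mult_integrable[OF coefficient_mult_L2[OF c smoothed_L2[OF f \<epsilon>]] g]
  have "(LINT q|lborel. c (fst q) * f q * ((in_time (future_average T \<epsilon>) g q - g q) / \<epsilon>))
      = (LINT q|lborel. (c (fst q) * f q * in_time (future_average T \<epsilon>) g q - c (fst q) * f q * g q) / \<epsilon>)"
    by (simp add: right_diff_distrib)
  also have "\<dots> = ((LINT q|lborel. c (fst q) * smoothed T \<epsilon> f q * g q) - (LINT q|lborel. c (fst q) * f q * g q)) / \<epsilon>"
    using i1 i2 smoothed_adjoint[OF c \<epsilon> f g] by simp
  also have "\<dots> = (LINT q|lborel. (c (fst q) * smoothed T \<epsilon> f q * g q - c (fst q) * f q * g q) / \<epsilon>)"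
    using i2 i3 by simp
  also have "\<dots> = (LINT q|lborel. - (c (fst q) * smoothed_rate T \<epsilon> f q * g q))"
    by (rule Bochner_Integration.integral_cong) (auto simp: smoothed_rate_def left_diff_distrib right_diff_distrib diff_divide_distrib)
  finally show ?thesis by simp
qed

lemma AE_lebesgue_on_fst:
  assumes ae: "AE x in lebesgue_on {0<..<l}. P x"
  shows "AE q in lebesgue_on (cylinder l T). P (fst q)"
proof -
  have "AE x in lborel. x \<in> {0<..<l} \<longrightarrow> P x" using ae by (simp add: AE_lebesgue_on_iff)
  then obtain N where N: "N \<in> null_sets lborel" "{x. \<not> (x \<in> {0<..<l} \<longrightarrow> P x)} \<subseteq> N" by (elim AE_E3) auto
  have "AE q in lborel \<Otimes>\<^sub>M lborel. fst q \<notin> N"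
  proof (rule lborel_pair.AE_pair_measure)
    have [measurable]: "N \<in> sets borel" using N(1) by auto
    show "{q \<in> space (lborel \<Otimes>\<^sub>M lborel). fst q \<notin> N} \<in> sets (lborel \<Otimes>\<^sub>M lborel)" by measurable
    show "AE x in lborel. AE y in lborel. fst (x, y) \<notin> N" using AE_not_in[OF N(1)] by eventually_elim simp
  qed
  then have "AE q in lborel. fst (q :: real \<times> real) \<notin> N" unfolding lborel_prod .
  then show ?thesis unfolding AE_lebesgue_on_iff[OF cylinder_sets]
    by eventually_elim (use N(2) in \<open>auto simp: cylinder_def\<close>)
qed

text \<open>Linearity requires integrable sections, available for almost every t, hence the
  exceptional set. The case \<open>\<epsilon> = 1\<close> serves as plain additivity.\<close>

lemma in_space_diff_AE:
  assumes k: "kernel_on {0<..<l} k" and f: "f \<in> borel_L2 (cylinder l T)" and g: "g \<in> borel_L2 (cylinder l T)"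
  shows "AE q in lborel. in_space (kernel_op k) (\<lambda>q. (f q - g q) / \<epsilon>) q = (in_space (kernel_op k) f q - in_space (kernel_op k) g q) / \<epsilon>"
proof (rule AE_plane_eqI(2))
  have f': "f \<in> borel_L2 ({0<..<l} \<times> {0<..<T})" and g': "g \<in> borel_L2 ({0<..<l} \<times> {0<..<T})"
    using f g by (simp_all add: cylinder_def)
  note km = kernel_on_measurable[OF k]
  note [measurable] = borel_L2_measurable[OF f] borel_L2_measurable[OF g]
    in_space_kernel_op_measurable[OF km borel_L2_measurable[OF f]] in_space_kernel_op_measurable[OF km borel_L2_measurable[OF g]]
  show "in_space (kernel_op k) (\<lambda>q. (f q - g q) / \<epsilon>) \<in> borel_measurable borel"
    by (rule in_space_kernel_op_measurable[OF km]) simp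
  show "(\<lambda>q. (in_space (kernel_op k) f q - in_space (kernel_op k) g q) / \<epsilon>) \<in> borel_measurable borel" by simp
  show "AE t in lborel. AE x in lborel. in_space (kernel_op k) (\<lambda>q. (f q - g q) / \<epsilon>) (x, t)
      = (in_space (kernel_op k) f (x, t) - in_space (kernel_op k) g (x, t)) / \<epsilon>"
    using borel_L2_sections(2)[OF f'] borel_L2_sections(2)[OF g']
  proof eventually_elim
    case (elim t)
    have "integrable lborel (\<lambda>x. f (x, t))" "integrable lborel (\<lambda>x. g (x, t))"
      using borel_L2_integrable[OF elim(1)] borel_L2_integrable[OF elim(2)] by simp_all
    from kernel_op_linear(2)[OF k this]
    have "kernel_op k (\<lambda>y. (f (y, t) - g (y, t)) / \<epsilon>) x = (kernel_op k (\<lambda>y. f (y, t)) x - kernel_op k (\<lambda>y. g (y, t)) x) / \<epsilon>" for x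
      using kernel_op_scale[of k "inverse \<epsilon>" "\<lambda>y. f (y, t) - g (y, t)" x] by (simp add: divide_inverse mult.commute)
    then show ?case by (simp add: in_space_apply)
  qed
qed

lemma weak_solution_imp_averaged_equation:
  assumes eq: "\<And>v v\<^sub>x v\<^sub>x\<^sub>x v\<^sub>t v\<^sub>x\<^sub>t v\<^sub>x\<^sub>x\<^sub>t.
        L2_V2 l T v v\<^sub>x v\<^sub>x\<^sub>x \<and> has_time_derivative l T v v\<^sub>t \<and> L2_V2 l T v\<^sub>t v\<^sub>x\<^sub>t v\<^sub>x\<^sub>x\<^sub>t \<and>
        vanishes_at_time l T v T \<longrightarrow>
        (LINT (x, t)|lebesgue_on (cylinder l T).
            - \<rho>\<^sub>A x * u\<^sub>t (x, t) * v\<^sub>t (x, t) + \<mu> x * u\<^sub>t (x, t) * v (x, t)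
            + T\<^sub>r x * u\<^sub>x (x, t) * v\<^sub>x (x, t) + r x * u\<^sub>x\<^sub>x (x, t) * v\<^sub>x\<^sub>x (x, t)
            - \<kappa> x * u\<^sub>x\<^sub>x (x, t) * v\<^sub>x\<^sub>x\<^sub>t (x, t))
        = (LINT (x, t)|lebesgue_on (cylinder l T). F (x, t) * v (x, t))"
    and l: "0 < l" and T: "0 < T" and \<epsilon>: "0 < \<epsilon>"
    and p: "p \<in> borel_L2 (cylinder l T)" "AE q in lebesgue_on (cylinder l T). u\<^sub>t q = p q"
    and h: "h \<in> borel_L2 (cylinder l T)" "AE q in lebesgue_on (cylinder l T). u\<^sub>x\<^sub>x q = h q"
    and ux: "AE q in lebesgue_on (cylinder l T). u\<^sub>x q = green_deriv_op l h q"
    and F': "F' \<in> borel_L2 (cylinder l T)" "AE q in lebesgue_on (cylinder l T). F q = F' q"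
    and rho: "\<rho>' \<in> borel_measurable borel" "\<And>x. \<bar>\<rho>' x\<bar> \<le> B1" "AE x in lebesgue_on {0<..<l}. \<rho>\<^sub>A x = \<rho>' x"
    and mu: "\<mu>' \<in> borel_measurable borel" "\<And>x. \<bar>\<mu>' x\<bar> \<le> B2" "AE x in lebesgue_on {0<..<l}. \<mu> x = \<mu>' x"
    and tau: "\<tau>' \<in> borel_measurable borel" "\<And>x. \<bar>\<tau>' x\<bar> \<le> B3" "AE x in lebesgue_on {0<..<l}. T\<^sub>r x = \<tau>' x"
    and rr: "r' \<in> borel_measurable borel" "\<And>x. \<bar>r' x\<bar> \<le> B4" "AE x in lebesgue_on {0<..<l}. r x = r' x"
    and kap: "\<kappa>' \<in> borel_measurable borel" "\<And>x. \<bar>\<kappa>' x\<bar> \<le> B5" "AE x in lebesgue_on {0<..<l}. \<kappa> x = \<kappa>' x"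
  shows "averaged_equation l T \<epsilon> \<rho>' \<mu>' \<tau>' r' \<kappa>' p h F'"
  unfolding averaged_equation_def
proof
  fix \<eta> assume \<eta>: "\<eta> \<in> borel_L2 (cylinder l T)"
  let ?A = "in_time (future_average T \<epsilon>)"
  have \<eta>i: "integrable lborel \<eta>" by (rule borel_L2_integrable[OF \<eta> bounded_cylinder])
  define g where "g = green_op l \<eta>"
  define g' where "g' = green_deriv_op l \<eta>"
  have g: "g \<in> borel_L2 (cylinder l T)" unfolding g_def by (rule green_op_L2[OF \<eta>])
  have g': "g' \<in> borel_L2 (cylinder l T)" unfolding g'_def by (rule green_deriv_op_L2[OF \<eta>])
  note A\<eta> = smoothed_adjoint_L2[OF \<eta> \<epsilon>] and Ag = smoothed_adjoint_L2[OF g \<epsilon>] and Ag' = smoothed_adjoint_L2[OF g' \<epsilon>]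
  note k = kernel_on_transpose[OF kernel_exp[OF \<epsilon>, of T]]
  \<comment> \<open>The test function has two readings. As G of an average of \<open>\<eta>\<close>
    it satisfies the boundary conditions with known x-derivatives; as an average of G
    \<open>\<eta>\<close> it has a time derivative and vanishes at T.\<close>
  have com: "green_op l (?A \<eta>) = ?A g" "green_deriv_op l (?A \<eta>) = ?A g'"
    unfolding g_def g'_def
    by (rule in_time_in_space_commute[symmetric, OF k kernel_green \<eta>i] 
        in_time_in_space_commute[symmetric, OF k kernel_green_deriv \<eta>i]; simp)+
  \<comment> \<open>The second x-derivative of the time derivative of the test function, so that
    this time derivative is G \<open>\<zeta>\<close>.\<close>
  define \<zeta> where "\<zeta> q = (?A \<eta> q - \<eta> q) / \<epsilon>" for q
  have \<zeta>: "\<zeta> \<in> borel_L2 (cylinder l T)"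
    using borel_L2_scale[OF borel_L2_diff[OF A\<eta> \<eta>], of "inverse \<epsilon>"]
    by (simp add: \<zeta>_def[abs_def] divide_inverse mult.commute)
  have G\<zeta>: "green_op l \<zeta> \<in> borel_L2 (cylinder l T)" by (rule green_op_L2[OF \<zeta>])
  have ae\<zeta>: "AE q in lborel. green_op l \<zeta> q = (?A g q - g q) / \<epsilon>"
    using in_space_diff_AE[OF kernel_green A\<eta> \<eta>, of \<epsilon>] by (simp add: \<zeta>_def[abs_def] com g_def)
  have V: "L2_V2 l T (?A g) (?A g') (?A \<eta>)" using L2_V2_green[OF A\<eta> l] by (simp add: com)
  have Vt: "L2_V2 l T (green_op l \<zeta>) (green_deriv_op l \<zeta>) \<zeta>" by (rule L2_V2_green[OF \<zeta> l])
  have td: "has_time_derivative l T (?A g) (green_op l \<zeta>)"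
    by (rule has_time_derivative_future_average[OF g \<epsilon> G\<zeta> ae\<zeta>])
  have va: "vanishes_at_time l T (?A g) T" by (rule vanishes_at_time_future_average[OF g \<epsilon> T])
  note weak = eq[rule_format, OF conjI[OF V conjI[OF td conjI[OF Vt va]]]]
  note cyl = AE_lebesgue_on_iff[OF cylinder_sets]
  note m = borel_measurable_fst_comp[OF rho(1)] borel_measurable_fst_comp[OF mu(1)] borel_measurable_fst_comp[OF tau(1)]
    borel_measurable_fst_comp[OF rr(1)] borel_measurable_fst_comp[OF kap(1)]
    borel_L2_measurable[OF p(1)] borel_L2_measurable[OF h(1)] borel_L2_measurable[OF green_deriv_op_L2[OF h(1)]]
    borel_L2_measurable[OF F'(1)] borel_L2_measurable[OF A\<eta>] borel_L2_measurable[OF Ag] borel_L2_measurable[OF Ag']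
    borel_L2_measurable[OF \<eta>] borel_L2_measurable[OF g]
  define E where "E q = - (\<rho>' (fst q) * p q * ((?A g q - g q) / \<epsilon>)) + \<mu>' (fst q) * p q * ?A g q
    + \<tau>' (fst q) * green_deriv_op l h q * ?A g' q + r' (fst q) * h q * ?A \<eta> q - \<kappa>' (fst q) * h q * ((?A \<eta> q - \<eta> q) / \<epsilon>)" for q
  have ae\<zeta>c: "AE q in lebesgue_on (cylinder l T). green_op l \<zeta> q = (?A g q - g q) / \<epsilon>"
    unfolding cyl using ae\<zeta> by eventually_elim simp
  have out: "p q = 0" "h q = 0" "green_deriv_op l h q = 0" "F' q = 0" if "q \<notin> cylinder l T" for q
    using borel_L2_outside[OF p(1) that] borel_L2_outside[OF h(1) that]
      borel_L2_outside[OF green_deriv_op_L2[OF h(1)] that] borel_L2_outside[OF F'(1) that] by auto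
  have lhs: "(LINT (x, t)|lebesgue_on (cylinder l T).
            - \<rho>\<^sub>A x * u\<^sub>t (x, t) * green_op l \<zeta> (x, t) + \<mu> x * u\<^sub>t (x, t) * ?A g (x, t)
            + T\<^sub>r x * u\<^sub>x (x, t) * ?A g' (x, t) + r x * u\<^sub>x\<^sub>x (x, t) * ?A \<eta> (x, t)
            - \<kappa> x * u\<^sub>x\<^sub>x (x, t) * \<zeta> (x, t)) = (LINT q|lborel. E q)"
  proof (rule integral_lebesgue_on_eq(1))
    show "E \<in> borel_measurable borel" unfolding E_def[abs_def] using m by simp
    show "E q = 0" if "q \<notin> cylinder l T" for q by (simp add: E_def out[OF that])
    show "AE q in lebesgue_on (cylinder l T). (case q of (x, t) \<Rightarrow>
            - \<rho>\<^sub>A x * u\<^sub>t (x, t) * green_op l \<zeta> (x, t) + \<mu> x * u\<^sub>t (x, t) * ?A g (x, t)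
            + T\<^sub>r x * u\<^sub>x (x, t) * ?A g' (x, t) + r x * u\<^sub>x\<^sub>x (x, t) * ?A \<eta> (x, t)
            - \<kappa> x * u\<^sub>x\<^sub>x (x, t) * \<zeta> (x, t)) = E q"
      using p(2) h(2) ux ae\<zeta>c AE_lebesgue_on_fst[OF rho(3)] AE_lebesgue_on_fst[OF mu(3)]
        AE_lebesgue_on_fst[OF tau(3)] AE_lebesgue_on_fst[OF rr(3)] AE_lebesgue_on_fst[OF kap(3)]
    proof eventually_elim
      case (elim q)
      then show ?case by (cases q) (simp add: E_def \<zeta>_def)
    qed
  qed simp
  have rhs: "(LINT (x, t)|lebesgue_on (cylinder l T). F (x, t) * ?A g (x, t)) = (LINT q|lborel. F' q * ?A g q)"
  proof (rule integral_lebesgue_on_eq(1))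
    show "(\<lambda>q. F' q * ?A g q) \<in> borel_measurable borel" using m by simp
    show "AE q in lebesgue_on (cylinder l T). (case q of (x, t) \<Rightarrow> F (x, t) * ?A g (x, t)) = F' q * ?A g q"
      using F'(2) by eventually_elim (auto split: prod.split)
  qed (use out in auto)
  have gd: "(\<lambda>q. (?A g q - g q) / \<epsilon>) \<in> borel_L2 (cylinder l T)"
    using borel_L2_scale[OF borel_L2_diff[OF Ag g], of "inverse \<epsilon>"] by (simp add: divide_inverse mult.commute)
  have \<zeta>': "(\<lambda>q. (?A \<eta> q - \<eta> q) / \<epsilon>) \<in> borel_L2 (cylinder l T)" using \<zeta> by (simp add: \<zeta>_def[abs_def])
  note c1 = coefficient_mult_L2[OF rho(1,2) p(1)] and c2 = coefficient_mult_L2[OF mu(1,2) p(1)]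
    and c3 = coefficient_mult_L2[OF tau(1,2) green_deriv_op_L2[OF h(1)]]
    and c4 = coefficient_mult_L2[OF rr(1,2) h(1)] and c5 = coefficient_mult_L2[OF kap(1,2) h(1)]
  have "(LINT q|lborel. E q) = - (LINT q|lborel. \<rho>' (fst q) * p q * ((?A g q - g q) / \<epsilon>))
      + (LINT q|lborel. \<mu>' (fst q) * p q * ?A g q)
      + (LINT q|lborel. \<tau>' (fst q) * green_deriv_op l h q * ?A g' q)
      + (LINT q|lborel. r' (fst q) * h q * ?A \<eta> q)
      - (LINT q|lborel. \<kappa>' (fst q) * h q * ((?A \<eta> q - \<eta> q) / \<epsilon>))"
    unfolding E_def
    using borel_L2_mult_integrable[OF c1 gd] borel_L2_mult_integrable[OF c2 Ag] borel_L2_mult_integrable[OF c3 Ag']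
      borel_L2_mult_integrable[OF c4 A\<eta>] borel_L2_mult_integrable[OF c5 \<zeta>']
    by (simp only: Bochner_Integration.integral_add Bochner_Integration.integral_diff Bochner_Integration.integral_minus
        Bochner_Integration.integrable_add Bochner_Integration.integrable_diff Bochner_Integration.integrable_minus)
  \<comment> \<open>Every average passes to the solution. The signs of the inertia and damping terms
    turn positive because the adjoint rate contributes a second minus.\<close>
  also have "\<dots> = (LINT q|lborel. \<rho>' (fst q) * smoothed_rate T \<epsilon> p q * g q)
    + (LINT q|lborel. \<mu>' (fst q) * smoothed T \<epsilon> p q * g q)
    + (LINT q|lborel. \<tau>' (fst q) * smoothed T \<epsilon> (green_deriv_op l h) q * g' q)
    + (LINT q|lborel. r' (fst q) * smoothed T \<epsilon> h q * \<eta> q)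
    + (LINT q|lborel. \<kappa>' (fst q) * smoothed_rate T \<epsilon> h q * \<eta> q)"
    unfolding smoothed_rate_adjoint[OF rho(1,2) \<epsilon> p(1) g] smoothed_adjoint[OF mu(1,2) \<epsilon> p(1) g]
      smoothed_adjoint[OF tau(1,2) \<epsilon> green_deriv_op_L2[OF h(1)] g'] smoothed_adjoint[OF rr(1,2) \<epsilon> h(1) \<eta>]
      smoothed_rate_adjoint[OF kap(1,2) \<epsilon> h(1) \<eta>] by simp
  finally have L: "(LINT q|lborel. E q) = \<dots>" .
  have "(LINT q|lborel. F' q * ?A g q) = (LINT q|lborel. smoothed T \<epsilon> F' q * g q)"
    using smoothed_adjoint[of "\<lambda>_. 1" 1, OF _ _ \<epsilon> F'(1) g] by simp
  with L weak show "(LINT q|lborel. \<rho>' (fst q) * smoothed_rate T \<epsilon> p q * green_op l \<eta> q)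
    + (LINT q|lborel. \<mu>' (fst q) * smoothed T \<epsilon> p q * green_op l \<eta> q)
    + (LINT q|lborel. \<tau>' (fst q) * smoothed T \<epsilon> (green_deriv_op l h) q * green_deriv_op l \<eta> q)
    + (LINT q|lborel. r' (fst q) * smoothed T \<epsilon> h q * \<eta> q)
    + (LINT q|lborel. \<kappa>' (fst q) * smoothed_rate T \<epsilon> h q * \<eta> q)
    = (LINT q|lborel. smoothed T \<epsilon> F' q * green_op l \<eta> q)"
    unfolding lhs rhs g_def[symmetric] g'_def[symmetric] by simp
qed

subsection \<open>The energy inequality\<close>

text \<open>In operator form I R = R I = I - \<epsilon> R for the primitive I, the integrated
  version of \<epsilon> w' + w = f with w(0) = 0.\<close>

lemma integral_exp_kernel_primitive:
  assumes \<epsilon>: "\<epsilon> > 0"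
  shows "(LINT s|lborel. volterra T (\<lambda>_. 1) (t, s) * exp_kernel T \<epsilon> (s, r))
      = volterra T (\<lambda>_. 1) (t, r) - \<epsilon> * exp_kernel T \<epsilon> (t, r)" (is ?A)
    and "(LINT s|lborel. exp_kernel T \<epsilon> (t, s) * volterra T (\<lambda>_. 1) (s, r))
      = volterra T (\<lambda>_. 1) (t, r) - \<epsilon> * exp_kernel T \<epsilon> (t, r)" (is ?B)
proof -
  have "?A \<and> ?B"
  proof (cases "0 < r \<and> r \<le> t \<and> t < T")
    case True
    have "(LINT s|lborel. volterra T (\<lambda>_. 1) (t, s) * exp_kernel T \<epsilon> (s, r))
        = (LINT s|lborel. indicator {r..t} s *\<^sub>R (exp (- (s - r) / \<epsilon>) / \<epsilon>))"
      by (rule Bochner_Integration.integral_cong)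
         (use True in \<open>auto simp: volterra_def exp_kernel_def indicator_def diff_divide_distrib\<close>)
    also have "\<dots> = - exp (- (t - r) / \<epsilon>) - - exp (- (r - r) / \<epsilon>)"
    proof (rule integral_FTC_atLeastAtMost)
      fix s
      have "((\<lambda>s. - exp (- (s - r) / \<epsilon>)) has_real_derivative exp (- (s - r) / \<epsilon>) / \<epsilon>) (at s)"
        using \<epsilon> by (auto intro!: derivative_eq_intros)
      then show "((\<lambda>s. - exp (- (s - r) / \<epsilon>)) has_vector_derivative exp (- (s - r) / \<epsilon>) / \<epsilon>) (at s within {r..t})"
        by (simp add: has_field_derivative_at_within flip: has_real_derivative_iff_has_vector_derivative)
    qed (use True \<epsilon> in \<open>auto intro!: continuous_intros\<close>)
    finally have A: "(LINT s|lborel. volterra T (\<lambda>_. 1) (t, s) * exp_kernel T \<epsilon> (s, r)) = 1 - exp (- (t - r) / \<epsilon>)" by simp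
    have "(LINT s|lborel. exp_kernel T \<epsilon> (t, s) * volterra T (\<lambda>_. 1) (s, r))
        = (LINT s|lborel. indicator {r..t} s *\<^sub>R (exp (- (t - s) / \<epsilon>) / \<epsilon>))"
      by (rule Bochner_Integration.integral_cong)
         (use True in \<open>auto simp: volterra_def exp_kernel_def indicator_def diff_divide_distrib\<close>)
    also have "\<dots> = exp (- (t - t) / \<epsilon>) - exp (- (t - r) / \<epsilon>)"
    proof (rule integral_FTC_atLeastAtMost)
      fix s
      have "((\<lambda>s. exp (- (t - s) / \<epsilon>)) has_real_derivative exp (- (t - s) / \<epsilon>) / \<epsilon>) (at s)"
        using \<epsilon> by (auto intro!: derivative_eq_intros)
      then show "((\<lambda>s. exp (- (t - s) / \<epsilon>)) has_vector_derivative exp (- (t - s) / \<epsilon>) / \<epsilon>) (at s within {r..t})"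
        by (simp add: has_field_derivative_at_within flip: has_real_derivative_iff_has_vector_derivative)
    qed (use True \<epsilon> in \<open>auto intro!: continuous_intros\<close>)
    finally have B: "(LINT s|lborel. exp_kernel T \<epsilon> (t, s) * volterra T (\<lambda>_. 1) (s, r)) = 1 - exp (- (t - r) / \<epsilon>)" by simp
    show ?thesis unfolding A B using True \<epsilon> by (simp add: volterra_def exp_kernel_def diff_divide_distrib)
  next
    case False
    then have "\<And>s. volterra T (\<lambda>_. 1) (t, s) * exp_kernel T \<epsilon> (s, r) = 0"
      "\<And>s. exp_kernel T \<epsilon> (t, s) * volterra T (\<lambda>_. 1) (s, r) = 0"
      by (auto simp: volterra_def exp_kernel_def)
    moreover have "volterra T (\<lambda>_. 1) (t, r) = 0" "exp_kernel T \<epsilon> (t, r) = 0"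
      using False by (auto simp: volterra_def exp_kernel_def)
    ultimately show ?thesis
      by (simp only: Bochner_Integration.integral_zero mult_zero_right diff_0_right simp_thms)
  qed
  then show ?A ?B by auto
qed

lemma kernel_op_primitive_minus_exp_kernel:
  assumes \<epsilon>: "\<epsilon> > 0" and f: "integrable lborel f"
  shows "(LINT r|lborel. (volterra T (\<lambda>_. 1) (t, r) - \<epsilon> * exp_kernel T \<epsilon> (t, r)) * f r)
    = primitive T f t - \<epsilon> * past_average T \<epsilon> f t"
  using kernel_op_integrable[OF kernel_primitive f, where t=t] kernel_op_integrable[OF kernel_exp[OF \<epsilon>] f, where t=t]
  by (simp add: kernel_op_def left_diff_distrib mult.assoc)

text \<open>R f is the primitive of its rate, so it starts at 0; this follows from the identity for
  I R.\<close>

lemma primitive_past_average: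
  assumes \<epsilon>: "\<epsilon> > 0" and f: "integrable lborel f"
  shows "primitive T (\<lambda>t. (f t - past_average T \<epsilon> f t) / \<epsilon>) t = past_average T \<epsilon> f t"
proof -
  have b: "bounded {0<..<T}" by simp
  have pa: "integrable lborel (past_average T \<epsilon> f)"
    using borel_L2_integrable[OF kernel_op_borel_L2[OF kernel_exp[OF \<epsilon>] _ f]] by simp
  have "primitive T (past_average T \<epsilon> f) t = primitive T f t - \<epsilon> * past_average T \<epsilon> f t"
    unfolding kernel_op_comp[OF kernel_primitive kernel_exp[OF \<epsilon>] b f]
      integral_exp_kernel_primitive(1)[OF \<epsilon>] by (rule kernel_op_primitive_minus_exp_kernel[OF \<epsilon> f])
  moreover have "primitive T (\<lambda>t. inverse \<epsilon> * (f t - past_average T \<epsilon> f t)) t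
      = inverse \<epsilon> * (primitive T f t - primitive T (past_average T \<epsilon> f) t)"
    by (simp add: kernel_op_scale kernel_op_linear(2)[OF kernel_primitive f pa])
  ultimately show ?thesis using \<epsilon> by (simp add: divide_inverse mult.commute)
qed

text \<open>The rate of the average of a primitive is the average of the integrand: R commutes with
  differentiation of functions starting at 0. This follows from the identity for R I.\<close>

lemma past_average_primitive:
  assumes \<epsilon>: "\<epsilon> > 0" and f: "integrable lborel f"
  shows "(primitive T f t - past_average T \<epsilon> (primitive T f) t) / \<epsilon> = past_average T \<epsilon> f t"
proof -
  have b: "bounded {0<..<T}" by simp
  have "past_average T \<epsilon> (primitive T f) t = primitive T f t - \<epsilon> * past_average T \<epsilon> f t"
    unfolding kernel_op_comp[OF kernel_exp[OF \<epsilon>] kernel_primitive b f]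
      integral_exp_kernel_primitive(2)[OF \<epsilon>] by (rule kernel_op_primitive_minus_exp_kernel[OF \<epsilon> f])
  then show ?thesis using \<epsilon> by simp
qed

lemma kernel_op_mult_integrable:
  assumes k: "kernel_on J k" and f: "integrable lborel f" and g: "integrable lborel g"
  shows "integrable lborel (\<lambda>t. g t * kernel_op k f t)"
proof -
  have [measurable]: "f \<in> borel_measurable borel" using borel_measurable_integrable[OF f] by simp
  note km [measurable] = kernel_on_measurable[OF k]
  obtain B where B: "\<And>p. \<bar>k p\<bar> \<le> B" using kernel_on_bound[OF k] by metis
  have "kernel_op k f \<in> borel_measurable borel" by measurable
  from integrable_bounded_mult[OF g this kernel_op_abs_le[OF k B f]] show ?thesis by (simp add: mult.commute)
qed

text \<open>The kernels of the primitive and of its transpose add up to 1.\<close>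

lemma integral_mult_primitive:
  assumes Q: "Q \<in> borel_L2 {0<..<T}"
  shows "(LINT s|lborel. Q s * primitive T Q s) = (LINT s|lborel. Q s)\<^sup>2 / 2"
proof -
  let ?V = "volterra T (\<lambda>_. 1)"
  have Qi: "integrable lborel Q" using borel_L2_integrable[OF Q] by simp
  note [measurable] = borel_L2_measurable[OF Q]
  note k = kernel_primitive[of T] and k' = kernel_on_transpose[OF kernel_primitive[of T]]
  have sum: "Q s * primitive T Q s + Q s * kernel_op (transpose_kernel ?V) Q s = Q s * (LINT r|lborel. Q r)" for s
  proof (cases "s \<in> {0<..<T}")
    case True
    have "primitive T Q s + kernel_op (transpose_kernel ?V) Q s = (LINT r|lborel. ?V (s, r) * Q r + transpose_kernel ?V (s, r) * Q r)"
      unfolding kernel_op_def using kernel_op_integrable[OF k Qi] kernel_op_integrable[OF k' Qi] by simp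
    also have "\<dots> = (LINT r|lborel. Q r)"
    proof (rule integral_cong_AE)
      show "AE r in lborel. ?V (s, r) * Q r + transpose_kernel ?V (s, r) * Q r = Q r"
        using AE_lborel_singleton[of s]
      proof eventually_elim
        case (elim r)
        then show ?case using True borel_L2_outside[OF Q, of r]
          by (cases "r \<in> {0<..<T}") (auto simp: volterra_def transpose_kernel_def)
      qed
      show "(\<lambda>r. ?V (s, r) * Q r + transpose_kernel ?V (s, r) * Q r) \<in> borel_measurable lborel"
        using kernel_op_integrable[OF k Qi, of s] kernel_op_integrable[OF k' Qi, of s]
        by (intro borel_measurable_add borel_measurable_integrable)
    qed simp
    finally show ?thesis by (simp flip: distrib_left)
  qed (simp add: borel_L2_outside[OF Q])
  have "2 * (LINT s|lborel. Q s * primitive T Q s)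
      = (LINT s|lborel. Q s * primitive T Q s) + (LINT s|lborel. Q s * kernel_op (transpose_kernel ?V) Q s)"
    using kernel_op_adjoint[OF k Qi Qi] by simp
  also have "\<dots> = (LINT s|lborel. Q s * (LINT r|lborel. Q r))"
    using kernel_op_mult_integrable[OF k Qi Qi] kernel_op_mult_integrable[OF k' Qi Qi] by (simp flip: sum)
  also have "\<dots> = (LINT s|lborel. Q s)\<^sup>2" by (simp add: power2_eq_square)
  finally show ?thesis by simp
qed

text \<open>The chain rule for the square of an absolutely continuous function, without
  differentiating: cutting q off after t reduces it to the integral over the whole interval.\<close>

lemma primitive_mult_primitive:
  assumes q: "q \<in> borel_L2 {0<..<T}" and t: "t \<in> {0<..<T}"
  shows "primitive T (\<lambda>s. q s * primitive T q s) t = (primitive T q t)\<^sup>2 / 2"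
proof -
  define Q where "Q s = indicator {..t} s * q s" for s
  have Q: "Q \<in> borel_L2 {0<..<T}"
    unfolding Q_def[abs_def] by (rule borel_L2_bounded_mult[OF q, of _ 1]) (auto simp: indicator_def)
  have "(LINT s|lborel. Q s) = primitive T q t"
    using tail_primitive_eq_primitive[OF q t] by (simp add: Q_def tail_primitive_def)
  moreover have "primitive T Q s = primitive T q s" if "s \<le> t" for s
    unfolding kernel_op_def by (rule Bochner_Integration.integral_cong) (use that in \<open>auto simp: volterra_def Q_def\<close>)
  then have "(\<lambda>s. Q s * primitive T Q s) = (\<lambda>s. volterra T (\<lambda>_. 1) (t, s) * (q s * primitive T q s))"
    using t borel_L2_outside[OF q] by (fastforce simp: Q_def volterra_def indicator_def)
  ultimately show ?thesis using integral_mult_primitive[OF Q] by (simp add: kernel_op_def[of _ "\<lambda>s. q s * primitive T q s"])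
qed

section \<open>The weighted energy inequality\<close>

text \<open>Prescribing minus the derivative of the weight instead of the weight makes integration
  by parts the adjoint identity for the primitive.\<close>

definition time_weight :: "real \<Rightarrow> real \<Rightarrow> (real \<Rightarrow> real) \<Rightarrow> real \<Rightarrow> real" where
  "time_weight T a \<psi> t = a + kernel_op (transpose_kernel (volterra T (\<lambda>_. 1))) \<psi> t"

lemma time_weight_bounded:
  assumes \<psi>: "integrable lborel \<psi>"
  obtains B where "\<And>t. \<bar>time_weight T a \<psi> t\<bar> \<le> B"
proof -
  note k = kernel_on_transpose[OF kernel_primitive[of T]]
  obtain B where B: "\<And>p. \<bar>transpose_kernel (volterra T (\<lambda>_. 1)) p\<bar> \<le> B" using kernel_on_bound[OF k] by metis
  have "\<bar>time_weight T a \<psi> t\<bar> \<le> \<bar>a\<bar> + B * (LINT s|lborel. \<bar>\<psi> s\<bar>)" for t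
    unfolding time_weight_def using kernel_op_abs_le[OF k B \<psi>, of t] by linarith
  then show ?thesis by (rule that)
qed

lemma time_weight_measurable:
  assumes \<psi>: "integrable lborel \<psi>" shows "time_weight T a \<psi> \<in> borel_measurable borel"
proof -
  have [measurable]: "\<psi> \<in> borel_measurable borel" using borel_measurable_integrable[OF \<psi>] by simp
  note [measurable] = kernel_on_measurable[OF kernel_on_transpose[OF kernel_primitive[of T]]]
  show ?thesis unfolding time_weight_def[abs_def] by measurable
qed

text \<open>Integration by parts: \<^const>\<open>time_weight\<close> has derivative \<open>- \<psi>\<close> and the value \<open>a\<close> at the final
  time, whose boundary term is nonnegative and dropped.\<close>

lemma weighted_energy_inequality:
  assumes q: "q \<in> borel_L2 {0<..<T}" and \<psi>: "\<psi> \<in> borel_L2 {0<..<T}" and a: "a \<ge> 0"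
  shows "(LINT t|lborel. \<psi> t * (primitive T q t)\<^sup>2) / 2 \<le> (LINT t|lborel. time_weight T a \<psi> t * (q t * primitive T q t))"
proof -
  note k = kernel_primitive[of T] and k' = kernel_on_transpose[OF kernel_primitive[of T]]
  have qi: "integrable lborel q" and \<psi>i: "integrable lborel \<psi>"
    using borel_L2_integrable[OF q] borel_L2_integrable[OF \<psi>] by simp_all
  have mi: "integrable lborel (\<lambda>s. q s * primitive T q s)" by (rule kernel_op_mult_integrable[OF k qi qi])
  have "(LINT t|lborel. \<psi> t * (primitive T q t)\<^sup>2) / 2 = (LINT t|lborel. \<psi> t * (primitive T q t)\<^sup>2 / 2)" by simp
  also have "\<dots> = (LINT t|lborel. \<psi> t * primitive T (\<lambda>s. q s * primitive T q s) t)"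
  proof (rule Bochner_Integration.integral_cong)
    fix t show "\<psi> t * (primitive T q t)\<^sup>2 / 2 = \<psi> t * primitive T (\<lambda>s. q s * primitive T q s) t"
      using primitive_mult_primitive[OF q, of t] borel_L2_outside[OF \<psi>, of t] by (cases "t \<in> {0<..<T}") auto
  qed simp
  also have "\<dots> = (LINT t|lborel. (q t * primitive T q t) * kernel_op (transpose_kernel (volterra T (\<lambda>_. 1))) \<psi> t)"
    by (rule kernel_op_adjoint[OF k mi \<psi>i])
  also have "\<dots> \<le> a * (LINT t|lborel. q t * primitive T q t) + \<dots>"
    using a by (simp add: integral_mult_primitive[OF q])
  also have "\<dots> = (LINT t|lborel. a * (q t * primitive T q t)
      + (q t * primitive T q t) * kernel_op (transpose_kernel (volterra T (\<lambda>_. 1))) \<psi> t)"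
    using mi kernel_op_mult_integrable[OF k' \<psi>i mi] by simp
  also have "\<dots> = (LINT t|lborel. time_weight T a \<psi> t * (q t * primitive T q t))"
    by (rule Bochner_Integration.integral_cong) (auto simp: time_weight_def algebra_simps)
  finally show ?thesis .
qed

lemma weight_integrable:
  fixes w :: "real \<times> real \<Rightarrow> real"
  assumes "w \<in> borel_measurable borel" "\<And>q. \<bar>w q\<bar> \<le> B" "f \<in> borel_L2 S" "g \<in> borel_L2 S'"
  shows "integrable lborel (\<lambda>q. w q * (f q * g q))"
  by (rule integrable_bounded_mult[OF borel_L2_mult_integrable[OF assms(3,4)] assms(1,2)])

lemma borel_measurable_snd_comp:
  fixes c :: "real \<Rightarrow> real"
  assumes [measurable]: "c \<in> borel_measurable borel"
  shows "(\<lambda>q. c (snd q)) \<in> borel_measurable (borel :: (real \<times> real) measure)"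
proof -
  have "(\<lambda>q. c (snd q)) \<in> borel_measurable ((borel :: real measure) \<Otimes>\<^sub>M borel)" by measurable
  then show ?thesis unfolding borel_prod .
qed

text \<open>On almost every line of constant x this is \<open>weighted_energy_inequality\<close> for
  the rate of f, whose primitive is R f. The nonnegative coefficient is constant on such a
  line.\<close>

lemma smoothed_energy_inequality:
  assumes c: "c \<in> borel_measurable borel" "\<And>x. \<bar>c x\<bar> \<le> B" "\<And>x. 0 \<le> c x"
    and \<psi>: "\<psi> \<in> borel_measurable borel" "\<And>t. \<bar>\<psi> t\<bar> \<le> B'" "\<And>t. t \<notin> {0<..<T} \<Longrightarrow> \<psi> t = 0"
    and a: "a \<ge> 0" and \<epsilon>: "\<epsilon> > 0" and f: "f \<in> borel_L2 (cylinder l T)"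
  shows "(LINT q|lborel. c (fst q) * \<psi> (snd q) * (smoothed T \<epsilon> f q * smoothed T \<epsilon> f q)) / 2
    \<le> (LINT q|lborel. c (fst q) * time_weight T a \<psi> (snd q) * (smoothed T \<epsilon> f q * smoothed_rate T \<epsilon> f q))"
proof -
  have \<psi>L: "\<psi> \<in> borel_L2 {0<..<T}" by (rule borel_L2_bounded[OF \<psi>]) auto
  have \<psi>i: "integrable lborel \<psi>" using borel_L2_integrable[OF \<psi>L] by simp
  obtain W where W: "\<And>t. \<bar>time_weight T a \<psi> t\<bar> \<le> W" by (rule time_weight_bounded[OF \<psi>i, of T a]) blast
  note m = borel_measurable_fst_comp[OF c(1)] borel_measurable_snd_comp[OF \<psi>(1)]
    borel_measurable_snd_comp[OF time_weight_measurable[OF \<psi>i, of T a]]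
  have B: "0 \<le> B" using c(2)[of 0] by linarith
  note L = smoothed_L2[OF f \<epsilon>] and D = smoothed_rate_L2[OF f \<epsilon>]
  have f': "f \<in> borel_L2 ({0<..<l} \<times> {0<..<T})" using f by (simp add: cylinder_def)
  have i1: "integrable lborel (\<lambda>q. c (fst q) * \<psi> (snd q) * (smoothed T \<epsilon> f q * smoothed T \<epsilon> f q))"
    by (rule weight_integrable[OF _ _ L L, of _ "B * B'"])
       (use m c(2) \<psi>(2) B in \<open>auto simp: abs_mult intro!: mult_mono\<close>)
  have i2: "integrable lborel (\<lambda>q. c (fst q) * time_weight T a \<psi> (snd q) * (smoothed T \<epsilon> f q * smoothed_rate T \<epsilon> f q))"
    by (rule weight_integrable[OF _ _ L D, of _ "B * W"])
       (use m c(2) W B in \<open>auto simp: abs_mult intro!: mult_mono\<close>)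
  have "(LINT x|lborel. (LINT t|lborel. c x * \<psi> t * (smoothed T \<epsilon> f (x, t) * smoothed T \<epsilon> f (x, t))) / 2)
      \<le> (LINT x|lborel. LINT t|lborel. c x * time_weight T a \<psi> t * (smoothed T \<epsilon> f (x, t) * smoothed_rate T \<epsilon> f (x, t)))"
  proof (rule integral_mono_AE)
    show "integrable lborel (\<lambda>x. (LINT t|lborel. c x * \<psi> t * (smoothed T \<epsilon> f (x, t) * smoothed T \<epsilon> f (x, t))) / 2)"
      using integrable_plane(3)[OF i1] by simp
    show "integrable lborel (\<lambda>x. LINT t|lborel. c x * time_weight T a \<psi> t * (smoothed T \<epsilon> f (x, t) * smoothed_rate T \<epsilon> f (x, t)))"
      using integrable_plane(3)[OF i2] by simp
    show "AE x in lborel. (LINT t|lborel. c x * \<psi> t * (smoothed T \<epsilon> f (x, t) * smoothed T \<epsilon> f (x, t))) / 2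
        \<le> (LINT t|lborel. c x * time_weight T a \<psi> t * (smoothed T \<epsilon> f (x, t) * smoothed_rate T \<epsilon> f (x, t)))"
      using borel_L2_sections(1)[OF f']
    proof eventually_elim
      case (elim x)
      let ?f = "\<lambda>t. f (x, t)"
      have fi: "integrable lborel ?f" using borel_L2_integrable[OF elim] by simp
      define d where "d t = (?f t - past_average T \<epsilon> ?f t) / \<epsilon>" for t
      have d: "d \<in> borel_L2 {0<..<T}"
        using borel_L2_scale[OF borel_L2_diff[OF elim kernel_op_borel_L2[OF kernel_exp[OF \<epsilon>] _ fi]], of "inverse \<epsilon>"]
        by (simp add: d_def[abs_def] divide_inverse mult.commute)
      have p: "primitive T d t = past_average T \<epsilon> ?f t" for t
        unfolding d_def[abs_def] by (rule primitive_past_average[OF \<epsilon> fi])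
      have "c x * ((LINT t|lborel. \<psi> t * (primitive T d t)\<^sup>2) / 2)
          \<le> c x * (LINT t|lborel. time_weight T a \<psi> t * (d t * primitive T d t))"
        by (rule mult_left_mono[OF weighted_energy_inequality[OF d \<psi>L a] c(3)])
      then show ?case
        by (simp add: in_time_apply smoothed_rate_def p power2_eq_square d_def mult_ac flip: integral_mult_right_zero)
    qed
  qed
  then show ?thesis using integrable_plane(5)[OF i1] integrable_plane(5)[OF i2] by simp
qed

text \<open>With \<open>\<psi> = 0\<close> and \<open>a = 1\<close> the weight is 1, and the energy
  inequality says that R f has nonnegative inner product with its rate (f - R f) / \<epsilon>. So
  the squared norm of R f is at most its inner product with f, and the inequality of the means
  finishes.\<close>

lemma smoothed_contraction:
  assumes \<epsilon>: "\<epsilon> > 0" and f: "f \<in> borel_L2 (cylinder l T)"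
  shows "(LINT q|lborel. (smoothed T \<epsilon> f q)\<^sup>2) \<le> (LINT q|lborel. (f q)\<^sup>2)"
proof -
  note L = smoothed_L2[OF f \<epsilon>] and D = smoothed_rate_L2[OF f \<epsilon>]
  have "time_weight T 1 (\<lambda>_. 0) t = 1" for t by (simp add: time_weight_def kernel_op_def)
  with smoothed_energy_inequality[of "\<lambda>_. 1" 1 "\<lambda>_. 0" 0 T 1 \<epsilon> f l] \<epsilon> f
  have "0 \<le> (LINT q|lborel. smoothed T \<epsilon> f q * smoothed_rate T \<epsilon> f q)" by simp
  also have "\<dots> = (LINT q|lborel. (smoothed T \<epsilon> f q * f q - (smoothed T \<epsilon> f q)\<^sup>2) / \<epsilon>)"
    by (simp add: smoothed_rate_def right_diff_distrib power2_eq_square)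
  also have "\<dots> = ((LINT q|lborel. smoothed T \<epsilon> f q * f q) - (LINT q|lborel. (smoothed T \<epsilon> f q)\<^sup>2)) / \<epsilon>"
    using borel_L2_mult_integrable[OF L f] borel_L2_square_integrable[OF L] by simp
  finally have "(LINT q|lborel. (smoothed T \<epsilon> f q)\<^sup>2) \<le> (LINT q|lborel. smoothed T \<epsilon> f q * f q)"
    using \<epsilon> by (simp add: zero_le_divide_iff)
  also have "\<dots> \<le> (LINT q|lborel. (smoothed T \<epsilon> f q)\<^sup>2 / 2 + (f q)\<^sup>2 / 2)"
  proof (rule integral_mono)
    show "smoothed T \<epsilon> f q * f q \<le> (smoothed T \<epsilon> f q)\<^sup>2 / 2 + (f q)\<^sup>2 / 2" for q
      using sum_squares_bound[of "smoothed T \<epsilon> f q" "f q"] by simp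
  qed (use borel_L2_mult_integrable[OF L f] borel_L2_square_integrable[OF L] borel_L2_square_integrable[OF f] in auto)
  also have "\<dots> = (LINT q|lborel. (smoothed T \<epsilon> f q)\<^sup>2) / 2 + (LINT q|lborel. (f q)\<^sup>2) / 2"
    using borel_L2_square_integrable[OF L] borel_L2_square_integrable[OF f] by simp
  finally show ?thesis by simp
qed

text \<open>With D for the rate, G D h = D G h = D I p = R p, where G h = I p is the kinematic
  identity. Choosing D h as second derivative of the multiplier thus amounts to multiplying by the
  averaged velocity.\<close>

lemma smoothed_rate_green_op:
  assumes \<epsilon>: "\<epsilon> > 0" and p: "p \<in> borel_L2 (cylinder l T)" and h: "h \<in> borel_L2 (cylinder l T)"
    and eq: "AE q in lborel. green_op l h q = in_time (primitive T) p q"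
  shows "AE q in lborel. green_op l (smoothed_rate T \<epsilon> h) q = smoothed T \<epsilon> p q"
    and "AE q in lborel. green_deriv_op l (smoothed_rate T \<epsilon> h) q = smoothed_rate T \<epsilon> (green_deriv_op l h) q"
proof -
  note k = kernel_exp[OF \<epsilon>, of T]
  have hi: "integrable lborel h" by (rule borel_L2_integrable[OF h bounded_cylinder])
  have p': "p \<in> borel_L2 ({0<..<l} \<times> {0<..<T})" using p by (simp add: cylinder_def)
  have Ip: "in_time (primitive T) p \<in> borel_L2 (cylinder l T)"
    unfolding cylinder_def by (rule in_time_borel_L2[OF kernel_primitive _ p']) simp
  have com: "green_op l (smoothed T \<epsilon> h) = smoothed T \<epsilon> (green_op l h)" "green_deriv_op l (smoothed T \<epsilon> h) = smoothed T \<epsilon> (green_deriv_op l h)"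
    by (rule in_time_in_space_commute[symmetric, OF k kernel_green hi] 
        in_time_in_space_commute[symmetric, OF k kernel_green_deriv hi]; simp)+
  have RI: "AE q in lborel. smoothed T \<epsilon> (green_op l h) q = smoothed T \<epsilon> (in_time (primitive T) p) q"
    by (rule in_time_cong_AE[OF k borel_L2_measurable[OF green_op_L2[OF h]] borel_L2_measurable[OF Ip] eq])
  have "AE q in lborel. (in_time (primitive T) p q - smoothed T \<epsilon> (in_time (primitive T) p) q) / \<epsilon> = smoothed T \<epsilon> p q"
  proof (rule AE_plane_eqI(1))
    show "(\<lambda>q. (in_time (primitive T) p q - smoothed T \<epsilon> (in_time (primitive T) p) q) / \<epsilon>) \<in> borel_measurable borel"
      using borel_L2_measurable[OF Ip] borel_L2_measurable[OF smoothed_L2[OF Ip \<epsilon>]] by simp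
    show "smoothed T \<epsilon> p \<in> borel_measurable borel" by (rule borel_L2_measurable[OF smoothed_L2[OF p \<epsilon>]])
    show "AE x in lborel. AE t in lborel.
        (in_time (primitive T) p (x, t) - smoothed T \<epsilon> (in_time (primitive T) p) (x, t)) / \<epsilon> = smoothed T \<epsilon> p (x, t)"
      using borel_L2_sections(1)[OF p']
    proof eventually_elim
      case (elim x)
      have "integrable lborel (\<lambda>t. p (x, t))" using borel_L2_integrable[OF elim] by simp
      from past_average_primitive[OF \<epsilon> this] show ?case by (simp add: in_time_apply)
    qed
  qed
  with in_space_diff_AE[OF kernel_green h smoothed_L2[OF h \<epsilon>], of \<epsilon>] eq RI
  show "AE q in lborel. green_op l (smoothed_rate T \<epsilon> h) q = smoothed T \<epsilon> p q"
    unfolding com smoothed_rate_def by eventually_elim simp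
  show "AE q in lborel. green_deriv_op l (smoothed_rate T \<epsilon> h) q = smoothed_rate T \<epsilon> (green_deriv_op l h) q"
    using in_space_diff_AE[OF kernel_green_deriv h smoothed_L2[OF h \<epsilon>], of \<epsilon>]
    unfolding com smoothed_rate_def by eventually_elim simp
qed

text \<open>The integrand is minus the derivative of the exponential, whose value 1 at the final
  time is the number subtracted.\<close>

lemma time_weight_exp:
  assumes \<rho>\<^sub>0: "\<rho>\<^sub>0 > 0" and t: "t \<in> {0<..<T}"
  shows "time_weight T a (\<lambda>t. indicator {0<..<T} t * (exp ((T - t) / \<rho>\<^sub>0) / \<rho>\<^sub>0)) t = a + exp ((T - t) / \<rho>\<^sub>0) - 1"
proof -
  let ?\<psi> = "\<lambda>t. indicator {0<..<T} t * (exp ((T - t) / \<rho>\<^sub>0) / \<rho>\<^sub>0)"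
  have "kernel_op (transpose_kernel (volterra T (\<lambda>_. 1))) ?\<psi> t = (LINT s|lborel. indicator {t..T} s *\<^sub>R (exp ((T - s) / \<rho>\<^sub>0) / \<rho>\<^sub>0))"
    unfolding kernel_op_def
  proof (rule integral_cong_AE)
    show "AE s in lborel. transpose_kernel (volterra T (\<lambda>_. 1)) (t, s) * ?\<psi> s = indicator {t..T} s *\<^sub>R (exp ((T - s) / \<rho>\<^sub>0) / \<rho>\<^sub>0)"
      using AE_lborel_singleton[of T]
      by eventually_elim (use t in \<open>auto simp: transpose_kernel_def volterra_def indicator_def\<close>)
    note [measurable] = kernel_on_measurable[OF kernel_on_transpose[OF kernel_primitive[of T]]]
    show "(\<lambda>s. transpose_kernel (volterra T (\<lambda>_. 1)) (t, s) * ?\<psi> s) \<in> borel_measurable lborel" by measurable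
  qed simp
  also have "\<dots> = - exp ((T - T) / \<rho>\<^sub>0) - - exp ((T - t) / \<rho>\<^sub>0)"
  proof (rule integral_FTC_atLeastAtMost)
    fix s
    have "((\<lambda>s. - exp ((T - s) / \<rho>\<^sub>0)) has_real_derivative exp ((T - s) / \<rho>\<^sub>0) / \<rho>\<^sub>0) (at s)"
      using \<rho>\<^sub>0 by (auto intro!: derivative_eq_intros)
    then show "((\<lambda>s. - exp ((T - s) / \<rho>\<^sub>0)) has_vector_derivative exp ((T - s) / \<rho>\<^sub>0) / \<rho>\<^sub>0) (at s within {t..T})"
      by (simp add: has_field_derivative_at_within flip: has_real_derivative_iff_has_vector_derivative)
  qed (use t \<rho>\<^sub>0 in \<open>auto intro!: continuous_intros\<close>)
  finally show ?thesis by (simp add: time_weight_def)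
qed

section \<open>The energy estimate and the limit of vanishing averaging\<close>

text \<open>The inertia term yields at least X / 2 and the load term costs at most X / 2 besides the
  load, where X is the weighted kinetic energy. After cancellation the bending and the damping term
  remain on the left.\<close>

lemma averaged_energy_estimate:
  assumes eqn: "averaged_equation l T \<epsilon> \<rho> \<mu> \<tau> r \<kappa> p h F"
    and p: "p \<in> borel_L2 (cylinder l T)" and h: "h \<in> borel_L2 (cylinder l T)" and F: "F \<in> borel_L2 (cylinder l T)"
    and Gh: "AE q in lborel. green_op l h q = in_time (primitive T) p q" and \<epsilon>: "\<epsilon> > 0" and T: "0 < T"
    and rho: "\<rho> \<in> borel_measurable borel" "\<And>x. \<rho>\<^sub>0 \<le> \<rho> x \<and> \<rho> x \<le> \<rho>\<^sub>1" "0 < \<rho>\<^sub>0"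
    and mu: "\<mu> \<in> borel_measurable borel" "\<And>x. \<mu>\<^sub>0 \<le> \<mu> x \<and> \<mu> x \<le> \<mu>\<^sub>1" "0 \<le> \<mu>\<^sub>0"
    and tau: "\<tau> \<in> borel_measurable borel" "\<And>x. \<tau>\<^sub>0 \<le> \<tau> x \<and> \<tau> x \<le> \<tau>\<^sub>1" "0 \<le> \<tau>\<^sub>0"
    and rr: "r \<in> borel_measurable borel" "\<And>x. r\<^sub>0 \<le> r x \<and> r x \<le> r\<^sub>1" "0 < r\<^sub>0"
    and kap: "\<kappa> \<in> borel_measurable borel" "\<And>x. \<kappa>\<^sub>0 \<le> \<kappa> x \<and> \<kappa> x \<le> \<kappa>\<^sub>1" "0 < \<kappa>\<^sub>0"
    and a: "0 < a" "a \<le> 1"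
  shows "r\<^sub>0 / \<rho>\<^sub>0 * (LINT q|lborel. (smoothed T \<epsilon> h q)\<^sup>2) / 2 + \<kappa>\<^sub>0 * a * (LINT q|lborel. (smoothed_rate T \<epsilon> h q)\<^sup>2)
    \<le> (a + exp (T / \<rho>\<^sub>0) - 1) / 2 * (LINT q|lborel. (F q)\<^sup>2)"
proof -
  define \<psi> where "\<psi> t = indicator {0<..<T} t * (exp ((T - t) / \<rho>\<^sub>0) / \<rho>\<^sub>0)" for t
  define \<phi> where "\<phi> = time_weight T a \<psi>"
  \<comment> \<open>An upper bound for the weight: its expression at t = 0.\<close>
  define P where "P = a + exp (T / \<rho>\<^sub>0) - 1"
  have \<psi>: "\<psi> \<in> borel_measurable borel" unfolding \<psi>_def[abs_def] by measurable
  have \<psi>b: "\<bar>\<psi> t\<bar> \<le> exp (T / \<rho>\<^sub>0) / \<rho>\<^sub>0" for t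
    using rho(3) by (auto simp: \<psi>_def indicator_def intro!: divide_right_mono)
  have \<psi>0: "\<psi> t = 0" if "t \<notin> {0<..<T}" for t using that by (simp add: \<psi>_def)
  have "\<psi> \<in> borel_L2 {0<..<T}" by (rule borel_L2_bounded[OF \<psi> \<psi>b \<psi>0]) auto
  then have \<psi>i: "integrable lborel \<psi>" by (rule borel_L2_integrable) simp
  have \<phi>m: "\<phi> \<in> borel_measurable borel" unfolding \<phi>_def by (rule time_weight_measurable[OF \<psi>i])
  obtain W where W: "\<And>t. \<bar>\<phi> t\<bar> \<le> W" unfolding \<phi>_def by (rule time_weight_bounded[OF \<psi>i, of T a]) blast
  have \<phi>eq: "\<phi> t = a + exp ((T - t) / \<rho>\<^sub>0) - 1" if "t \<in> {0<..<T}" for t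
    unfolding \<phi>_def \<psi>_def[abs_def] by (rule time_weight_exp[OF rho(3) that])
  \<comment> \<open>The third bound uses \<open>a \<le> 1\<close>: then the weight is at most exp
    ((T - t) / \<open>\<rho>\<^sub>0\<close>), which is
    \<open>\<rho>\<^sub>0 * \<psi> t\<close>.\<close>
  have \<phi>: "a \<le> \<phi> t" "\<phi> t \<le> P" "\<phi> t \<le> \<rho>\<^sub>0 * \<psi> t" "1 / \<rho>\<^sub>0 \<le> \<psi> t" if t: "t \<in> {0<..<T}" for t
  proof -
    have "1 \<le> exp ((T - t) / \<rho>\<^sub>0)" using t rho(3) by simp
    moreover have "exp ((T - t) / \<rho>\<^sub>0) \<le> exp (T / \<rho>\<^sub>0)" using t rho(3) by (simp add: divide_right_mono)
    ultimately show "a \<le> \<phi> t" "\<phi> t \<le> P" "\<phi> t \<le> \<rho>\<^sub>0 * \<psi> t" "1 / \<rho>\<^sub>0 \<le> \<psi> t"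
      using t a rho(3) by (simp_all add: \<phi>eq P_def \<psi>_def divide_right_mono)
  qed
  let ?R = "smoothed T \<epsilon>" and ?D = "smoothed_rate T \<epsilon>"
  have G'h: "green_deriv_op l h \<in> borel_L2 (cylinder l T)" by (rule green_deriv_op_L2[OF h])
  note Rp = smoothed_L2[OF p \<epsilon>] and Rh = smoothed_L2[OF h \<epsilon>] and RF = smoothed_L2[OF F \<epsilon>] and RG = smoothed_L2[OF G'h \<epsilon>]
    and Dp = smoothed_rate_L2[OF p \<epsilon>] and Dh = smoothed_rate_L2[OF h \<epsilon>] and DG = smoothed_rate_L2[OF G'h \<epsilon>]
  have bd: "\<bar>c x\<bar> \<le> \<bar>hi\<bar>" if "\<And>x. lo \<le> c x \<and> c x \<le> hi" "0 \<le> lo" for c :: "real \<Rightarrow> real" and lo hi x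
    using that(1)[of x] that(2) by linarith
  note rb = bd[of \<rho>\<^sub>0 \<rho> \<rho>\<^sub>1, OF rho(2) less_imp_le[OF rho(3)]] and mb = bd[of \<mu>\<^sub>0 \<mu> \<mu>\<^sub>1, OF mu(2,3)]
    and tb = bd[of \<tau>\<^sub>0 \<tau> \<tau>\<^sub>1, OF tau(2,3)]
    and rrb = bd[of r\<^sub>0 r r\<^sub>1, OF rr(2) less_imp_le[OF rr(3)]] and kb = bd[of \<kappa>\<^sub>0 \<kappa> \<kappa>\<^sub>1, OF kap(2) less_imp_le[OF kap(3)]]
  have \<phi>q: "(\<lambda>q. \<phi> (snd q)) \<in> borel_measurable (borel :: (real \<times> real) measure)"
    by (rule borel_measurable_snd_comp[OF \<phi>m])
  have \<psi>q: "(\<lambda>q. \<psi> (snd q)) \<in> borel_measurable (borel :: (real \<times> real) measure)"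
    by (rule borel_measurable_snd_comp[OF \<psi>])
  have \<phi>L: "(\<lambda>q. \<phi> (snd q) * f q) \<in> borel_L2 (cylinder l T)" if "f \<in> borel_L2 (cylinder l T)" for f
    by (rule borel_L2_bounded_mult[OF that \<phi>q W])
  have wi: "integrable lborel (\<lambda>q. c (fst q) * w (snd q) * (f q * g q))"
    if "c \<in> borel_measurable borel" "\<And>x. \<bar>c x\<bar> \<le> B" "w \<in> borel_measurable borel" "\<And>x. \<bar>w x\<bar> \<le> B'"
      "f \<in> borel_L2 (cylinder l T)" "g \<in> borel_L2 (cylinder l T)" for c w :: "real \<Rightarrow> real" and B B' f g
  proof (rule weight_integrable[OF _ _ that(5,6), of _ "B * B'"])
    show "(\<lambda>q. c (fst q) * w (snd q)) \<in> borel_measurable borel"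
      using borel_measurable_fst_comp[OF that(1)] borel_measurable_snd_comp[OF that(3)] by simp
    show "\<bar>c (fst q) * w (snd q)\<bar> \<le> B * B'" for q :: "real \<times> real"
      unfolding abs_mult by (rule mult_mono) (use that(2)[of "fst q"] that(4) in auto)
  qed
  \<comment> \<open>The weight depends on time only, so it passes through the Green operators; G of
    this function is the weight times the averaged velocity.\<close>
  define \<eta> where "\<eta> q = \<phi> (snd q) * ?D h q" for q
  have \<eta>: "\<eta> \<in> borel_L2 (cylinder l T)" unfolding \<eta>_def[abs_def] by (rule \<phi>L[OF Dh])
  have "in_space (kernel_op k) \<eta> q = \<phi> (snd q) * in_space (kernel_op k) (?D h) q" for k q
    by (simp add: in_space_def \<eta>_def kernel_op_scale)
  then have G\<eta>: "AE q in lborel. green_op l \<eta> q = \<phi> (snd q) * ?R p q"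
    and G'\<eta>: "AE q in lborel. green_deriv_op l \<eta> q = \<phi> (snd q) * ?D (green_deriv_op l h) q"
    using smoothed_rate_green_op[OF \<epsilon> p h Gh] by (auto elim: eventually_mono)
  have sub: "(LINT q|lborel. c (fst q) * f q * g q) = (LINT q|lborel. c (fst q) * \<phi> (snd q) * (f q * g' q))"
    if "AE q in lborel. g q = \<phi> (snd q) * g' q" "c \<in> borel_measurable borel" "f \<in> borel_L2 (cylinder l T)"
      "g \<in> borel_L2 (cylinder l T)" "g' \<in> borel_L2 (cylinder l T)" for c f g g'
  proof (rule integral_cong_AE)
    show "AE q in lborel. c (fst q) * f q * g q = c (fst q) * \<phi> (snd q) * (f q * g' q)"
      using that(1) by eventually_elim simp
  qed (use borel_measurable_fst_comp[OF that(2)] \<phi>q borel_L2_measurable[OF that(3)]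
      borel_L2_measurable[OF that(4)] borel_L2_measurable[OF that(5)] in simp_all)
  note GL = green_op_L2[OF \<eta>] and G'L = green_deriv_op_L2[OF \<eta>]
  have \<eta>eq: "AE q in lborel. \<eta> q = \<phi> (snd q) * ?D h q" by (simp add: \<eta>_def)
  have e: "(LINT q|lborel. \<rho> (fst q) * \<phi> (snd q) * (?D p q * ?R p q))
    + (LINT q|lborel. \<mu> (fst q) * \<phi> (snd q) * (?R p q * ?R p q))
    + (LINT q|lborel. \<tau> (fst q) * \<phi> (snd q) * (?R (green_deriv_op l h) q * ?D (green_deriv_op l h) q))
    + (LINT q|lborel. r (fst q) * \<phi> (snd q) * (?R h q * ?D h q))
    + (LINT q|lborel. \<kappa> (fst q) * \<phi> (snd q) * (?D h q * ?D h q))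
    = (LINT q|lborel. 1 * \<phi> (snd q) * (?R F q * ?R p q))"
    using eqn[unfolded averaged_equation_def, rule_format, OF \<eta>]
      sub[OF G\<eta> rho(1) Dp GL Rp] sub[OF G\<eta> mu(1) Rp GL Rp] sub[OF G'\<eta> tau(1) RG G'L DG]
      sub[OF \<eta>eq rr(1) Rh \<eta> Dh] sub[OF \<eta>eq kap(1) Dh \<eta> Dh] sub[OF G\<eta> _ RF GL Rp, of "\<lambda>_. 1"] by simp
  have cyl: "snd q \<in> {0<..<T}" if "q \<in> cylinder l T" for q using that by (auto simp: cylinder_def)
  have one: "(\<lambda>_. 1 :: real) \<in> borel_measurable borel" "\<And>x. \<bar>1 :: real\<bar> \<le> 1" by auto
  \<comment> \<open>Kinetic energy with weight \<phi> but without the density, the quantity that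
    cancels between inertia and load.\<close>
  define X where "X = (LINT q|lborel. 1 * \<phi> (snd q) * (?R p q * ?R p q))"
  have mono: "(LINT q|lborel. c (fst q) * w (snd q) * (f q * f q)) \<le> (LINT q|lborel. c' (fst q) * w' (snd q) * (f q * f q))"
    if "integrable lborel (\<lambda>q. c (fst q) * w (snd q) * (f q * f q))" "integrable lborel (\<lambda>q. c' (fst q) * w' (snd q) * (f q * f q))"
      "f \<in> borel_L2 (cylinder l T)" "\<And>x t. t \<in> {0<..<T} \<Longrightarrow> c x * w t \<le> c' x * w' t" for c w c' w' :: "real \<Rightarrow> real" and f
  proof (rule integral_mono[OF that(1,2)])
    fix q
    show "c (fst q) * w (snd q) * (f q * f q) \<le> c' (fst q) * w' (snd q) * (f q * f q)"
    proof (cases "q \<in> cylinder l T")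
      case True
      show ?thesis by (rule mult_right_mono[OF that(4)[OF cyl[OF True]]]) simp
    qed (simp add: borel_L2_outside[OF that(3)])
  qed
  \<comment> \<open>Integration by parts leaves half of \<open>\<rho>\<close> times
    \<open>\<psi>\<close>, and \<open>\<rho> x * \<psi> t \<ge> \<rho>\<^sub>0 * \<psi> t \<ge>
    \<phi> t\<close>. This inequality replaces Gronwall.\<close>
  have T1: "X / 2 \<le> (LINT q|lborel. \<rho> (fst q) * \<phi> (snd q) * (?D p q * ?R p q))"
  proof -
    have "X \<le> (LINT q|lborel. \<rho> (fst q) * \<psi> (snd q) * (?R p q * ?R p q))"
      unfolding X_def
    proof (rule mono[OF wi[OF one \<phi>m W Rp Rp] wi[OF rho(1) rb \<psi> \<psi>b Rp Rp] Rp])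
      fix x t assume t: "t \<in> {0<..<T}"
      have "0 \<le> \<psi> t" using \<phi>(4)[OF t] rho(3) by (simp add: \<psi>_def)
      then have "\<rho>\<^sub>0 * \<psi> t \<le> \<rho> x * \<psi> t" using rho(2)[of x] by (intro mult_right_mono) auto
      then show "1 * \<phi> t \<le> \<rho> x * \<psi> t" using \<phi>(3)[OF t] by simp
    qed
    moreover have "(LINT q|lborel. \<rho> (fst q) * \<psi> (snd q) * (?R p q * ?R p q)) / 2
        \<le> (LINT q|lborel. \<rho> (fst q) * \<phi> (snd q) * (?R p q * ?D p q))"
      unfolding \<phi>_def
      by (rule smoothed_energy_inequality[OF rho(1) rb _ \<psi> \<psi>b \<psi>0 _ \<epsilon> p]) (use rho a in \<open>auto intro: order_trans less_imp_le\<close>)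
    ultimately show ?thesis by (simp add: mult.commute[of "?D p _"])
  qed
  have T2: "0 \<le> (LINT q|lborel. \<mu> (fst q) * \<phi> (snd q) * (?R p q * ?R p q))"
  proof -
    have "(LINT q|lborel. 0 * 0 * (?R p q * ?R p q)) \<le> (LINT q|lborel. \<mu> (fst q) * \<phi> (snd q) * (?R p q * ?R p q))"
    proof (rule mono[OF _ wi[OF mu(1) mb \<phi>m W Rp Rp] Rp])
      fix x t assume t: "t \<in> {0<..<T}"
      have "0 \<le> \<phi> t" using \<phi>(1)[OF t] a by simp
      then show "0 * 0 \<le> \<mu> x * \<phi> t" using mu(2)[of x] mu(3) by simp
    qed simp
    then show ?thesis by simp
  qed
  \<comment> \<open>The tension term is again a function times its rate, so the energy inequality
    bounds it below by a nonnegative integral.\<close>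
  have T3: "0 \<le> (LINT q|lborel. \<tau> (fst q) * \<phi> (snd q) * (?R (green_deriv_op l h) q * ?D (green_deriv_op l h) q))"
  proof -
    have "(LINT q|lborel. 0 * 0 * (?R (green_deriv_op l h) q * ?R (green_deriv_op l h) q))
        \<le> (LINT q|lborel. \<tau> (fst q) * \<psi> (snd q) * (?R (green_deriv_op l h) q * ?R (green_deriv_op l h) q))"
    proof (rule mono[OF _ wi[OF tau(1) tb \<psi> \<psi>b RG RG] RG])
      fix x t assume t: "t \<in> {0<..<T}"
      have "0 \<le> \<psi> t" using \<phi>(4)[OF t] rho(3) by (simp add: \<psi>_def)
      then show "0 * 0 \<le> \<tau> x * \<psi> t" using tau(2)[of x] tau(3) by simp
    qed simp
    moreover have "(LINT q|lborel. \<tau> (fst q) * \<psi> (snd q) * (?R (green_deriv_op l h) q * ?R (green_deriv_op l h) q)) / 2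
        \<le> (LINT q|lborel. \<tau> (fst q) * \<phi> (snd q) * (?R (green_deriv_op l h) q * ?D (green_deriv_op l h) q))"
      unfolding \<phi>_def
      by (rule smoothed_energy_inequality[OF tau(1) tb _ \<psi> \<psi>b \<psi>0 _ \<epsilon> G'h]) (use tau a in \<open>auto intro: order_trans less_imp_le\<close>)
    ultimately show ?thesis by simp
  qed
  \<comment> \<open>Half of the coefficient comes from integration by parts, and 1 /
    \<open>\<rho>\<^sub>0\<close> is the lower bound for \<open>\<psi>\<close>.\<close>
  have T4: "r\<^sub>0 / \<rho>\<^sub>0 * (LINT q|lborel. (?R h q)\<^sup>2) / 2 \<le> (LINT q|lborel. r (fst q) * \<phi> (snd q) * (?R h q * ?D h q))"
  proof -
    have "(LINT q|lborel. r\<^sub>0 * (1 / \<rho>\<^sub>0) * (?R h q * ?R h q)) \<le> (LINT q|lborel. r (fst q) * \<psi> (snd q) * (?R h q * ?R h q))"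
    proof (rule mono[OF _ wi[OF rr(1) rrb \<psi> \<psi>b Rh Rh] Rh])
      show "integrable lborel (\<lambda>q. r\<^sub>0 * (1 / \<rho>\<^sub>0) * (?R h q * ?R h q))"
        using borel_L2_mult_integrable[OF Rh Rh] by simp
      fix x t assume t: "t \<in> {0<..<T}"
      show "r\<^sub>0 * (1 / \<rho>\<^sub>0) \<le> r x * \<psi> t"
        by (rule mult_mono) (use \<phi>(4)[OF t] rr(2)[of x] rr(3) rho(3) in auto)
    qed
    moreover have "(LINT q|lborel. r (fst q) * \<psi> (snd q) * (?R h q * ?R h q)) / 2
        \<le> (LINT q|lborel. r (fst q) * \<phi> (snd q) * (?R h q * ?D h q))"
      unfolding \<phi>_def
      by (rule smoothed_energy_inequality[OF rr(1) rrb _ \<psi> \<psi>b \<psi>0 _ \<epsilon> h]) (use rr a in \<open>auto intro: order_trans less_imp_le\<close>)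
    moreover have "(LINT q|lborel. r\<^sub>0 * (1 / \<rho>\<^sub>0) * (?R h q * ?R h q)) = r\<^sub>0 / \<rho>\<^sub>0 * (LINT q|lborel. (?R h q)\<^sup>2)"
      by (simp add: power2_eq_square)
    moreover have "x \<le> y \<Longrightarrow> y / 2 \<le> z \<Longrightarrow> x = w \<Longrightarrow> w / 2 \<le> z" for w x y z :: real by simp
    ultimately show ?thesis by blast
  qed
  \<comment> \<open>Here the weight multiplies a square directly, and its lower bound a > 0 keeps
    the rate of h under control up to the final time.\<close>
  have T5: "\<kappa>\<^sub>0 * a * (LINT q|lborel. (?D h q)\<^sup>2) \<le> (LINT q|lborel. \<kappa> (fst q) * \<phi> (snd q) * (?D h q * ?D h q))"
  proof -
    have "(LINT q|lborel. \<kappa>\<^sub>0 * a * (?D h q * ?D h q)) \<le> (LINT q|lborel. \<kappa> (fst q) * \<phi> (snd q) * (?D h q * ?D h q))"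
    proof (rule mono[OF _ wi[OF kap(1) kb \<phi>m W Dh Dh] Dh])
      show "integrable lborel (\<lambda>q. \<kappa>\<^sub>0 * a * (?D h q * ?D h q))"
        using borel_L2_mult_integrable[OF Dh Dh] by simp
      fix x t assume t: "t \<in> {0<..<T}"
      show "\<kappa>\<^sub>0 * a \<le> \<kappa> x * \<phi> t"
        by (rule mult_mono) (use \<phi>(1)[OF t] kap(2)[of x] kap(3) a in auto)
    qed
    then show ?thesis by (simp add: power2_eq_square)
  qed
  \<comment> \<open>Young's inequality with equal halves, so that the velocity part is exactly X /
    2. Then the weight is estimated by its bound \<open>P\<close> and the average by its contraction
    property.\<close>
  have T6: "(LINT q|lborel. 1 * \<phi> (snd q) * (?R F q * ?R p q)) \<le> P / 2 * (LINT q|lborel. (F q)\<^sup>2) + X / 2"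
  proof -
    have "(LINT q|lborel. 1 * \<phi> (snd q) * (?R F q * ?R p q))
        \<le> (LINT q|lborel. (1 * \<phi> (snd q) * (?R F q * ?R F q)) / 2 + (1 * \<phi> (snd q) * (?R p q * ?R p q)) / 2)"
    proof (rule integral_mono)
      show "integrable lborel (\<lambda>q. 1 * \<phi> (snd q) * (?R F q * ?R p q))" by (rule wi[OF one \<phi>m W RF Rp])
      show "integrable lborel (\<lambda>q. (1 * \<phi> (snd q) * (?R F q * ?R F q)) / 2 + (1 * \<phi> (snd q) * (?R p q * ?R p q)) / 2)"
        using wi[OF one \<phi>m W RF RF] wi[OF one \<phi>m W Rp Rp] by simp
      fix q
      show "1 * \<phi> (snd q) * (?R F q * ?R p q)
          \<le> (1 * \<phi> (snd q) * (?R F q * ?R F q)) / 2 + (1 * \<phi> (snd q) * (?R p q * ?R p q)) / 2"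
      proof (cases "q \<in> cylinder l T")
        case True
        have "0 \<le> \<phi> (snd q)" using \<phi>(1)[OF cyl[OF True]] a by simp
        then have "\<phi> (snd q) * (2 * ?R F q * ?R p q) \<le> \<phi> (snd q) * ((?R F q)\<^sup>2 + (?R p q)\<^sup>2)"
          by (intro mult_left_mono sum_squares_bound)
        then show ?thesis by (simp add: power2_eq_square algebra_simps)
      qed (simp add: borel_L2_outside[OF Rp] borel_L2_outside[OF RF])
    qed
    also have "\<dots> = (LINT q|lborel. 1 * \<phi> (snd q) * (?R F q * ?R F q)) / 2 + X / 2"
      unfolding X_def using wi[OF one \<phi>m W RF RF] wi[OF one \<phi>m W Rp Rp] by simp
    also have "(LINT q|lborel. 1 * \<phi> (snd q) * (?R F q * ?R F q)) \<le> (LINT q|lborel. 1 * P * (?R F q * ?R F q))"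
    proof (rule mono[OF wi[OF one \<phi>m W RF RF] _ RF])
      show "integrable lborel (\<lambda>q. 1 * P * (?R F q * ?R F q))" using borel_L2_mult_integrable[OF RF RF] by simp
    qed (use \<phi>(2) in simp)
    also have "(LINT q|lborel. 1 * P * (?R F q * ?R F q)) \<le> P * (LINT q|lborel. (F q)\<^sup>2)"
    proof -
      have "1 \<le> exp (T / \<rho>\<^sub>0)" using T rho(3) by simp
      then have "P \<ge> 0" using a unfolding P_def by linarith
      then show ?thesis using smoothed_contraction[OF \<epsilon> F] by (simp add: power2_eq_square mult_left_mono)
    qed
    finally show ?thesis by simp
  qed
  have "t1 + t2 + t3 + t4 + t5 = t6 \<Longrightarrow> x \<le> t1 \<Longrightarrow> 0 \<le> t2 \<Longrightarrow> 0 \<le> t3 \<Longrightarrow> y \<le> t4 \<Longrightarrow> z \<le> t5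
      \<Longrightarrow> t6 \<le> w + x \<Longrightarrow> y + z \<le> w" for t1 t2 t3 t4 t5 t6 x y z w :: real by linarith
  from this[OF e T1 T2 T3 T4 T5 T6] show ?thesis unfolding P_def .
qed

text \<open>The energy estimate bounds R h and its rate D h uniformly in \<epsilon>. In h = R h +
  \<epsilon> D h the second summand tends to 0, so the convergence of R h to h is a by-product of
  the damping.\<close>

lemma second_derivative_estimate:
  assumes eqn: "\<And>\<epsilon>. \<epsilon> > 0 \<Longrightarrow> averaged_equation l T \<epsilon> \<rho> \<mu> \<tau> r \<kappa> p h F"
    and p: "p \<in> borel_L2 (cylinder l T)" and h: "h \<in> borel_L2 (cylinder l T)" and F: "F \<in> borel_L2 (cylinder l T)"
    and Gh: "AE q in lborel. green_op l h q = in_time (primitive T) p q" and T: "0 < T"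
    and rho: "\<rho> \<in> borel_measurable borel" "\<And>x. \<rho>\<^sub>0 \<le> \<rho> x \<and> \<rho> x \<le> \<rho>\<^sub>1" "0 < \<rho>\<^sub>0"
    and mu: "\<mu> \<in> borel_measurable borel" "\<And>x. \<mu>\<^sub>0 \<le> \<mu> x \<and> \<mu> x \<le> \<mu>\<^sub>1" "0 \<le> \<mu>\<^sub>0"
    and tau: "\<tau> \<in> borel_measurable borel" "\<And>x. \<tau>\<^sub>0 \<le> \<tau> x \<and> \<tau> x \<le> \<tau>\<^sub>1" "0 \<le> \<tau>\<^sub>0"
    and rr: "r \<in> borel_measurable borel" "\<And>x. r\<^sub>0 \<le> r x \<and> r x \<le> r\<^sub>1" "0 < r\<^sub>0"
    and kap: "\<kappa> \<in> borel_measurable borel" "\<And>x. \<kappa>\<^sub>0 \<le> \<kappa> x \<and> \<kappa> x \<le> \<kappa>\<^sub>1" "0 < \<kappa>\<^sub>0"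
  shows "(LINT q|lborel. (h q)\<^sup>2) \<le> 4 * \<rho>\<^sub>0 / r\<^sub>0 * (exp (T / \<rho>\<^sub>0) - 1) * (LINT q|lborel. (F q)\<^sup>2)"
proof -
  define E where "E = exp (T / \<rho>\<^sub>0) - 1"
  define N where "N = (LINT q|lborel. (F q)\<^sup>2)"
  \<comment> \<open>\<open>a \<le> 1\<close> is required by the weight; \<open>a \<le> E\<close>
    bounds the factor \<open>a + E\<close> of the load by \<open>2 * E\<close>, which accounts for
    one factor 2 in the result.\<close>
  define a where "a = min 1 E"
  define H where "H = (LINT q|lborel. (h q)\<^sup>2)"
  have E: "E > 0" using T rho(3) by (simp add: E_def)
  have a: "0 < a" "a \<le> 1" using E by (auto simp: a_def)
  have N: "N \<ge> 0" by (simp add: N_def)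
  have aE: "0 \<le> a + E" "a + E \<le> 2 * E" using a E by (auto simp: a_def)
  have est: "H \<le> 4 * \<rho>\<^sub>0 / r\<^sub>0 * E * N + \<epsilon>\<^sup>2 * (2 * E * N / (\<kappa>\<^sub>0 * a))" if \<epsilon>: "\<epsilon> > 0" for \<epsilon>
  proof -
    note L = smoothed_L2[OF h \<epsilon>] and D = smoothed_rate_L2[OF h \<epsilon>]
    define A where "A = (LINT q|lborel. (smoothed T \<epsilon> h q)\<^sup>2)"
    define B where "B = (LINT q|lborel. (smoothed_rate T \<epsilon> h q)\<^sup>2)"
    have AB: "A \<ge> 0" "B \<ge> 0" by (simp_all add: A_def B_def)
    \<comment> \<open>Splitting the square of a sum costs the second factor 2, whence the 4 of the
      statement.\<close>
    have "H \<le> (LINT q|lborel. 2 * (smoothed T \<epsilon> h q)\<^sup>2 + 2 * \<epsilon>\<^sup>2 * (smoothed_rate T \<epsilon> h q)\<^sup>2)"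
      unfolding H_def
    proof (rule integral_mono)
      fix q
      have "h q = smoothed T \<epsilon> h q + \<epsilon> * smoothed_rate T \<epsilon> h q" using \<epsilon> by (simp add: smoothed_rate_def)
      then show "(h q)\<^sup>2 \<le> 2 * (smoothed T \<epsilon> h q)\<^sup>2 + 2 * \<epsilon>\<^sup>2 * (smoothed_rate T \<epsilon> h q)\<^sup>2"
        using square_add_le[of "smoothed T \<epsilon> h q" "\<epsilon> * smoothed_rate T \<epsilon> h q"] by (simp add: power_mult_distrib)
    qed (use borel_L2_square_integrable[OF h] borel_L2_square_integrable[OF L] borel_L2_square_integrable[OF D] in auto)
    also have "\<dots> = 2 * A + 2 * \<epsilon>\<^sup>2 * B"
      using borel_L2_square_integrable[OF L] borel_L2_square_integrable[OF D] by (simp add: A_def B_def)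
    finally have H: "H \<le> 2 * A + 2 * \<epsilon>\<^sup>2 * B" .
    have "r\<^sub>0 / \<rho>\<^sub>0 * A / 2 + \<kappa>\<^sub>0 * a * B \<le> (a + exp (T / \<rho>\<^sub>0) - 1) / 2 * N"
      unfolding A_def B_def N_def
      by (rule averaged_energy_estimate[OF eqn[OF \<epsilon>] p h F Gh \<epsilon> T rho mu tau rr kap a])
    also have "\<dots> = (a + E) * N / 2" by (simp add: E_def)
    also have "\<dots> \<le> E * N" using mult_right_mono[OF aE(2) N] by simp
    finally have e: "r\<^sub>0 / \<rho>\<^sub>0 * A / 2 + \<kappa>\<^sub>0 * a * B \<le> E * N" .
    have pos: "0 \<le> r\<^sub>0 / \<rho>\<^sub>0 * A / 2" "0 \<le> \<kappa>\<^sub>0 * a * B" using AB rr(3) rho(3) kap(3) a by simp_all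
    have "r\<^sub>0 / \<rho>\<^sub>0 * A / 2 \<le> E * N" using e pos by linarith
    then have A: "A \<le> 2 * (\<rho>\<^sub>0 / r\<^sub>0 * E * N)" using rr(3) rho(3) by (simp add: field_simps)
    have "\<kappa>\<^sub>0 * a * B \<le> E * N" using e pos by linarith
    then have "B \<le> E * N / (\<kappa>\<^sub>0 * a)" using kap(3) a by (simp add: pos_le_divide_eq mult.commute)
    then have B: "2 * \<epsilon>\<^sup>2 * B \<le> 2 * \<epsilon>\<^sup>2 * (E * N / (\<kappa>\<^sub>0 * a))" by (rule mult_left_mono) simp
    have eqs: "4 * \<rho>\<^sub>0 / r\<^sub>0 * E * N = 4 * (\<rho>\<^sub>0 / r\<^sub>0 * E * N)"
      "\<epsilon>\<^sup>2 * (2 * E * N / (\<kappa>\<^sub>0 * a)) = 2 * \<epsilon>\<^sup>2 * (E * N / (\<kappa>\<^sub>0 * a))" by simp_all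
    have "H \<le> 2 * A + b \<Longrightarrow> A \<le> 2 * z \<Longrightarrow> b \<le> c \<Longrightarrow> H \<le> 4 * z + c" for z b c by linarith
    from this[OF H A B] show ?thesis unfolding eqs .
  qed
  \<comment> \<open>\<open>a\<close> and \<open>\<kappa>\<^sub>0\<close> do not depend on
    \<epsilon>, so the bound for the rate enters with a factor tending to 0.\<close>
  have "((\<lambda>\<epsilon>. 4 * \<rho>\<^sub>0 / r\<^sub>0 * E * N + \<epsilon>\<^sup>2 * (2 * E * N / (\<kappa>\<^sub>0 * a))) \<longlongrightarrow> 4 * \<rho>\<^sub>0 / r\<^sub>0 * E * N + 0\<^sup>2 * (2 * E * N / (\<kappa>\<^sub>0 * a))) (at_right 0)"
    by (intro tendsto_intros)
  then have "H \<le> 4 * \<rho>\<^sub>0 / r\<^sub>0 * E * N + 0\<^sup>2 * (2 * E * N / (\<kappa>\<^sub>0 * a))"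
    by (rule tendsto_lowerbound)
       (use est in \<open>auto intro: eventually_mono[OF eventually_at_right_less]\<close>)
  then show ?thesis by (simp add: H_def E_def N_def)
qed

subsection \<open>Differences of weak solutions\<close>

lemma in_time_diff_AE:
  assumes k: "kernel_on {0<..<T} k" and f: "f \<in> borel_L2 (cylinder l T)" and g: "g \<in> borel_L2 (cylinder l T)"
  shows "AE q in lborel. in_time (kernel_op k) (\<lambda>q. f q - g q) q = in_time (kernel_op k) f q - in_time (kernel_op k) g q"
proof (rule AE_plane_eqI(1))
  have f': "f \<in> borel_L2 ({0<..<l} \<times> {0<..<T})" and g': "g \<in> borel_L2 ({0<..<l} \<times> {0<..<T})"
    using f g by (simp_all add: cylinder_def)
  note km = kernel_on_measurable[OF k]
  note [measurable] = borel_L2_measurable[OF f] borel_L2_measurable[OF g]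
    in_time_kernel_op_measurable[OF km borel_L2_measurable[OF f]] in_time_kernel_op_measurable[OF km borel_L2_measurable[OF g]]
  show "in_time (kernel_op k) (\<lambda>q. f q - g q) \<in> borel_measurable borel"
    by (rule in_time_kernel_op_measurable[OF km]) simp
  show "(\<lambda>q. in_time (kernel_op k) f q - in_time (kernel_op k) g q) \<in> borel_measurable borel" by simp
  show "AE x in lborel. AE t in lborel. in_time (kernel_op k) (\<lambda>q. f q - g q) (x, t)
      = in_time (kernel_op k) f (x, t) - in_time (kernel_op k) g (x, t)"
    using borel_L2_sections(1)[OF f'] borel_L2_sections(1)[OF g']
  proof eventually_elim
    case (elim x)
    have "integrable lborel (\<lambda>t. f (x, t))" "integrable lborel (\<lambda>t. g (x, t))"
      using borel_L2_integrable[OF elim(1)] borel_L2_integrable[OF elim(2)] by simp_all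
    from kernel_op_linear(2)[OF k this] show ?case by (simp add: in_time_apply)
  qed
qed

text \<open>Differences are formed at this stage because for each fixed \<eta> the averaged equation
  is a linear identity between convergent integrals in p, h and F.\<close>

lemma averaged_equation_diff:
  assumes 1: "averaged_equation l T \<epsilon> \<rho> \<mu> \<tau> r \<kappa> p\<^sub>1 h\<^sub>1 F\<^sub>1" and 2: "averaged_equation l T \<epsilon> \<rho> \<mu> \<tau> r \<kappa> p\<^sub>2 h\<^sub>2 F\<^sub>2"
    and \<epsilon>: "\<epsilon> > 0"
    and p: "p\<^sub>1 \<in> borel_L2 (cylinder l T)" "p\<^sub>2 \<in> borel_L2 (cylinder l T)"
    and h: "h\<^sub>1 \<in> borel_L2 (cylinder l T)" "h\<^sub>2 \<in> borel_L2 (cylinder l T)"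
    and F: "F\<^sub>1 \<in> borel_L2 (cylinder l T)" "F\<^sub>2 \<in> borel_L2 (cylinder l T)"
    and c: "\<rho> \<in> borel_measurable borel" "\<And>x. \<bar>\<rho> x\<bar> \<le> B1" "\<mu> \<in> borel_measurable borel" "\<And>x. \<bar>\<mu> x\<bar> \<le> B2"
      "\<tau> \<in> borel_measurable borel" "\<And>x. \<bar>\<tau> x\<bar> \<le> B3" "r \<in> borel_measurable borel" "\<And>x. \<bar>r x\<bar> \<le> B4"
      "\<kappa> \<in> borel_measurable borel" "\<And>x. \<bar>\<kappa> x\<bar> \<le> B5"
  shows "averaged_equation l T \<epsilon> \<rho> \<mu> \<tau> r \<kappa> (\<lambda>q. p\<^sub>1 q - p\<^sub>2 q) (\<lambda>q. h\<^sub>1 q - h\<^sub>2 q) (\<lambda>q. F\<^sub>1 q - F\<^sub>2 q)"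
  unfolding averaged_equation_def
proof
  fix \<eta> assume \<eta>: "\<eta> \<in> borel_L2 (cylinder l T)"
  note k = kernel_exp[OF \<epsilon>, of T]
  have split: "(LINT q|lborel. c (fst q) * Z q * g q) = (LINT q|lborel. c (fst q) * Z\<^sub>1 q * g q) - (LINT q|lborel. c (fst q) * Z\<^sub>2 q * g q)"
    if ae: "AE q in lborel. Z q = Z\<^sub>1 q - Z\<^sub>2 q" and c: "c \<in> borel_measurable borel" "\<And>x. \<bar>c x\<bar> \<le> B"
      and Z: "Z \<in> borel_L2 (cylinder l T)" "Z\<^sub>1 \<in> borel_L2 (cylinder l T)" "Z\<^sub>2 \<in> borel_L2 (cylinder l T)" "g \<in> borel_L2 (cylinder l T)"
    for Z Z\<^sub>1 Z\<^sub>2 g c B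
  proof -
    have "(LINT q|lborel. c (fst q) * Z q * g q) = (LINT q|lborel. c (fst q) * Z\<^sub>1 q * g q - c (fst q) * Z\<^sub>2 q * g q)"
    proof (rule integral_cong_AE)
      show "AE q in lborel. c (fst q) * Z q * g q = c (fst q) * Z\<^sub>1 q * g q - c (fst q) * Z\<^sub>2 q * g q"
        using ae by eventually_elim (simp add: left_diff_distrib right_diff_distrib)
    qed (use borel_measurable_fst_comp[OF c(1)] Z[THEN borel_L2_measurable] in simp_all)
    also have "\<dots> = (LINT q|lborel. c (fst q) * Z\<^sub>1 q * g q) - (LINT q|lborel. c (fst q) * Z\<^sub>2 q * g q)"
      using borel_L2_mult_integrable[OF coefficient_mult_L2[OF c Z(2)] Z(4)]
        borel_L2_mult_integrable[OF coefficient_mult_L2[OF c Z(3)] Z(4)] by simp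
    finally show ?thesis .
  qed
  have R: "AE q in lborel. smoothed T \<epsilon> (\<lambda>q. f q - g q) q = smoothed T \<epsilon> f q - smoothed T \<epsilon> g q"
    and D: "AE q in lborel. smoothed_rate T \<epsilon> (\<lambda>q. f q - g q) q = smoothed_rate T \<epsilon> f q - smoothed_rate T \<epsilon> g q"
    if "f \<in> borel_L2 (cylinder l T)" "g \<in> borel_L2 (cylinder l T)" for f g
  proof -
    show R: "AE q in lborel. smoothed T \<epsilon> (\<lambda>q. f q - g q) q = smoothed T \<epsilon> f q - smoothed T \<epsilon> g q"
      by (rule in_time_diff_AE[OF k that])
    then show "AE q in lborel. smoothed_rate T \<epsilon> (\<lambda>q. f q - g q) q = smoothed_rate T \<epsilon> f q - smoothed_rate T \<epsilon> g q"
      by eventually_elim (simp add: smoothed_rate_def diff_divide_distrib)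
  qed
  have G': "AE q in lborel. green_deriv_op l (\<lambda>q. h\<^sub>1 q - h\<^sub>2 q) q = green_deriv_op l h\<^sub>1 q - green_deriv_op l h\<^sub>2 q"
    using in_space_diff_AE[OF kernel_green_deriv h, of 1] by simp
  note pd = borel_L2_diff[OF p] and hd = borel_L2_diff[OF h] and Fd = borel_L2_diff[OF F]
  note G'L = green_deriv_op_L2[OF h(1)] green_deriv_op_L2[OF h(2)]
  have "AE q in lborel. smoothed T \<epsilon> (green_deriv_op l (\<lambda>q. h\<^sub>1 q - h\<^sub>2 q)) q = smoothed T \<epsilon> (\<lambda>q. green_deriv_op l h\<^sub>1 q - green_deriv_op l h\<^sub>2 q) q"
    by (rule in_time_cong_AE[OF k borel_L2_measurable[OF green_deriv_op_L2[OF hd]] borel_L2_measurable[OF borel_L2_diff[OF G'L]] G'])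
  with R[OF G'L] have RG': "AE q in lborel. smoothed T \<epsilon> (green_deriv_op l (\<lambda>q. h\<^sub>1 q - h\<^sub>2 q)) q
      = smoothed T \<epsilon> (green_deriv_op l h\<^sub>1) q - smoothed T \<epsilon> (green_deriv_op l h\<^sub>2) q" by eventually_elim simp
  note g = green_op_L2[OF \<eta>] and g' = green_deriv_op_L2[OF \<eta>]
  note s1 = split[OF D[OF p] c(1,2) smoothed_rate_L2[OF pd \<epsilon>] smoothed_rate_L2[OF p(1) \<epsilon>] smoothed_rate_L2[OF p(2) \<epsilon>] g]
  note s2 = split[OF R[OF p] c(3,4) smoothed_L2[OF pd \<epsilon>] smoothed_L2[OF p(1) \<epsilon>] smoothed_L2[OF p(2) \<epsilon>] g]
  note s3 = split[OF RG' c(5,6) smoothed_L2[OF green_deriv_op_L2[OF hd] \<epsilon>] smoothed_L2[OF G'L(1) \<epsilon>] smoothed_L2[OF G'L(2) \<epsilon>] g']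
  note s4 = split[OF R[OF h] c(7,8) smoothed_L2[OF hd \<epsilon>] smoothed_L2[OF h(1) \<epsilon>] smoothed_L2[OF h(2) \<epsilon>] \<eta>]
  note s5 = split[OF D[OF h] c(9,10) smoothed_rate_L2[OF hd \<epsilon>] smoothed_rate_L2[OF h(1) \<epsilon>] smoothed_rate_L2[OF h(2) \<epsilon>] \<eta>]
  have s6: "(LINT q|lborel. smoothed T \<epsilon> (\<lambda>q. F\<^sub>1 q - F\<^sub>2 q) q * green_op l \<eta> q)
      = (LINT q|lborel. smoothed T \<epsilon> F\<^sub>1 q * green_op l \<eta> q) - (LINT q|lborel. smoothed T \<epsilon> F\<^sub>2 q * green_op l \<eta> q)"
    using split[OF R[OF F] _ _ smoothed_L2[OF Fd \<epsilon>] smoothed_L2[OF F(1) \<epsilon>] smoothed_L2[OF F(2) \<epsilon>] g, of "\<lambda>_. 1" 1] by simp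
  show "(LINT q|lborel. \<rho> (fst q) * smoothed_rate T \<epsilon> (\<lambda>q. p\<^sub>1 q - p\<^sub>2 q) q * green_op l \<eta> q)
    + (LINT q|lborel. \<mu> (fst q) * smoothed T \<epsilon> (\<lambda>q. p\<^sub>1 q - p\<^sub>2 q) q * green_op l \<eta> q)
    + (LINT q|lborel. \<tau> (fst q) * smoothed T \<epsilon> (green_deriv_op l (\<lambda>q. h\<^sub>1 q - h\<^sub>2 q)) q * green_deriv_op l \<eta> q)
    + (LINT q|lborel. r (fst q) * smoothed T \<epsilon> (\<lambda>q. h\<^sub>1 q - h\<^sub>2 q) q * \<eta> q)
    + (LINT q|lborel. \<kappa> (fst q) * smoothed_rate T \<epsilon> (\<lambda>q. h\<^sub>1 q - h\<^sub>2 q) q * \<eta> q)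
    = (LINT q|lborel. smoothed T \<epsilon> (\<lambda>q. F\<^sub>1 q - F\<^sub>2 q) q * green_op l \<eta> q)"
    unfolding s1 s2 s3 s4 s5 s6
    using 1[unfolded averaged_equation_def, rule_format, OF \<eta>] 2[unfolded averaged_equation_def, rule_format, OF \<eta>]
    by linarith
qed

text \<open>Clamping a Borel representative between the bounds alters it on a null set only and
  makes them hold everywhere. That the bounds are in the right order follows since (0, l) is not a
  null set.\<close>

lemma bounded_coefficient_representative:
  fixes c :: "real \<Rightarrow> real"
  assumes m: "L_infinity {0<..<l} c" and ae: "AE x in lebesgue_on {0<..<l}. lo \<le> c x \<and> c x \<le> hi" and l: "0 < l"
  obtains c' where "c' \<in> borel_measurable borel" "\<And>x. lo \<le> c' x \<and> c' x \<le> hi"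
    "AE x in lebesgue_on {0<..<l}. c x = c' x"
proof -
  have S: "{0<..<l} \<in> sets borel" by simp
  have cm: "c \<in> borel_measurable (lebesgue_on {0<..<l})" using m by (simp add: L_infinity_def)
  obtain d where d: "d \<in> borel_measurable borel" "\<And>x. x \<notin> {0<..<l} \<Longrightarrow> d x = 0" "AE x in lebesgue_on {0<..<l}. c x = d x"
    by (rule borel_representative_ex[OF cm S]) iprover
  have "lo \<le> hi"
  proof (rule ccontr)
    assume "\<not> lo \<le> hi"
    have "AE x in lborel. x \<in> {0<..<l} \<longrightarrow> lo \<le> c x \<and> c x \<le> hi" using ae unfolding AE_lebesgue_on_iff[OF S] .
    then have "AE x in lborel. x \<notin> {0<..<l}" by eventually_elim (use \<open>\<not> lo \<le> hi\<close> in auto)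
    then have "{0<..<l} \<in> null_sets lborel" by (subst AE_iff_null_sets) auto
    then have "emeasure lborel {0<..<l} = 0" by (rule null_setsD1)
    then show False using l by simp
  qed
  show ?thesis
  proof (rule that[of "\<lambda>x. max lo (min hi (d x))"])
    show "(\<lambda>x. max lo (min hi (d x))) \<in> borel_measurable borel" using d(1) by simp
    show "AE x in lebesgue_on {0<..<l}. c x = max lo (min hi (d x))"
      using ae d(3) by eventually_elim auto
  qed (use \<open>lo \<le> hi\<close> in auto)
qed

section \<open>End slopes as weighted integrals of the second derivative\<close>

text \<open>The limit of the x-derivative of the Green kernel at x = 0, cut to the open interval;
  the right weight is its limit at x = l.\<close>

definition left_slope_weight :: "real \<Rightarrow> real \<Rightarrow> real" where
  "left_slope_weight l y = indicator {0<..<l} y * (- ((l - y) / l))"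

definition right_slope_weight :: "real \<Rightarrow> real \<Rightarrow> real" where
  "right_slope_weight l y = indicator {0<..<l} y * (y / l)"

lemma slope_weights_borel_L2:
  "left_slope_weight l \<in> borel_L2 {0<..<l}" "right_slope_weight l \<in> borel_L2 {0<..<l}"
proof -
  have "left_slope_weight l \<in> borel_measurable borel" "right_slope_weight l \<in> borel_measurable borel"
    unfolding left_slope_weight_def[abs_def] right_slope_weight_def[abs_def] by measurable
  moreover have "\<bar>left_slope_weight l y\<bar> \<le> 1" "\<bar>right_slope_weight l y\<bar> \<le> 1" for y
  proof -
    have "\<bar>(l - y) / l\<bar> \<le> 1" if "y \<in> {0<..<l}" using green_slope_bounds[of y l] that by auto
    then show "\<bar>left_slope_weight l y\<bar> \<le> 1"
      unfolding left_slope_weight_def abs_mult abs_minus_cancel by (cases "y \<in> {0<..<l}") simp_all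
    show "\<bar>right_slope_weight l y\<bar> \<le> 1" by (auto simp: right_slope_weight_def indicator_def)
  qed
  ultimately show "left_slope_weight l \<in> borel_L2 {0<..<l}" "right_slope_weight l \<in> borel_L2 {0<..<l}"
    by (auto intro!: borel_L2_bounded[of _ 1] simp: left_slope_weight_def right_slope_weight_def)
qed

lemma integral_slope_weights_square:
  assumes l: "0 < l"
  shows "(LINT y|lborel. (left_slope_weight l y)\<^sup>2) = l / 3" "(LINT y|lborel. (right_slope_weight l y)\<^sup>2) = l / 3"
proof -
  have "(LINT y|lborel. (left_slope_weight l y)\<^sup>2) = (LINT y|lborel. indicator {0..l} y *\<^sub>R ((l - y) / l)\<^sup>2)"
  proof (rule integral_cong_AE)
    show "AE y in lborel. (left_slope_weight l y)\<^sup>2 = indicator {0..l} y *\<^sub>R ((l - y) / l)\<^sup>2"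
      using AE_lborel_singleton[of 0] AE_lborel_singleton[of l]
      by eventually_elim (auto simp: left_slope_weight_def indicator_def power_divide power2_commute)
  qed (use borel_L2_measurable[OF slope_weights_borel_L2(1)[of l]] in auto)
  also have "\<dots> = - (l / 3) * ((l - l) / l) ^ 3 - - (l / 3) * ((l - 0) / l) ^ 3"
  proof (rule integral_FTC_atLeastAtMost)
    fix y
    have "- (l / 3) * (3 * (z * (- 1 / l))) = z" for z using l by simp
    moreover have "((\<lambda>y. - (l / 3) * ((l - y) / l) ^ 3) has_real_derivative - (l / 3) * (3 * (((l - y) / l)\<^sup>2 * (- 1 / l)))) (at y)"
      by (auto intro!: derivative_eq_intros)
    ultimately have "((\<lambda>y. - (l / 3) * ((l - y) / l) ^ 3) has_real_derivative ((l - y) / l)\<^sup>2) (at y)" by metis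
    then show "((\<lambda>y. - (l / 3) * ((l - y) / l) ^ 3) has_vector_derivative ((l - y) / l)\<^sup>2) (at y within {0..l})"
      by (simp add: has_field_derivative_at_within flip: has_real_derivative_iff_has_vector_derivative)
  qed (use l in \<open>auto intro!: continuous_intros\<close>)
  finally show "(LINT y|lborel. (left_slope_weight l y)\<^sup>2) = l / 3" using l by simp
  have "(LINT y|lborel. (right_slope_weight l y)\<^sup>2) = (LINT y|lborel. indicator {0..l} y *\<^sub>R (y / l)\<^sup>2)"
  proof (rule integral_cong_AE)
    show "AE y in lborel. (right_slope_weight l y)\<^sup>2 = indicator {0..l} y *\<^sub>R (y / l)\<^sup>2"
      using AE_lborel_singleton[of 0] AE_lborel_singleton[of l]
      by eventually_elim (auto simp: right_slope_weight_def indicator_def)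
  qed (use borel_L2_measurable[OF slope_weights_borel_L2(2)[of l]] in auto)
  also have "\<dots> = l / 3 * (l / l) ^ 3 - l / 3 * (0 / l) ^ 3"
  proof (rule integral_FTC_atLeastAtMost)
    fix y
    have "l / 3 * (3 * (z * (1 / l))) = z" for z using l by simp
    moreover have "((\<lambda>y. l / 3 * (y / l) ^ 3) has_real_derivative l / 3 * (3 * ((y / l)\<^sup>2 * (1 / l)))) (at y)"
      by (auto intro!: derivative_eq_intros)
    ultimately have "((\<lambda>y. l / 3 * (y / l) ^ 3) has_real_derivative (y / l)\<^sup>2) (at y)" by metis
    then show "((\<lambda>y. l / 3 * (y / l) ^ 3) has_vector_derivative (y / l)\<^sup>2) (at y within {0..l})"
      by (simp add: has_field_derivative_at_within flip: has_real_derivative_iff_has_vector_derivative)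
  qed (use l in \<open>auto intro!: continuous_intros\<close>)
  finally show "(LINT y|lborel. (right_slope_weight l y)\<^sup>2) = l / 3" using l by simp
qed

lemma V2_slope_weights:
  assumes V: "V2 l v v1 v2" and l: "0 < l"
    and h: "h \<in> borel_L2 {0<..<l}" "AE x in lebesgue_on {0<..<l}. v2 x = h x"
  shows "continuous_representative 0 l (L2_weak_derivative 0 l v) 0 = (LINT y|lborel. left_slope_weight l y * h y)"
    and "continuous_representative 0 l (L2_weak_derivative 0 l v) l = (LINT y|lborel. right_slope_weight l y * h y)"
proof -
  have hi: "integrable lborel h" using borel_L2_integrable[OF h(1)] by simp
  have left: "- ((l - y) / l * h y) = left_slope_weight l y * h y" for y
  proof (cases "y \<in> {0<..<l}")
    case True
    then show ?thesis by (simp only: left_slope_weight_def indicator_simps mult_1 mult_minus_left)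
  qed (simp add: borel_L2_outside[OF h(1)])
  have right: "h y + left_slope_weight l y * h y = right_slope_weight l y * h y" for y
  proof (cases "y \<in> {0<..<l}")
    case True
    then have "left_slope_weight l y = right_slope_weight l y - 1"
      using l by (simp add: left_slope_weight_def right_slope_weight_def diff_divide_distrib)
    then show ?thesis by (simp add: left_diff_distrib)
  qed (simp add: borel_L2_outside[OF h(1)])
  have 1: "- (LINT y|lborel. (l - y) / l * h y) = (LINT y|lborel. left_slope_weight l y * h y)"
    by (simp flip: left)
  then show "continuous_representative 0 l (L2_weak_derivative 0 l v) 0 = (LINT y|lborel. left_slope_weight l y * h y)"
    using V2_boundary_slope(1)[OF V l h] by simp
  have "(LINT y|lborel. right_slope_weight l y * h y) = (LINT y|lborel. h y) + (LINT y|lborel. left_slope_weight l y * h y)"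
    using hi borel_L2_mult_integrable[OF slope_weights_borel_L2(1) h(1)] by (simp flip: right)
  then show "continuous_representative 0 l (L2_weak_derivative 0 l v) l = (LINT y|lborel. right_slope_weight l y * h y)"
    using V2_boundary_slope(2)[OF V l h] 1 by simp
qed

section \<open>From weak solutions to Borel representatives\<close>

text \<open>Collects what the estimates use of a weak solution: representatives of u_t and u_xx, the
  kinematic identity, the averaged equations and the slopes.\<close>

lemma weak_solution_representatives:
  assumes sol: "weak_solution l T \<rho>\<^sub>A \<mu> T\<^sub>r r \<kappa> F u" and l: "0 < l" and T: "0 < T"
    and F': "F' \<in> borel_L2 (cylinder l T)" "AE q in lebesgue_on (cylinder l T). F q = F' q"
    and rho: "\<rho>' \<in> borel_measurable borel" "\<And>x. \<bar>\<rho>' x\<bar> \<le> B1" "AE x in lebesgue_on {0<..<l}. \<rho>\<^sub>A x = \<rho>' x"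
    and mu: "\<mu>' \<in> borel_measurable borel" "\<And>x. \<bar>\<mu>' x\<bar> \<le> B2" "AE x in lebesgue_on {0<..<l}. \<mu> x = \<mu>' x"
    and tau: "\<tau>' \<in> borel_measurable borel" "\<And>x. \<bar>\<tau>' x\<bar> \<le> B3" "AE x in lebesgue_on {0<..<l}. T\<^sub>r x = \<tau>' x"
    and rr: "r' \<in> borel_measurable borel" "\<And>x. \<bar>r' x\<bar> \<le> B4" "AE x in lebesgue_on {0<..<l}. r x = r' x"
    and kap: "\<kappa>' \<in> borel_measurable borel" "\<And>x. \<bar>\<kappa>' x\<bar> \<le> B5" "AE x in lebesgue_on {0<..<l}. \<kappa> x = \<kappa>' x"
  obtains p h where "p \<in> borel_L2 (cylinder l T)" "h \<in> borel_L2 (cylinder l T)"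
    "AE q in lborel. green_op l h q = in_time (primitive T) p q"
    "\<And>\<epsilon>. \<epsilon> > 0 \<Longrightarrow> averaged_equation l T \<epsilon> \<rho>' \<mu>' \<tau>' r' \<kappa>' p h F'"
    "AE t in lebesgue_on {0<..<T}. boundary_slope l u 0 t = (LINT y|lborel. left_slope_weight l y * h (y, t))"
    "AE t in lebesgue_on {0<..<T}. boundary_slope l u l t = (LINT y|lborel. right_slope_weight l y * h (y, t))"
proof -
  obtain u\<^sub>x u\<^sub>x\<^sub>x u\<^sub>t where V: "L2_V2 l T u u\<^sub>x u\<^sub>x\<^sub>x" and td: "has_time_derivative l T u u\<^sub>t" and van: "vanishes_at_time l T u 0"
    and eq: "\<And>v v\<^sub>x v\<^sub>x\<^sub>x v\<^sub>t v\<^sub>x\<^sub>t v\<^sub>x\<^sub>x\<^sub>t.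
        L2_V2 l T v v\<^sub>x v\<^sub>x\<^sub>x \<and> has_time_derivative l T v v\<^sub>t \<and> L2_V2 l T v\<^sub>t v\<^sub>x\<^sub>t v\<^sub>x\<^sub>x\<^sub>t \<and>
        vanishes_at_time l T v T \<longrightarrow>
        (LINT (x, t)|lebesgue_on (cylinder l T).
            - \<rho>\<^sub>A x * u\<^sub>t (x, t) * v\<^sub>t (x, t) + \<mu> x * u\<^sub>t (x, t) * v (x, t)
            + T\<^sub>r x * u\<^sub>x (x, t) * v\<^sub>x (x, t) + r x * u\<^sub>x\<^sub>x (x, t) * v\<^sub>x\<^sub>x (x, t)
            - \<kappa> x * u\<^sub>x\<^sub>x (x, t) * v\<^sub>x\<^sub>x\<^sub>t (x, t))
        = (LINT (x, t)|lebesgue_on (cylinder l T). F (x, t) * v (x, t))"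
    using sol unfolding weak_solution_def by blast
  have L: "L2 (cylinder l T) u" "L2 (cylinder l T) u\<^sub>x" "L2 (cylinder l T) u\<^sub>x\<^sub>x" "L2 (cylinder l T) u\<^sub>t"
    using V td by (auto simp: L2_V2_def has_time_derivative_def)
  obtain u' where u': "u' \<in> borel_L2 (cylinder l T)" "AE q in lebesgue_on (cylinder l T). u q = u' q"
    by (rule L2_obtain_borel[OF L(1) cylinder_sets])
  obtain ux' where ux': "ux' \<in> borel_L2 (cylinder l T)" "AE q in lebesgue_on (cylinder l T). u\<^sub>x q = ux' q"
    by (rule L2_obtain_borel[OF L(2) cylinder_sets])
  obtain h where h: "h \<in> borel_L2 (cylinder l T)" "AE q in lebesgue_on (cylinder l T). u\<^sub>x\<^sub>x q = h q"
    by (rule L2_obtain_borel[OF L(3) cylinder_sets])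
  obtain p where p: "p \<in> borel_L2 (cylinder l T)" "AE q in lebesgue_on (cylinder l T). u\<^sub>t q = p q"
    by (rule L2_obtain_borel[OF L(4) cylinder_sets])
  have h': "h \<in> borel_L2 ({0<..<l} \<times> {0<..<T})" using h(1) by (simp add: cylinder_def)
  have sec: "AE t in lborel. t \<in> {0<..<T} \<longrightarrow> (AE x in lebesgue_on {0<..<l}. f (x, t) = g (x, t))"
    if ae: "AE q in lebesgue_on (cylinder l T). f q = g q" for f g :: "real \<times> real \<Rightarrow> real"
  proof -
    have "AE t in lborel. AE x in lborel. x \<in> {0<..<l} \<longrightarrow> t \<in> {0<..<T} \<longrightarrow> f (x, t) = g (x, t)"
      by (rule AE_lebesgue_on_sections(2)[OF ae[unfolded cylinder_def]]) auto
    then show ?thesis by eventually_elim (auto simp: AE_lebesgue_on_iff)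
  qed
  have Vt: "AE t in lborel. t \<in> {0<..<T} \<longrightarrow> V2 l (\<lambda>x. u (x, t)) (\<lambda>x. u\<^sub>x (x, t)) (\<lambda>x. u\<^sub>x\<^sub>x (x, t))"
    using V by (simp add: L2_V2_def AE_lebesgue_on_iff)
  have main: "AE t in lborel. t \<in> {0<..<T} \<longrightarrow>
      (AE x in lebesgue_on {0<..<l}. u (x, t) = green_op l h (x, t)) \<and>
      (AE x in lebesgue_on {0<..<l}. u\<^sub>x (x, t) = green_deriv_op l h (x, t)) \<and>
      boundary_slope l u 0 t = (LINT y|lborel. left_slope_weight l y * h (y, t)) \<and>
      boundary_slope l u l t = (LINT y|lborel. right_slope_weight l y * h (y, t))"
    using Vt sec[OF h(2)] borel_L2_sections(2)[OF h']
  proof eventually_elim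
    case (elim t)
    show ?case
    proof
      assume t: "t \<in> {0<..<T}"
      note a = V2_imp_green[OF _ l elim(3)] V2_slope_weights[OF _ l elim(3)]
      show "(AE x in lebesgue_on {0<..<l}. u (x, t) = green_op l h (x, t)) \<and>
      (AE x in lebesgue_on {0<..<l}. u\<^sub>x (x, t) = green_deriv_op l h (x, t)) \<and>
      boundary_slope l u 0 t = (LINT y|lborel. left_slope_weight l y * h (y, t)) \<and>
      boundary_slope l u l t = (LINT y|lborel. right_slope_weight l y * h (y, t))"
        using a[OF elim(1)[rule_format, OF t] elim(2)[rule_format, OF t]]
        by (simp add: in_space_apply boundary_slope_def)
    qed
  qed
  \<comment> \<open>The facts about V2 hold on almost every time slice; equality of Borel functions
    on these slices gives equality almost everywhere in the plane.\<close>
  have plane: "AE q in lborel. f' q = g q"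
    if f: "AE t in lborel. t \<in> {0<..<T} \<longrightarrow> (AE x in lebesgue_on {0<..<l}. f (x, t) = g (x, t))"
      and f': "f' \<in> borel_L2 (cylinder l T)" "AE q in lebesgue_on (cylinder l T). f q = f' q"
      and g: "g \<in> borel_L2 (cylinder l T)" for f f' g :: "real \<times> real \<Rightarrow> real"
  proof (rule AE_plane_eqI(2)[OF borel_L2_measurable[OF f'(1)] borel_L2_measurable[OF g]])
    show "AE t in lborel. AE x in lborel. f' (x, t) = g (x, t)"
      using f sec[OF f'(2)]
    proof eventually_elim
      case (elim t)
      show ?case
      proof (cases "t \<in> {0<..<T}")
        case True
        have "AE x in lebesgue_on {0<..<l}. f (x, t) = g (x, t)" "AE x in lebesgue_on {0<..<l}. f (x, t) = f' (x, t)"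
          using elim True by auto
        then have "AE x in lebesgue_on {0<..<l}. f' (x, t) = g (x, t)" by eventually_elim simp
        then have "AE x in lborel. x \<in> {0<..<l} \<longrightarrow> f' (x, t) = g (x, t)" by (simp add: AE_lebesgue_on_iff)
        then show ?thesis
        proof eventually_elim
          case (elim x)
          then show ?case
            using borel_L2_outside[OF f'(1), of "(x, t)"] borel_L2_outside[OF g, of "(x, t)"]
            by (cases "x \<in> {0<..<l}") (auto simp: cylinder_def)
        qed
      next
        case False
        then show ?thesis using borel_L2_outside[OF f'(1)] borel_L2_outside[OF g] by (auto simp: cylinder_def)
      qed
    qed
  qed
  \<comment> \<open>u is expressed twice, in space as G h and in time as the primitive of p;
    equating the two gives the kinematic identity.\<close>
  have "AE q in lborel. u' q = green_op l h q"
    by (rule plane[OF _ u' green_op_L2[OF h(1)]]) (use main in \<open>auto elim: eventually_mono\<close>)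
  with time_derivative_vanishing_at_0[OF td van T u' p]
  have Gh: "AE q in lborel. green_op l h q = in_time (primitive T) p q" by eventually_elim simp
  have "AE q in lborel. ux' q = green_deriv_op l h q"
    by (rule plane[OF _ ux' green_deriv_op_L2[OF h(1)]]) (use main in \<open>auto elim: eventually_mono\<close>)
  then have "AE q in lebesgue_on (cylinder l T). ux' q = green_deriv_op l h q"
    unfolding AE_lebesgue_on_iff[OF cylinder_sets] by eventually_elim simp
  with ux'(2) have ux: "AE q in lebesgue_on (cylinder l T). u\<^sub>x q = green_deriv_op l h q" by eventually_elim simp
  show ?thesis
  proof (rule that[OF p(1) h(1) Gh])
    show "averaged_equation l T \<epsilon> \<rho>' \<mu>' \<tau>' r' \<kappa>' p h F'" if "\<epsilon> > 0" for \<epsilon>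
      by (rule weak_solution_imp_averaged_equation[OF eq l T that p h ux F' rho mu tau rr kap])
    show "AE t in lebesgue_on {0<..<T}. boundary_slope l u 0 t = (LINT y|lborel. left_slope_weight l y * h (y, t))"
      "AE t in lebesgue_on {0<..<T}. boundary_slope l u l t = (LINT y|lborel. right_slope_weight l y * h (y, t))"
      using main by (auto simp: AE_lebesgue_on_iff elim: eventually_mono)
  qed
qed

lemma integral_fst_borel_L2:
  fixes g :: "real \<times> real \<Rightarrow> real"
  assumes g: "g \<in> borel_L2 (X \<times> Y)" and \<omega>: "\<omega> \<in> borel_L2 Z"
  shows "(\<lambda>t. LINT y|lborel. \<omega> y * g (y, t)) \<in> borel_L2 Y"
    and "(LINT t|lborel. (LINT y|lborel. \<omega> y * g (y, t))\<^sup>2) \<le> (LINT y|lborel. (\<omega> y)\<^sup>2) * (LINT q|lborel. (g q)\<^sup>2)"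
proof -
  note s = borel_L2_swap[OF g]
  have "(LINT q|lborel. (g (snd q, fst q))\<^sup>2) = (LINT q|lborel. (g q)\<^sup>2)"
    using integrable_plane(5)[OF borel_L2_square_integrable[OF s]] integrable_plane(6)[OF borel_L2_square_integrable[OF g]]
    by simp
  with integral_snd_borel_L2[OF s \<omega>]
  show "(\<lambda>t. LINT y|lborel. \<omega> y * g (y, t)) \<in> borel_L2 Y"
    "(LINT t|lborel. (LINT y|lborel. \<omega> y * g (y, t))\<^sup>2) \<le> (LINT y|lborel. (\<omega> y)\<^sup>2) * (LINT q|lborel. (g q)\<^sup>2)"
    by simp_all
qed

text \<open>A slope is linear in h, so its difference is controlled by the squared norm of the
  weight. With the weight arbitrary, both ends are covered.\<close>

lemma slope_difference_estimate:
  assumes h\<^sub>1: "h\<^sub>1 \<in> borel_L2 (cylinder l T)" and h\<^sub>2: "h\<^sub>2 \<in> borel_L2 (cylinder l T)"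
    and \<omega>: "\<omega> \<in> borel_L2 {0<..<l}"
    and s\<^sub>1: "AE t in lebesgue_on {0<..<T}. s\<^sub>1 t = (LINT y|lborel. \<omega> y * h\<^sub>1 (y, t))"
    and s\<^sub>2: "AE t in lebesgue_on {0<..<T}. s\<^sub>2 t = (LINT y|lborel. \<omega> y * h\<^sub>2 (y, t))"
  shows "L2 {0<..<T} s\<^sub>1" "L2 {0<..<T} s\<^sub>2"
    "L2_norm {0<..<T} (\<lambda>t. s\<^sub>1 t - s\<^sub>2 t) \<le> sqrt ((LINT y|lborel. (\<omega> y)\<^sup>2) * (LINT q|lborel. (h\<^sub>1 q - h\<^sub>2 q)\<^sup>2))"
proof -
  have h1: "h\<^sub>1 \<in> borel_L2 ({0<..<l} \<times> {0<..<T})" and h2: "h\<^sub>2 \<in> borel_L2 ({0<..<l} \<times> {0<..<T})"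
    using h\<^sub>1 h\<^sub>2 by (simp_all add: cylinder_def)
  show "L2 {0<..<T} s\<^sub>1" by (rule borel_L2_imp_L2(1)[OF integral_fst_borel_L2(1)[OF h1 \<omega>] _ s\<^sub>1]) simp
  show "L2 {0<..<T} s\<^sub>2" by (rule borel_L2_imp_L2(1)[OF integral_fst_borel_L2(1)[OF h2 \<omega>] _ s\<^sub>2]) simp
  note d = integral_fst_borel_L2[OF borel_L2_diff[OF h1 h2] \<omega>]
  have "AE t in lborel. (LINT y|lborel. \<omega> y * h\<^sub>1 (y, t)) - (LINT y|lborel. \<omega> y * h\<^sub>2 (y, t))
      = (LINT y|lborel. \<omega> y * (h\<^sub>1 (y, t) - h\<^sub>2 (y, t)))"
    using borel_L2_sections(2)[OF h1] borel_L2_sections(2)[OF h2]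
  proof eventually_elim
    case (elim t)
    show ?case unfolding right_diff_distrib
      using borel_L2_mult_integrable[OF \<omega> elim(1)] borel_L2_mult_integrable[OF \<omega> elim(2)] by simp
  qed
  then have "AE t in lebesgue_on {0<..<T}. (LINT y|lborel. \<omega> y * h\<^sub>1 (y, t)) - (LINT y|lborel. \<omega> y * h\<^sub>2 (y, t))
      = (LINT y|lborel. \<omega> y * (h\<^sub>1 (y, t) - h\<^sub>2 (y, t)))"
    by (auto simp: AE_lebesgue_on_iff elim: eventually_mono)
  with s\<^sub>1 s\<^sub>2 have "AE t in lebesgue_on {0<..<T}. s\<^sub>1 t - s\<^sub>2 t = (LINT y|lborel. \<omega> y * (h\<^sub>1 (y, t) - h\<^sub>2 (y, t)))"
    by eventually_elim simp
  from borel_L2_imp_L2(2)[OF d(1) _ this] d(2)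
  show "L2_norm {0<..<T} (\<lambda>t. s\<^sub>1 t - s\<^sub>2 t) \<le> sqrt ((LINT y|lborel. (\<omega> y)\<^sup>2) * (LINT q|lborel. (h\<^sub>1 q - h\<^sub>2 q)\<^sup>2))"
    by simp
qed

section \<open>The Lipschitz estimate\<close>

theorem lemma2:
  fixes l T C\<^sub>F \<rho>\<^sub>0 \<rho>\<^sub>1 \<mu>\<^sub>0 \<mu>\<^sub>1 T\<^sub>r\<^sub>0 T\<^sub>r\<^sub>1 r\<^sub>0 r\<^sub>1 \<kappa>\<^sub>0 \<kappa>\<^sub>1 C\<^sub>1 C\<^sub>L :: real
    and \<rho>\<^sub>A \<mu> T\<^sub>r r \<kappa> :: "real \<Rightarrow> real"
    and F\<^sub>1 F\<^sub>2 u\<^sub>1 u\<^sub>2 :: "real \<times> real \<Rightarrow> real"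
  assumes "l > 0" and "T > 0" and "C\<^sub>F > 0"
    and "L_infinity {0<..<l} \<rho>\<^sub>A" and "L_infinity {0<..<l} \<mu>" and "L_infinity {0<..<l} T\<^sub>r"
    and "L_infinity {0<..<l} r" and "L_infinity {0<..<l} \<kappa>"
    and "0 < \<rho>\<^sub>0" and "AE x in lebesgue_on {0<..<l}. \<rho>\<^sub>0 \<le> \<rho>\<^sub>A x \<and> \<rho>\<^sub>A x \<le> \<rho>\<^sub>1"
    and "0 \<le> T\<^sub>r\<^sub>0" and "AE x in lebesgue_on {0<..<l}. T\<^sub>r\<^sub>0 \<le> T\<^sub>r x \<and> T\<^sub>r x \<le> T\<^sub>r\<^sub>1"
    and "0 < r\<^sub>0" and "AE x in lebesgue_on {0<..<l}. r\<^sub>0 \<le> r x \<and> r x \<le> r\<^sub>1"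
    and "0 \<le> \<mu>\<^sub>0" and "AE x in lebesgue_on {0<..<l}. \<mu>\<^sub>0 \<le> \<mu> x \<and> \<mu> x \<le> \<mu>\<^sub>1"
    and "0 < \<kappa>\<^sub>0" and "AE x in lebesgue_on {0<..<l}. \<kappa>\<^sub>0 \<le> \<kappa> x \<and> \<kappa> x \<le> \<kappa>\<^sub>1"
    and "F\<^sub>1 \<in> admissible_loads l T C\<^sub>F" and "F\<^sub>2 \<in> admissible_loads l T C\<^sub>F"
    and "weak_solution l T \<rho>\<^sub>A \<mu> T\<^sub>r r \<kappa> F\<^sub>1 u\<^sub>1" and "weak_solution l T \<rho>\<^sub>A \<mu> T\<^sub>r r \<kappa> F\<^sub>2 u\<^sub>2"
    and "C\<^sub>1 > 0" and "C\<^sub>1\<^sup>2 = 5 * l * \<rho>\<^sub>0 / 3 * (exp (T / \<rho>\<^sub>0) - 1)" and "C\<^sub>L = C\<^sub>1 / sqrt r\<^sub>0"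
  shows "L2 {0<..<T} (boundary_slope l u\<^sub>1 0) \<and> L2 {0<..<T} (boundary_slope l u\<^sub>1 l) \<and>
    L2 {0<..<T} (boundary_slope l u\<^sub>2 0) \<and> L2 {0<..<T} (boundary_slope l u\<^sub>2 l) \<and>
    L2_norm {0<..<T} (\<lambda>t. boundary_slope l u\<^sub>1 0 t - boundary_slope l u\<^sub>2 0 t)
      \<le> C\<^sub>L * L2_norm (cylinder l T) (\<lambda>p. F\<^sub>1 p - F\<^sub>2 p) \<and>
    L2_norm {0<..<T} (\<lambda>t. boundary_slope l u\<^sub>1 l t - boundary_slope l u\<^sub>2 l t)
      \<le> C\<^sub>L * L2_norm (cylinder l T) (\<lambda>p. F\<^sub>1 p - F\<^sub>2 p)"
proof -
  note l = assms(1) and T = assms(2) and \<rho>\<^sub>0 = assms(9) and r\<^sub>0 = assms(13)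
  obtain \<rho>' where rho: "\<rho>' \<in> borel_measurable borel" "\<And>x. \<rho>\<^sub>0 \<le> \<rho>' x \<and> \<rho>' x \<le> \<rho>\<^sub>1" "AE x in lebesgue_on {0<..<l}. \<rho>\<^sub>A x = \<rho>' x"
    by (rule bounded_coefficient_representative[OF assms(4,10) l]) iprover
  obtain \<tau>' where tau: "\<tau>' \<in> borel_measurable borel" "\<And>x. T\<^sub>r\<^sub>0 \<le> \<tau>' x \<and> \<tau>' x \<le> T\<^sub>r\<^sub>1" "AE x in lebesgue_on {0<..<l}. T\<^sub>r x = \<tau>' x"
    by (rule bounded_coefficient_representative[OF assms(6,12) l]) iprover
  obtain r' where rr: "r' \<in> borel_measurable borel" "\<And>x. r\<^sub>0 \<le> r' x \<and> r' x \<le> r\<^sub>1" "AE x in lebesgue_on {0<..<l}. r x = r' x"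
    by (rule bounded_coefficient_representative[OF assms(7,14) l]) iprover
  obtain \<mu>' where mu: "\<mu>' \<in> borel_measurable borel" "\<And>x. \<mu>\<^sub>0 \<le> \<mu>' x \<and> \<mu>' x \<le> \<mu>\<^sub>1" "AE x in lebesgue_on {0<..<l}. \<mu> x = \<mu>' x"
    by (rule bounded_coefficient_representative[OF assms(5,16) l]) iprover
  obtain \<kappa>' where kap: "\<kappa>' \<in> borel_measurable borel" "\<And>x. \<kappa>\<^sub>0 \<le> \<kappa>' x \<and> \<kappa>' x \<le> \<kappa>\<^sub>1" "AE x in lebesgue_on {0<..<l}. \<kappa> x = \<kappa>' x"
    by (rule bounded_coefficient_representative[OF assms(8,18) l]) iprover
  have abs_le: "\<bar>c x\<bar> \<le> \<bar>lo\<bar> + \<bar>hi\<bar>" if "\<And>x. lo \<le> c x \<and> c x \<le> hi" for c :: "real \<Rightarrow> real" and lo hi x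
    using that[of x] by linarith
  note rb = abs_le[of \<rho>\<^sub>0 \<rho>' \<rho>\<^sub>1, OF rho(2)] and mb = abs_le[of \<mu>\<^sub>0 \<mu>' \<mu>\<^sub>1, OF mu(2)] and tb = abs_le[of T\<^sub>r\<^sub>0 \<tau>' T\<^sub>r\<^sub>1, OF tau(2)]
    and rrb = abs_le[of r\<^sub>0 r' r\<^sub>1, OF rr(2)] and kb = abs_le[of \<kappa>\<^sub>0 \<kappa>' \<kappa>\<^sub>1, OF kap(2)]
  have FL: "L2 (cylinder l T) F\<^sub>1" "L2 (cylinder l T) F\<^sub>2"
    using assms(19,20) by (auto simp: admissible_loads_def)
  obtain F\<^sub>1' where F1: "F\<^sub>1' \<in> borel_L2 (cylinder l T)" "AE q in lebesgue_on (cylinder l T). F\<^sub>1 q = F\<^sub>1' q"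
    by (rule L2_obtain_borel[OF FL(1) cylinder_sets])
  obtain F\<^sub>2' where F2: "F\<^sub>2' \<in> borel_L2 (cylinder l T)" "AE q in lebesgue_on (cylinder l T). F\<^sub>2 q = F\<^sub>2' q"
    by (rule L2_obtain_borel[OF FL(2) cylinder_sets])
  obtain p\<^sub>1 h\<^sub>1 where 1: "p\<^sub>1 \<in> borel_L2 (cylinder l T)" "h\<^sub>1 \<in> borel_L2 (cylinder l T)"
    "AE q in lborel. green_op l h\<^sub>1 q = in_time (primitive T) p\<^sub>1 q"
    "\<And>\<epsilon>. \<epsilon> > 0 \<Longrightarrow> averaged_equation l T \<epsilon> \<rho>' \<mu>' \<tau>' r' \<kappa>' p\<^sub>1 h\<^sub>1 F\<^sub>1'"
    "AE t in lebesgue_on {0<..<T}. boundary_slope l u\<^sub>1 0 t = (LINT y|lborel. left_slope_weight l y * h\<^sub>1 (y, t))"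
    "AE t in lebesgue_on {0<..<T}. boundary_slope l u\<^sub>1 l t = (LINT y|lborel. right_slope_weight l y * h\<^sub>1 (y, t))"
    by (rule weak_solution_representatives[OF assms(21) l T F1 rho(1) rb rho(3) mu(1) mb mu(3) tau(1) tb tau(3)
        rr(1) rrb rr(3) kap(1) kb kap(3)]) iprover
  obtain p\<^sub>2 h\<^sub>2 where 2: "p\<^sub>2 \<in> borel_L2 (cylinder l T)" "h\<^sub>2 \<in> borel_L2 (cylinder l T)"
    "AE q in lborel. green_op l h\<^sub>2 q = in_time (primitive T) p\<^sub>2 q"
    "\<And>\<epsilon>. \<epsilon> > 0 \<Longrightarrow> averaged_equation l T \<epsilon> \<rho>' \<mu>' \<tau>' r' \<kappa>' p\<^sub>2 h\<^sub>2 F\<^sub>2'"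
    "AE t in lebesgue_on {0<..<T}. boundary_slope l u\<^sub>2 0 t = (LINT y|lborel. left_slope_weight l y * h\<^sub>2 (y, t))"
    "AE t in lebesgue_on {0<..<T}. boundary_slope l u\<^sub>2 l t = (LINT y|lborel. right_slope_weight l y * h\<^sub>2 (y, t))"
    by (rule weak_solution_representatives[OF assms(22) l T F2 rho(1) rb rho(3) mu(1) mb mu(3) tau(1) tb tau(3)
        rr(1) rrb rr(3) kap(1) kb kap(3)]) iprover
  \<comment> \<open>The kinematic identity is linear and so passes to the difference, to which the
    estimate for the second derivative is then applied.\<close>
  have G: "AE q in lborel. green_op l (\<lambda>q. h\<^sub>1 q - h\<^sub>2 q) q = in_time (primitive T) (\<lambda>q. p\<^sub>1 q - p\<^sub>2 q) q"
    using in_space_diff_AE[OF kernel_green 1(2) 2(2), of 1] in_time_diff_AE[OF kernel_primitive 1(1) 2(1)] 1(3) 2(3)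
    by eventually_elim simp
  define N where "N = (LINT q|lborel. (F\<^sub>1' q - F\<^sub>2' q)\<^sup>2)"
  define H where "H = (LINT q|lborel. (h\<^sub>1 q - h\<^sub>2 q)\<^sup>2)"
  have H: "H \<le> 4 * \<rho>\<^sub>0 / r\<^sub>0 * (exp (T / \<rho>\<^sub>0) - 1) * N"
    unfolding H_def N_def
    by (rule second_derivative_estimate[OF
          averaged_equation_diff[OF 1(4) 2(4) _ 1(1) 2(1) 1(2) 2(2) F1(1) F2(1) rho(1) rb mu(1) mb tau(1) tb rr(1) rrb kap(1) kb]
          borel_L2_diff[OF 1(1) 2(1)] borel_L2_diff[OF 1(2) 2(2)] borel_L2_diff[OF F1(1) F2(1)] G T
          rho(1,2) \<rho>\<^sub>0 mu(1,2) assms(15) tau(1,2) assms(11) rr(1,2) r\<^sub>0 kap(1,2) assms(17)]) auto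
  have "AE q in lebesgue_on (cylinder l T). F\<^sub>1 q - F\<^sub>2 q = F\<^sub>1' q - F\<^sub>2' q"
    using F1(2) F2(2) by eventually_elim simp
  from borel_L2_imp_L2(2)[OF borel_L2_diff[OF F1(1) F2(1)] cylinder_sets this]
  have N: "L2_norm (cylinder l T) (\<lambda>p. F\<^sub>1 p - F\<^sub>2 p) = sqrt N" by (simp add: N_def)
  have E: "exp (T / \<rho>\<^sub>0) - 1 > 0" using T \<rho>\<^sub>0 by simp
  have N0: "N \<ge> 0" by (simp add: N_def)
  \<comment> \<open>l / 3 is the squared norm of either slope weight. The product has the factor 4
    where \<open>C\<^sub>1\<^sup>2\<close> has 5.\<close>
  have "l / 3 * H \<le> l / 3 * (4 * \<rho>\<^sub>0 / r\<^sub>0 * (exp (T / \<rho>\<^sub>0) - 1) * N)"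
    using H l by (intro mult_left_mono) auto
  also have "\<dots> = 4 * (l * \<rho>\<^sub>0 / (3 * r\<^sub>0) * (exp (T / \<rho>\<^sub>0) - 1) * N)" by simp
  also have "\<dots> \<le> 5 * (l * \<rho>\<^sub>0 / (3 * r\<^sub>0) * (exp (T / \<rho>\<^sub>0) - 1) * N)"
    using l \<rho>\<^sub>0 r\<^sub>0 E N0 by (intro mult_right_mono) auto
  also have "\<dots> = C\<^sub>1\<^sup>2 / r\<^sub>0 * N" by (simp add: assms(24))
  also have "\<dots> = C\<^sub>L\<^sup>2 * N" using r\<^sub>0 by (simp add: assms(25) power_divide)
  finally have HN: "l / 3 * H \<le> C\<^sub>L\<^sup>2 * N" .
  \<comment> \<open>The sign matters for taking the square root of
    \<open>C\<^sub>L\<^sup>2\<close>.\<close>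
  have "C\<^sub>L \<ge> 0" using assms(23) r\<^sub>0 by (simp add: assms(25))
  then have sq: "sqrt (C\<^sub>L\<^sup>2 * N) = C\<^sub>L * sqrt N" by (simp add: real_sqrt_mult)
  have bound: "sqrt (l / 3 * H) \<le> C\<^sub>L * L2_norm (cylinder l T) (\<lambda>p. F\<^sub>1 p - F\<^sub>2 p)"
    unfolding N sq[symmetric] using HN by (rule real_sqrt_le_mono)
  note s0 = slope_difference_estimate[OF 1(2) 2(2) slope_weights_borel_L2(1) 1(5) 2(5),
      unfolded integral_slope_weights_square(1)[OF l] H_def[symmetric]]
  note sl = slope_difference_estimate[OF 1(2) 2(2) slope_weights_borel_L2(2) 1(6) 2(6),
      unfolded integral_slope_weights_square(2)[OF l] H_def[symmetric]]
  show ?thesis using s0 sl bound by (auto intro: order_trans)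
qed

end
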